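(* Let $d,n\ge 1$, $\varepsilon\in(0,1)$ and $$\delta\le \frac{1}{3n\ln(en)}.$$ There is a probability distribution for a random positive definite matrix $\Sigma\in\mathbb{R}^{d\times d}$ such that the following holds for every $(\varepsilon,\delta)$-differentially private mechanism $\mathcal{M}\colon(\mathbb{R}^d)^n\to\mathbb{R}^{d\times d}$: if the error $\alpha$ of $\mathcal{M}$ (defined below) satisfies $\alpha\in[2^{-d},\sqrt{d}/15]$, then $$n=\Omega\Big(\frac{d^2}{\varepsilon\alpha}\Big),$$ where the constant implicit in $\Omega$ is absolute.
   Context: The input of $\mathcal{M}$ is a matrix $X\in\mathbb{R}^{d\times n}$ with columns $x_1,\dots,x_n$; $\mathcal{M}$ may be randomized (with internal randomness independent of everything else). $\mathcal{M}$ is $(\varepsilon,\delta)$-differentially private if for all $X,X'\in\mathbb{R}^{d\times n}$ differing in exactly one column and every measurable set $S$, $\Pr[\mathcal{M}(X)\in S]\le e^{\varepsilon}\Pr[\mathcal{M}(X')\in S]+\delta$. Data model: $\Sigma$ is drawn from the given distribution, and conditionally on $\Sigma$ the columns $x_1,\dots,x_n$ are i.i.d. $\mathcal{N}(0,\Sigma)$. Let $\mathcal{W}=\{A \text{ symmetric}: 0.09 I\preceq A\preceq 10 I\}$. Define $\alpha_\Sigma^2=\mathbb{E}[\|\mathcal{M}(X)-\Sigma\|_F^2\mid\Sigma]$ and the error $\alpha\ge 0$ by $\alpha^2=\mathbb{E}[\alpha_\Sigma^2\mid \Sigma\in\mathcal{W}]$, where $\|\cdot\|_F$ is the Frobenius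 norm. *)

theory Defs
  imports "HOL-Probability.Probability"
begin

text \<open>Conventions. A d-by-d real matrix is a function A :: nat => nat => real, entry (i,j) = A i j,
  living in the product measure space over indices {..<d} x {..<d}.  A data matrix X in R^(d x n)
  is represented column-wise: X j is the j-th column (j < n), and X j i its i-th coordinate (i < d).\<close>

definition vec_space :: "nat \<Rightarrow> (nat \<Rightarrow> real) measure" where
  "vec_space d = PiM {..<d} (\<lambda>_. lborel)"

definition mat_space :: "nat \<Rightarrow> (nat \<Rightarrow> nat \<Rightarrow> real) measure" where
  "mat_space d = PiM {..<d} (\<lambda>_. vec_space d)"

definition data_space :: "nat \<Rightarrow> nat \<Rightarrow> (nat \<Rightarrow> nat \<Rightarrow> real) measure" where
  "data_space d n = PiM {..<n} (\<lambda>_. vec_space d)"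

definition symmetric_mat :: "nat \<Rightarrow> (nat \<Rightarrow> nat \<Rightarrow> real) \<Rightarrow> bool" where
  "symmetric_mat d A \<longleftrightarrow> (\<forall>i<d. \<forall>j<d. A i j = A j i)"

definition quad_form :: "nat \<Rightarrow> (nat \<Rightarrow> nat \<Rightarrow> real) \<Rightarrow> (nat \<Rightarrow> real) \<Rightarrow> real" where
  "quad_form d A x = (\<Sum>i<d. \<Sum>j<d. x i * A i j * x j)"

definition pos_def :: "nat \<Rightarrow> (nat \<Rightarrow> nat \<Rightarrow> real) \<Rightarrow> bool" where
  "pos_def d A \<longleftrightarrow> symmetric_mat d A \<and> (\<forall>x. (\<exists>i<d. x i \<noteq> 0) \<longrightarrow> quad_form d A x > 0)"

definition W_set :: "nat \<Rightarrow> (nat \<Rightarrow> nat \<Rightarrow> real) set" where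
  "W_set d = {A \<in> space (mat_space d). symmetric_mat d A \<and>
      (\<forall>x. 0.09 * (\<Sum>i<d. (x i)\<^sup>2) \<le> quad_form d A x \<and> quad_form d A x \<le> 10 * (\<Sum>i<d. (x i)\<^sup>2))}"

text \<open>A square root factor A with A A^T = Sigma (exists for positive semidefinite Sigma).\<close>
definition sqrt_factor :: "nat \<Rightarrow> (nat \<Rightarrow> nat \<Rightarrow> real) \<Rightarrow> (nat \<Rightarrow> nat \<Rightarrow> real)" where
  "sqrt_factor d S = (SOME A. \<forall>i<d. \<forall>j<d. (\<Sum>k<d. A i k * A j k) = S i j)"

definition gaussian :: "nat \<Rightarrow> (nat \<Rightarrow> nat \<Rightarrow> real) \<Rightarrow> (nat \<Rightarrow> real) measure" where
  "gaussian d S = distr (PiM {..<d} (\<lambda>_. density lborel std_normal_density)) (vec_space d)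
      (\<lambda>z. \<lambda>i\<in>{..<d}. \<Sum>k<d. sqrt_factor d S i k * z k)"

definition data_law :: "nat \<Rightarrow> nat \<Rightarrow> (nat \<Rightarrow> nat \<Rightarrow> real) \<Rightarrow> (nat \<Rightarrow> nat \<Rightarrow> real) measure" where
  "data_law d n S = PiM {..<n} (\<lambda>_. gaussian d S)"

definition mechanism :: "nat \<Rightarrow> nat \<Rightarrow> ((nat \<Rightarrow> nat \<Rightarrow> real) \<Rightarrow> (nat \<Rightarrow> nat \<Rightarrow> real) measure) \<Rightarrow> bool" where
  "mechanism d n M \<longleftrightarrow> M \<in> measurable (data_space d n) (subprob_algebra (mat_space d)) \<and>
      (\<forall>X\<in>space (data_space d n). prob_space (M X))"

definition neighbours :: "nat \<Rightarrow> nat \<Rightarrow> (nat \<Rightarrow> nat \<Rightarrow> real) \<Rightarrow> (nat \<Rightarrow> nat \<Rightarrow> real) \<Rightarrow> bool" where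
  "neighbours d n X X' \<longleftrightarrow> X \<in> space (data_space d n) \<and> X' \<in> space (data_space d n) \<and>
      (\<exists>j<n. X j \<noteq> X' j \<and> (\<forall>k<n. k \<noteq> j \<longrightarrow> X k = X' k))"

definition diff_private :: "nat \<Rightarrow> nat \<Rightarrow> real \<Rightarrow> real \<Rightarrow> ((nat \<Rightarrow> nat \<Rightarrow> real) \<Rightarrow> (nat \<Rightarrow> nat \<Rightarrow> real) measure) \<Rightarrow> bool" where
  "diff_private d n \<epsilon> \<delta> M \<longleftrightarrow> (\<forall>X X'. neighbours d n X X' \<longrightarrow>
      (\<forall>S\<in>sets (mat_space d). measure (M X) S \<le> exp \<epsilon> * measure (M X') S + \<delta>))"

definition frob_sq :: "nat \<Rightarrow> (nat \<Rightarrow> nat \<Rightarrow> real) \<Rightarrow> (nat \<Rightarrow> nat \<Rightarrow> real) \<Rightarrow> real" where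
  "frob_sq d A B = (\<Sum>i<d. \<Sum>j<d. (A i j - B i j)\<^sup>2)"

definition err_given :: "nat \<Rightarrow> nat \<Rightarrow> ((nat \<Rightarrow> nat \<Rightarrow> real) \<Rightarrow> (nat \<Rightarrow> nat \<Rightarrow> real) measure)
    \<Rightarrow> (nat \<Rightarrow> nat \<Rightarrow> real) \<Rightarrow> ennreal" where
  "err_given d n M S = (\<integral>\<^sup>+ X. (\<integral>\<^sup>+ A. ennreal (frob_sq d A S) \<partial>M X) \<partial>data_law d n S)"

definition err_sq :: "nat \<Rightarrow> nat \<Rightarrow> (nat \<Rightarrow> nat \<Rightarrow> real) measure
    \<Rightarrow> ((nat \<Rightarrow> nat \<Rightarrow> real) \<Rightarrow> (nat \<Rightarrow> nat \<Rightarrow> real) measure) \<Rightarrow> ennreal" where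
  "err_sq d n P M = (\<integral>\<^sup>+ S. indicator (W_set d) S * err_given d n M S \<partial>P) / emeasure P (W_set d)"

end

theory Submission
  imports Defs
begin

text \<open>
  For small d the prior puts equal mass on two multiples of the identity: group privacy over all
  n samples makes the output of a mechanism with n * eps small almost independent of the data.

  For large d the data are a random-design linear regression. With m = d div 2 write a sample as
  x = (u, v), where u is standard normal on the first m coordinates and v = gamma B u + w with
  standard normal noise w; the entries of B are independent and uniform on [-1, 1], and
  gamma = 1 / (3 sqrt d). The lower left block of the covariance is exactly gamma B, so the mechanism
  estimates B, and the log-likelihood has the gradient gamma (sum over samples of w u^T) in B.
  Integration by parts in B with the weight 1 - b^2 (a fingerprinting identity) shows that the
  correlation of an accurate output with these scores, summed over the samples, is of order d^2.
  By privacy a single sample contributes only O(eps * alpha), up to a term that is small since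
  n * delta is at most 1/3. A net argument shows that the covariance lies in the window except with
  probability 8^-d, and clipping the output to [-gamma, gamma] keeps the exceptional part harmless.
\<close>

section \<open>Gaussian laws depend only on the covariance\<close>

text \<open>The factor \<open>sqrt_factor\<close> in the data model is a Hilbert choice, known only
  through its Gram matrix; a uniqueness theorem for Gaussian laws is the price for replacing it by
  the unit triangular \<open>factor B\<close>. That factor is chosen because its law has an explicit
  density against the standard normal, with an exponent quadratic in B and no determinant or
  inverse, and because one block of the covariance is linear in B. The weight 1 - b^2 vanishes at
  the ends of [-1, 1] and so removes the boundary terms. The scores are unbounded, but the additive
  privacy loss is charged against their first absolute moment instead of a truncation level, which
  makes the total charge of order n * \<delta> * \<gamma> * d^2, below the main term. The error is
  controlled on the window only, and the lower limit 2^-d for \<alpha> lets the exceptional part, at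
  most 4^-d, be absorbed into \<alpha>^2. On the block \<open>K\<close> the constant estimate 0 has
  mean squared error \<gamma>^2 * card K / 3, about d/108; the upper limit sqrt d / 15 keeps
  \<alpha>^2 below this with room for the constants.\<close>

lemma finite_measure_eqI_cos:
  fixes \<mu> \<nu> :: "real measure"
  assumes fin: "finite_measure \<mu>" "finite_measure \<nu>"
    and sets[simp]: "sets \<mu> = sets borel" "sets \<nu> = sets borel"
    and eq: "\<And>s c. (\<integral>x. cos (s * x + c) \<partial>\<mu>) = (\<integral>x. cos (s * x + c) \<partial>\<nu>)"
  shows "\<mu> = \<nu>"
proof -
  interpret \<mu>: finite_measure \<mu> by fact
  interpret \<nu>: finite_measure \<nu> by fact
  have sp[simp]: "space \<mu> = UNIV" "space \<nu> = UNIV"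
    using sets_eq_imp_space_eq[OF sets(1)] sets_eq_imp_space_eq[OF sets(2)] by auto
  note [measurable_cong] = sets
  define r where "r = measure \<mu> UNIV"
  have r: "measure \<nu> UNIV = r"
    using eq[of 0 0] by (simp add: r_def)
  \<comment> \<open>The phases 0 and -pi/2 turn the cosine into the real and the imaginary part of
    the characteristic function.\<close>
  have char_form: "(\<integral>x. iexp (t * x) \<partial>M) =
      Complex (\<integral>x. cos (t * x + 0) \<partial>M) (\<integral>x. cos (t * x + - (pi / 2)) \<partial>M)"
    if "finite_measure M" and [measurable_cong]: "sets M = sets borel" for t and M :: "real measure"
  proof -
    interpret finite_measure M by fact
    have i: "integrable M (\<lambda>x. iexp (t * x))"
      by (intro integrable_const_bound[where B = 1]) auto
    have "Re (\<integral>x. iexp (t * x) \<partial>M) = (\<integral>x. cos (t * x + 0) \<partial>M)"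
      using i by (subst integral_Re[symmetric]) (auto simp: Re_exp)
    moreover have "Im (\<integral>x. iexp (t * x) \<partial>M) = (\<integral>x. cos (t * x + - (pi / 2)) \<partial>M)"
      using i by (subst integral_Im[symmetric]) (auto simp: Im_exp cos_diff)
    ultimately show ?thesis by (simp add: complex_eq_iff)
  qed
  show ?thesis
  proof (cases "r = 0")
    case True
    then have "emeasure \<mu> UNIV = 0" "emeasure \<nu> UNIV = 0"
      using r by (simp_all add: r_def \<mu>.emeasure_eq_measure \<nu>.emeasure_eq_measure)
    then have "emeasure \<mu> A = 0 \<and> emeasure \<nu> A = 0" for A
      by (metis emeasure_eq_0 sets(1,2) sets.top sp subset_UNIV)
    then show ?thesis by (intro measure_eqI) auto
  next
    case False
    then have rp: "r > 0" unfolding r_def by (simp add: zero_less_measure_iff)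
    \<comment> \<open>Levy uniqueness concerns probability measures. Both measures have the mass r
      (frequency and phase 0), so division by r reduces to that case.\<close>
    define N where "N M = density M (\<lambda>_. ennreal (1 / r))" for M :: "real measure"
    have N_dist: "real_distribution (N M)"
      if "finite_measure M" "sets M = sets borel" "measure M UNIV = r" for M
    proof -
      interpret finite_measure M by fact
      have [simp]: "space M = UNIV" using sets_eq_imp_space_eq[OF that(2)] by simp
      have "emeasure (N M) (space (N M)) = ennreal (1 / r) * emeasure M UNIV"
        by (simp add: N_def emeasure_density_const that)
      also have "\<dots> = 1"
        using rp by (simp add: emeasure_eq_measure that flip: ennreal_mult)
      finally have "prob_space (N M)" by (rule prob_spaceI)
      then show ?thesis
        by (intro real_distribution.intro real_distribution_axioms.intro) (auto simp: N_def that)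
    qed
    have char_N: "char (N M) t = (1 / r) *\<^sub>R (\<integral>x. iexp (t * x) \<partial>M)"
      if [measurable_cong]: "sets M = sets borel" for M t
      unfolding char_def N_def using rp
      by (subst integral_density) (auto)
    have "char (N \<mu>) = char (N \<nu>)"
      unfolding char_N[OF sets(1), THEN ext] char_N[OF sets(2), THEN ext]
        char_form[OF fin(1) sets(1)] char_form[OF fin(2) sets(2)] eq ..
    then have "N \<mu> = N \<nu>"
      using N_dist[OF fin(1) sets(1)] N_dist[OF fin(2) sets(2)] r
      by (intro Levy_uniqueness) (auto simp: r_def)
    then have *: "emeasure (N \<mu>) A = emeasure (N \<nu>) A" for A by simp
    show ?thesis
    proof (rule measure_eqI)
      fix A assume A: "A \<in> sets \<mu>"
      have "ennreal (1 / r) * emeasure \<mu> A = ennreal (1 / r) * emeasure \<nu> A"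
        using *[of A] A by (simp add: N_def emeasure_density_const)
      then show "emeasure \<mu> A = emeasure \<nu> A"
        using rp by (auto simp: ennreal_mult_cancel_left)
    qed simp
  qed
qed

text \<open>The indicators of a box are introduced one coordinate at a time: for fixed earlier
  indicators and later frequencies, weighting by the nonnegative function 1 + cos turns the law of
  the current coordinate into a finite measure on the line, which Levy's theorem identifies.\<close>

lemma PiM_eqI_cos:
  fixes \<mu> \<nu> :: "(nat \<Rightarrow> real) measure"
  assumes prob: "prob_space \<mu>" "prob_space \<nu>"
    and sets: "sets \<mu> = sets (PiM {..<d} (\<lambda>_. borel))" "sets \<nu> = sets (PiM {..<d} (\<lambda>_. borel))"
    and eq: "\<And>t c. (\<integral>x. cos ((\<Sum>i<d. t i * x i) + c) \<partial>\<mu>) = (\<integral>x. cos ((\<Sum>i<d. t i * x i) + c) \<partial>\<nu>)"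
  shows "\<mu> = \<nu>"
proof -
  define w :: "nat \<Rightarrow> (nat \<Rightarrow> real set) \<Rightarrow> (nat \<Rightarrow> real) \<Rightarrow> real"
    where "w k E x = (\<Prod>i<k. indicator (E i) (x i))" for k E x
  define F where "F M k E t c = (\<integral>x. w k E x * cos ((\<Sum>i\<in>{k..<d}. t i * x i) + c) \<partial>M)"
    for M :: "(nat \<Rightarrow> real) measure" and k E t and c :: real
  let ?ok = "\<lambda>M. prob_space M \<and> sets M = sets (PiM {..<d} (\<lambda>_. borel :: real measure))"
  have w01: "0 \<le> w k E x" "w k E x \<le> 1" for k E x
    unfolding w_def by (auto intro!: prod_nonneg prod_le_1)
  have wm: "w k E \<in> borel_measurable M" if "?ok M" "k \<le> d" "\<And>i. E i \<in> sets borel" for M k E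
  proof -
    have sM[measurable_cong]: "sets M = sets (PiM {..<d} (\<lambda>_. borel :: real measure))" using that by auto
    note that(3)[measurable]
    have "(\<lambda>x. indicator (E i) (x i) :: real) \<in> borel_measurable M" if "i < k" for i
    proof -
      have [measurable]: "i \<in> {..<d}" using \<open>k \<le> d\<close> that by auto
      show ?thesis by measurable
    qed
    then show ?thesis unfolding w_def by (intro borel_measurable_prod) auto
  qed
  have cm: "(\<lambda>x. cos ((\<Sum>i\<in>I. t i * x i) + c)) \<in> borel_measurable M" if "?ok M" "I \<subseteq> {..<d}" for M I t c
  proof -
    have sM[measurable_cong]: "sets M = sets (PiM {..<d} (\<lambda>_. borel :: real measure))" using that by auto
    have [measurable]: "(\<lambda>x. x i) \<in> borel_measurable M" if "i \<in> I" for i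
    proof -
      have i: "i \<in> {..<d}" using \<open>I \<subseteq> {..<d}\<close> that by auto
      show ?thesis by (rule measurable_compose[OF measurable_ident_sets[OF sM] measurable_component_singleton[OF i]])
    qed
    show ?thesis by measurable
  qed
  have int: "integrable M (\<lambda>x. w k E x * cos ((\<Sum>i\<in>I. t i * x i) + c))"
    if "?ok M" "k \<le> d" "\<And>i. E i \<in> sets borel" "I \<subseteq> {..<d}" for M k E I t c
  proof -
    interpret prob_space M using that by auto
    show ?thesis
      using wm[OF that(1-3)] cm[OF that(1,4)]
      by (intro integrable_const_bound[where B = 1] AE_I2)
        (auto simp: abs_mult intro!: mult_le_one w01 abs_cos_le_one simp: w01)
  qed
  have main: "F \<mu> k E t c = F \<nu> k E t c" if "k \<le> d" "\<And>i. E i \<in> sets borel" for k E t c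
    using that
  proof (induction k arbitrary: E t c)
    case 0
    then show ?case using eq by (simp add: F_def w_def lessThan_atLeast0)
  next
    case (Suc k)
    then have k: "k < d" by simp
    have split: "(\<Sum>i\<in>{k..<d}. t i * x i) = t k * x k + (\<Sum>i\<in>{Suc k..<d}. t i * x i)" for t x :: "nat \<Rightarrow> real"
      using k by (simp add: sum.atLeast_Suc_lessThan)
    have sub: "{Suc k..<d} \<subseteq> {..<d}" by auto
    define g where "g t c x = w k E x * (1 + cos ((\<Sum>i\<in>{Suc k..<d}. t i * x i) + c))" for t :: "nat \<Rightarrow> real" and c x
    have g0: "0 \<le> g t c x" for t c x
    proof -
      have "0 \<le> 1 + cos y" for y :: real using cos_ge_minus_one[of y] by linarith
      then show ?thesis unfolding g_def using w01 by (intro mult_nonneg_nonneg) blast+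
    qed
    have gm: "g t c \<in> borel_measurable M" if "?ok M" for M t c
      unfolding g_def using wm[OF that, of k E] cm[OF that sub] k Suc.prems(2)
      by (intro borel_measurable_times borel_measurable_add) auto
    have gi: "integrable M (g t c)" if "?ok M" for M t c
      unfolding g_def using int[OF that, of k E "{}" "\<lambda>_. 0" 0] int[OF that _ _ sub, of k E t c] k Suc.prems(2)
      by (simp add: distrib_left) 
    have km: "(\<lambda>x. x k) \<in> borel_measurable M" if "?ok M" for M
    proof -
      have sM[measurable_cong]: "sets M = sets (PiM {..<d} (\<lambda>_. borel :: real measure))" using that by auto
      have k': "k \<in> {..<d}" using k by simp
      show ?thesis by (rule measurable_compose[OF measurable_ident_sets[OF sM] measurable_component_singleton[OF k']])
    qed
    define D where "D M t c = distr (density M (\<lambda>x. ennreal (g t c x))) borel (\<lambda>x. x k)" for M t c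
    have D_fin: "finite_measure (D M t c)" if "?ok M" for M t c
    proof -
      have "emeasure (density M (\<lambda>x. ennreal (g t c x))) (space M) = (\<integral>\<^sup>+x. ennreal (g t c x) \<partial>M)"
        using gm[OF that] by (subst emeasure_density) (auto intro!: nn_integral_cong)
      also have "\<dots> < \<infinity>"
        using gi[OF that, of t c] g0 by (simp add: nn_integral_eq_integral)
      finally have "finite_measure (density M (\<lambda>x. ennreal (g t c x)))"
        by (intro finite_measureI) auto
      then show ?thesis
        unfolding D_def using km[OF that] by (intro finite_measure.finite_measure_distr) auto
    qed
    have D_int: "(\<integral>y. f y \<partial>D M t c) = (\<integral>x. g t c x * f (x k) \<partial>M)"
      if "?ok M" and [measurable]: "f \<in> borel_measurable borel" for M t c and f :: "real \<Rightarrow> real"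
    proof -
      note [measurable] = gm[OF that(1)] km[OF that(1)]
      show ?thesis
        unfolding D_def using g0 by (subst integral_distr) (auto simp: integral_density)
    qed
    \<comment> \<open>The product of two cosines splits into cosines of sum and difference. The
      transform of \<open>D\<close> is thus a combination of values of \<open>F\<close> at stage k,
      with frequency s in coordinate k and t, -t or 0 behind it, all covered by the induction
      hypothesis.\<close>
    have D_cos: "(\<integral>y. cos (s * y + a) \<partial>D M t c) =
        F M k E (\<lambda>i. if i = k then s else 0) a
        + 1 / 2 * F M k E (\<lambda>i. if i = k then s else t i) (a + c)
        + 1 / 2 * F M k E (\<lambda>i. if i = k then s else - t i) (a - c)" if "?ok M" for M t c s a
    proof -
      let ?S = "\<lambda>x. \<Sum>i\<in>{Suc k..<d}. t i * x i"
      have 1: "g t c x * cos (s * x k + a) = w k E x * cos ((\<Sum>i\<in>{k..<d}. (if i = k then s else 0) * x i) + a)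
        + 1 / 2 * (w k E x * cos ((\<Sum>i\<in>{k..<d}. (if i = k then s else t i) * x i) + (a + c)))
        + 1 / 2 * (w k E x * cos ((\<Sum>i\<in>{k..<d}. (if i = k then s else - t i) * x i) + (a - c)))" for x
      proof -
        have "(\<Sum>i\<in>{k..<d}. (if i = k then s else 0) * x i) = s * x k"
          "(\<Sum>i\<in>{k..<d}. (if i = k then s else t i) * x i) = s * x k + ?S x"
          "(\<Sum>i\<in>{k..<d}. (if i = k then s else - t i) * x i) = s * x k - ?S x"
          unfolding split by (auto simp: sum_negf)
        moreover have "cos (?S x + c) * cos (s * x k + a) =
            1 / 2 * cos (s * x k + ?S x + (a + c)) + 1 / 2 * cos (s * x k - ?S x + (a - c))"
        proof -
          have 1: "cos ((?S x + c) - (s * x k + a)) = cos (s * x k - ?S x + (a - c))"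
            by (subst cos_minus[symmetric]) (simp add: algebra_simps)
          have 2: "(?S x + c) + (s * x k + a) = s * x k + ?S x + (a + c)" by simp
          show ?thesis unfolding cos_times_cos 1 2 by simp
        qed
        ultimately show ?thesis
          unfolding g_def by (simp only: distrib_left distrib_right mult_1_right mult.assoc mult.left_commute[of "1/2"])
      qed
      have I: "integrable M (\<lambda>x. w k E x * cos ((\<Sum>i\<in>{k..<d}. t i * x i) + c))" for t c
        using k Suc.prems(2) by (intro int[OF that]) auto
      show ?thesis
        unfolding F_def using I by (subst D_int[OF that]) (auto simp: 1)
    qed
    have ok: "?ok \<mu>" "?ok \<nu>" using prob sets by auto
    have "D \<mu> t c = D \<nu> t c" for t c
    proof (rule finite_measure_eqI_cos)
      show "(\<integral>y. cos (s * y + a) \<partial>D \<mu> t c) = (\<integral>y. cos (s * y + a) \<partial>D \<nu> t c)" for s a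
        unfolding D_cos[OF ok(1)] D_cos[OF ok(2)] using k Suc.prems by (simp add: Suc.IH)
    qed (auto simp: D_fin ok, auto simp: D_def)
    then have G: "(\<integral>x. g t c x * indicator (E k) (x k) \<partial>\<mu>) = (\<integral>x. g t c x * indicator (E k) (x k) \<partial>\<nu>)" for t c
      using D_int[OF ok(1), of "indicator (E k)"] D_int[OF ok(2), of "indicator (E k)"] Suc.prems(2) by simp
    \<comment> \<open>For t = 0 and c = 0 the weight 1 + cos equals 2, so half of that integral is
      exactly the surplus caused by the added 1.\<close>
    have F_eq: "F M (Suc k) E t c = (\<integral>x. g t c x * indicator (E k) (x k) \<partial>M)
        - 1 / 2 * (\<integral>x. g (\<lambda>_. 0) 0 x * indicator (E k) (x k) \<partial>M)" if "?ok M" for M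
    proof -
      have 1: "integrable M (\<lambda>x. g t c x * indicator (E k) (x k))" for t c
      proof -
        note [measurable] = gm[OF that] km[OF that] and Suc.prems(2)[measurable]
        show ?thesis
          by (rule Bochner_Integration.integrable_bound[OF gi[OF that, of t c]]) (auto simp: indicator_def)
      qed
      have "F M (Suc k) E t c = (\<integral>x. g t c x * indicator (E k) (x k)
          - 1 / 2 * (g (\<lambda>_. 0) 0 x * indicator (E k) (x k)) \<partial>M)"
        unfolding F_def g_def w_def by (intro Bochner_Integration.integral_cong) (auto simp: algebra_simps)
      also have "\<dots> = (\<integral>x. g t c x * indicator (E k) (x k) \<partial>M)
        - 1 / 2 * (\<integral>x. g (\<lambda>_. 0) 0 x * indicator (E k) (x k) \<partial>M)"
        using 1 by simp
      finally show ?thesis .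
    qed
    show ?case unfolding F_eq[OF ok(1)] F_eq[OF ok(2)] G ..
  qed
  interpret \<mu>: prob_space \<mu> by fact
  interpret \<nu>: prob_space \<nu> by fact
  show ?thesis
  proof (rule measure_eqI_PiM_finite[where I = "{..<d}" and M = "\<lambda>_. borel" and A = "\<lambda>_. space (PiM {..<d} (\<lambda>_. borel))"])
    fix A :: "nat \<Rightarrow> real set" assume A: "\<And>i. i \<in> {..<d} \<Longrightarrow> A i \<in> sets borel"
    \<comment> \<open>The value UNIV off the index range makes every \<open>E i\<close> a Borel set,
      as \<open>main\<close> asks for.\<close>
    define E where "E i = (if i < d then A i else UNIV)" for i
    have E: "E i \<in> sets borel" for i using A by (auto simp: E_def)
    have box: "emeasure M (Pi\<^sub>E {..<d} A) = ennreal (F M d E (\<lambda>_. 0) 0)" if "?ok M" for M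
    proof -
      interpret prob_space M using that by auto
      have S: "Pi\<^sub>E {..<d} A \<in> sets M" using that A by (auto intro!: sets_PiM_I_finite)
      have "F M d E (\<lambda>_. 0) 0 = (\<integral>x. indicator (Pi\<^sub>E {..<d} A) x \<partial>M)"
        unfolding F_def
      proof (intro Bochner_Integration.integral_cong refl)
        fix x assume "x \<in> space M"
        then have x: "x \<in> extensional {..<d}"
          using that sets_eq_imp_space_eq[of M "PiM {..<d} (\<lambda>_. borel)"] by (auto simp: space_PiM PiE_def)
        have "w d E x = (if \<forall>i<d. x i \<in> A i then 1 else 0)"
          unfolding w_def by (auto simp: E_def indicator_def intro!: prod_zero)
        also have "\<dots> = indicator (Pi\<^sub>E {..<d} A) x"
          using x by (auto simp: PiE_def indicator_def)
        finally show "w d E x * cos ((\<Sum>i\<in>{d..<d}. 0 * x i) + 0) = indicator (Pi\<^sub>E {..<d} A) x" by simp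
      qed
      then show ?thesis using S by (simp add: emeasure_eq_measure)
    qed
    show "emeasure \<mu> (Pi\<^sub>E {..<d} A) = emeasure \<nu> (Pi\<^sub>E {..<d} A)"
      using box[of \<mu>] box[of \<nu>] main[OF order_refl E] prob sets by simp
  qed (use sets space_in_prod_algebra[of "{..<d}" "\<lambda>_. borel :: real measure"] in \<open>auto simp: space_PiM\<close>)
qed


section \<open>Standard normal vectors and their linear images\<close>

abbreviation std_normal_vec :: "nat \<Rightarrow> (nat \<Rightarrow> real) measure" where
  "std_normal_vec d \<equiv> PiM {..<d} (\<lambda>_. std_normal_distribution)"

lemma prob_space_std_normal: "prob_space std_normal_distribution"
  using real_dist_normal_dist by (simp add: real_distribution_def)

interpretation std_normal: prob_space std_normal_distribution
  by (rule prob_space_std_normal)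

interpretation std_normal_prod: product_sigma_finite "\<lambda>_::'i. std_normal_distribution"
  by unfold_locales

lemma prob_space_std_normal_vec: "prob_space (std_normal_vec d)"
  by (intro prob_space_PiM prob_space_std_normal)

lemma sets_vec_space [measurable_cong]: "sets (vec_space d) = sets (PiM {..<d} (\<lambda>_. borel :: real measure))"
  unfolding vec_space_def by (intro sets_PiM_cong) auto

lemma sets_std_normal_vec [measurable_cong]: "sets (std_normal_vec d) = sets (vec_space d)"
  unfolding vec_space_def by (intro sets_PiM_cong) auto

lemma measurable_vec_component: "i < d \<Longrightarrow> (\<lambda>x. x i) \<in> borel_measurable (vec_space d)"
  using measurable_component_singleton[of i "{..<d}" "\<lambda>_. lborel :: real measure"]
  by (simp add: vec_space_def)

text \<open>Real part of the characteristic function of a product measure; the phase enters as the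
  factor \<open>cis c\<close>.\<close>

lemma std_normal_vec_cos:
  "(\<integral>z. cos ((\<Sum>k<d. s k * z k) + c) \<partial>std_normal_vec d) = exp (- (\<Sum>k<d. (s k)\<^sup>2) / 2) * cos c"
proof -
  interpret P: prob_space "std_normal_vec d" by (rule prob_space_std_normal_vec)
  have int1: "integrable std_normal_distribution (\<lambda>x. iexp (a * x))" for a :: real
    by (intro std_normal.integrable_const_bound[where B = 1]) auto
  have "(\<integral>z. iexp (\<Sum>k<d. s k * z k) \<partial>std_normal_vec d) = (\<integral>z. (\<Prod>k<d. iexp (s k * z k)) \<partial>std_normal_vec d)"
    by (simp add: exp_sum sum_distrib_left)
  also have "\<dots> = (\<Prod>k<d. \<integral>x. iexp (s k * x) \<partial>std_normal_distribution)"
    by (intro std_normal_prod.product_integral_prod int1) auto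
  also have "\<dots> = (\<Prod>k<d. complex_of_real (exp (- (s k)\<^sup>2 / 2)))"
    using char_std_normal_distribution by (simp add: char_def fun_eq_iff)
  also have "\<dots> = complex_of_real (exp (\<Sum>k<d. - (s k)\<^sup>2 / 2))"
    by (simp add: exp_sum)
  also have "(\<Sum>k<d. - (s k)\<^sup>2 / 2) = - (\<Sum>k<d. (s k)\<^sup>2) / 2"
    by (simp add: sum_negf sum_divide_distrib)
  finally have *: "(\<integral>z. iexp (\<Sum>k<d. s k * z k) \<partial>std_normal_vec d) = complex_of_real (exp (- (\<Sum>k<d. (s k)\<^sup>2) / 2))" .
  have m: "(\<lambda>z. \<Sum>k<d. s k * z k) \<in> borel_measurable (std_normal_vec d)"
    by (intro borel_measurable_sum) measurable
  have "(\<integral>z. cos ((\<Sum>k<d. s k * z k) + c) \<partial>std_normal_vec d) =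
      (\<integral>z. Re (cis c * iexp (\<Sum>k<d. s k * z k)) \<partial>std_normal_vec d)"
    by (intro Bochner_Integration.integral_cong refl)
      (simp add: cos_add Re_exp Im_exp del: of_real_sum)
  also have "\<dots> = Re (\<integral>z. cis c * iexp (\<Sum>k<d. s k * z k) \<partial>std_normal_vec d)"
    using m by (intro integral_Re P.integrable_const_bound[where B = 1]) (auto simp: norm_mult)
  also have "\<dots> = Re (cis c * complex_of_real (exp (- (\<Sum>k<d. (s k)\<^sup>2) / 2)))"
    by (simp add: * del: of_real_sum)
  finally show ?thesis by simp
qed

text \<open>The construction in \<open>gaussian\<close> with the factor left open, so that the
  chosen \<open>sqrt_factor\<close> and a convenient factor become instances of one law.\<close>

definition linear_law :: "nat \<Rightarrow> (nat \<Rightarrow> nat \<Rightarrow> real) \<Rightarrow> (nat \<Rightarrow> real) measure" where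
  "linear_law d A = distr (std_normal_vec d) (vec_space d) (\<lambda>z. \<lambda>i\<in>{..<d}. \<Sum>k<d. A i k * z k)"

lemma linear_map_measurable [measurable]:
  "(\<lambda>z. \<lambda>i\<in>{..<d}. \<Sum>k<d. A i k * z k) \<in> measurable (vec_space d) (vec_space d)"
proof -
  have "(\<lambda>z. \<Sum>k<d. A i k * z k) \<in> borel_measurable (vec_space d)" for i
    by (intro borel_measurable_sum borel_measurable_times) auto
  then show ?thesis
    by (subst (2) vec_space_def) (intro measurable_restrict, simp)
qed

text \<open>The cosine transform at t is exp (-(t^T A A^T t) / 2) * cos c. Only the Gram matrix of
  the rows enters, and \<open>PiM_eqI_cos\<close> identifies the laws.\<close>

lemma linear_law_cong:
  assumes "\<And>i j. i < d \<Longrightarrow> j < d \<Longrightarrow> (\<Sum>k<d. A i k * A j k) = (\<Sum>k<d. A' i k * A' j k)"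
  shows "linear_law d A = linear_law d A'"
proof (rule PiM_eqI_cos[where d = d])
  interpret P: prob_space "std_normal_vec d" by (rule prob_space_std_normal_vec)
  have m: "(\<lambda>z. \<lambda>i\<in>{..<d}. \<Sum>k<d. B i k * z k) \<in> measurable (std_normal_vec d) (vec_space d)" for B
    by measurable
  show "prob_space (linear_law d A)" "prob_space (linear_law d A')"
    unfolding linear_law_def by (intro P.prob_space_distr m)+
  show "sets (linear_law d A) = sets (PiM {..<d} (\<lambda>_. borel))" "sets (linear_law d A') = sets (PiM {..<d} (\<lambda>_. borel))"
    by (simp_all add: linear_law_def sets_vec_space)
  fix t :: "nat \<Rightarrow> real" and c :: real
  have *: "(\<integral>x. cos ((\<Sum>i<d. t i * x i) + c) \<partial>linear_law d B) =
      exp (- (\<Sum>i<d. \<Sum>j<d. t i * t j * (\<Sum>k<d. B i k * B j k)) / 2) * cos c" for B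
  proof -
    have cm: "(\<lambda>x. cos ((\<Sum>i<d. t i * x i) + c)) \<in> borel_measurable (vec_space d)"
      by measurable
    have "(\<integral>x. cos ((\<Sum>i<d. t i * x i) + c) \<partial>linear_law d B) =
      (\<integral>z. cos ((\<Sum>i<d. t i * (\<Sum>k<d. B i k * z k)) + c) \<partial>std_normal_vec d)"
      unfolding linear_law_def by (subst integral_distr[OF m cm]) simp
    also have "\<dots> = (\<integral>z. cos ((\<Sum>k<d. (\<Sum>i<d. t i * B i k) * z k) + c) \<partial>std_normal_vec d)"
      unfolding sum_distrib_left sum_distrib_right by (subst sum.swap) (simp add: mult_ac)
    also have "(\<integral>z. cos ((\<Sum>k<d. (\<Sum>i<d. t i * B i k) * z k) + c) \<partial>std_normal_vec d) =
      exp (- (\<Sum>k<d. (\<Sum>i<d. t i * B i k)\<^sup>2) / 2) * cos c"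
      by (rule std_normal_vec_cos)
    also have "(\<Sum>k<d. (\<Sum>i<d. t i * B i k)\<^sup>2) = (\<Sum>k<d. \<Sum>i<d. \<Sum>j<d. t i * B i k * (t j * B j k))"
      by (simp add: power2_eq_square sum_product)
    also have "\<dots> = (\<Sum>i<d. \<Sum>k<d. \<Sum>j<d. t i * B i k * (t j * B j k))"
      by (rule sum.swap)
    also have "\<dots> = (\<Sum>i<d. \<Sum>j<d. \<Sum>k<d. t i * B i k * (t j * B j k))"
      by (intro sum.cong refl sum.swap)
    also have "\<dots> = (\<Sum>i<d. \<Sum>j<d. t i * t j * (\<Sum>k<d. B i k * B j k))"
      by (simp add: sum_distrib_left mult_ac)
    finally show ?thesis .
  qed
  show "(\<integral>x. cos ((\<Sum>i<d. t i * x i) + c) \<partial>linear_law d A) = (\<integral>x. cos ((\<Sum>i<d. t i * x i) + c) \<partial>linear_law d A')"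
    unfolding * using assms by simp
qed

text \<open>The hypothesis does two things: it shows that a factor exists, so that the choice in
  \<open>sqrt_factor\<close> satisfies its specification, and it makes the Gram matrices of both
  factors agree.\<close>

lemma gaussian_eq_linear_law:
  assumes "\<And>i j. i < d \<Longrightarrow> j < d \<Longrightarrow> (\<Sum>k<d. A i k * A j k) = S i j"
  shows "gaussian d S = linear_law d A"
proof -
  have "\<forall>i<d. \<forall>j<d. (\<Sum>k<d. sqrt_factor d S i k * sqrt_factor d S j k) = S i j"
    unfolding sqrt_factor_def by (rule someI[of _ A]) (use assms in auto)
  then have "linear_law d (sqrt_factor d S) = linear_law d A"
    using assms by (intro linear_law_cong) auto
  then show ?thesis by (simp add: gaussian_def linear_law_def)
qed

section \<open>Change of measure and product measures\<close>

lemma indicator_PiE_eq_prod: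
  assumes "finite I" "x \<in> extensional I"
  shows "indicator (Pi\<^sub>E I A) x = (\<Prod>i\<in>I. indicator (A i) (x i) :: ennreal)"
proof (cases "\<forall>i\<in>I. x i \<in> A i")
  case True
  then have "(\<Prod>i\<in>I. indicator (A i) (x i) :: ennreal) = 1" by (intro prod.neutral) simp
  then show ?thesis using True assms by (simp add: PiE_def Pi_def)
next
  case False
  then obtain i where i: "i \<in> I" "x i \<notin> A i" by blast
  then have "(\<Prod>i\<in>I. indicator (A i) (x i) :: ennreal) = 0"
    using assms by (intro prod_zero) (auto intro!: bexI[of _ i])
  moreover have "x \<notin> Pi\<^sub>E I A" using i by auto
  ultimately show ?thesis by simp
qed

text \<open>Total mass 1 keeps the tilted factors probability measures, so their product is
  determined by its values on boxes, where density and indicator both factor over the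
  coordinates.\<close>

lemma PiM_density:
  assumes I: "finite I" and N: "prob_space N"
    and f[measurable]: "\<And>i. f i \<in> borel_measurable N" and f1: "\<And>i. (\<integral>\<^sup>+x. f i x \<partial>N) = 1"
  shows "PiM I (\<lambda>i. density N (f i)) = density (PiM I (\<lambda>_. N)) (\<lambda>x. \<Prod>i\<in>I. f i (x i))"
proof -
  interpret N: prob_space N by fact
  have "prob_space (density N (f i))" for i
    by (rule prob_spaceI) (simp add: emeasure_density f1 cong: nn_integral_cong)
  then interpret D: product_sigma_finite "\<lambda>i. density N (f i)"
    by (intro product_sigma_finite.intro prob_space_imp_sigma_finite)
  interpret P: product_sigma_finite "\<lambda>_. N"
    by (intro product_sigma_finite.intro N.sigma_finite_measure_axioms)
  have fm: "(\<lambda>x. \<Prod>i\<in>I. f i (x i)) \<in> borel_measurable (PiM I (\<lambda>_. N))"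
    using I by measurable
  show ?thesis
  proof (rule D.PiM_eqI[OF I, symmetric])
    show "sets (density (PiM I (\<lambda>_. N)) (\<lambda>x. \<Prod>i\<in>I. f i (x i))) = sets (PiM I (\<lambda>i. density N (f i)))"
      by (auto intro!: sets_PiM_cong)
    fix A assume A: "\<And>i. i \<in> I \<Longrightarrow> A i \<in> sets (density N (f i))"
    then have A'[measurable]: "\<And>i. i \<in> I \<Longrightarrow> A i \<in> sets N" by simp
    have "emeasure (density (PiM I (\<lambda>_. N)) (\<lambda>x. \<Prod>i\<in>I. f i (x i))) (Pi\<^sub>E I A)
      = (\<integral>\<^sup>+x. (\<Prod>i\<in>I. f i (x i)) * indicator (Pi\<^sub>E I A) x \<partial>PiM I (\<lambda>_. N))"
      using A' I by (intro emeasure_density fm sets_PiM_I_finite) auto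
    also have "\<dots> = (\<integral>\<^sup>+x. (\<Prod>i\<in>I. f i (x i) * indicator (A i) (x i)) \<partial>PiM I (\<lambda>_. N))"
    proof (intro nn_integral_cong)
      fix x assume x: "x \<in> space (PiM I (\<lambda>_. N))"
      have "indicator (Pi\<^sub>E I A) x = (\<Prod>i\<in>I. indicator (A i) (x i) :: ennreal)"
        using x I by (intro indicator_PiE_eq_prod) (auto simp: space_PiM PiE_def)
      then show "(\<Prod>i\<in>I. f i (x i)) * indicator (Pi\<^sub>E I A) x = (\<Prod>i\<in>I. f i (x i) * indicator (A i) (x i))"
        by (simp add: prod.distrib)
    qed
    also have "\<dots> = (\<Prod>i\<in>I. \<integral>\<^sup>+x. f i x * indicator (A i) x \<partial>N)"
      using A' by (intro P.product_nn_integral_prod I) measurable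
    also have "\<dots> = (\<Prod>i\<in>I. emeasure (density N (f i)) (A i))"
      using A' by (simp add: emeasure_density)
    finally show "emeasure (density (PiM I (\<lambda>_. N)) (\<lambda>x. \<Prod>i\<in>I. f i (x i))) (Pi\<^sub>E I A) = (\<Prod>i\<in>I. emeasure (density N (f i)) (A i))" .
  qed
qed

text \<open>Cameron-Martin formula on the line: the standard normal density at y - s is the density
  at y times exp (s y - s^2 / 2).\<close>

lemma nn_integral_std_normal_shift:
  assumes [measurable]: "f \<in> borel_measurable borel"
  shows "(\<integral>\<^sup>+y. f (y + s) \<partial>std_normal_distribution) =
    (\<integral>\<^sup>+y. ennreal (exp (s * y - s\<^sup>2 / 2)) * f y \<partial>std_normal_distribution)"
proof -
  have "(\<integral>\<^sup>+y. f (y + s) \<partial>std_normal_distribution) = (\<integral>\<^sup>+y. ennreal (std_normal_density y) * f (y + s) \<partial>lborel)"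
    by (subst nn_integral_density) auto
  also have "\<dots> = (\<integral>\<^sup>+y. ennreal (std_normal_density (y - s)) * f y \<partial>lborel)"
    by (subst (2) nn_integral_real_affine[where c = 1 and t = s]) (auto simp: add.commute)
  also have "\<dots> = (\<integral>\<^sup>+y. ennreal (std_normal_density y) * (ennreal (exp (s * y - s\<^sup>2 / 2)) * f y) \<partial>lborel)"
  proof (intro nn_integral_cong)
    fix y :: real
    have "std_normal_density (y - s) = std_normal_density y * exp (s * y - s\<^sup>2 / 2)"
      unfolding std_normal_density_def by (simp add: power2_eq_square field_simps flip: exp_add)
    then show "ennreal (std_normal_density (y - s)) * f y = ennreal (std_normal_density y) * (ennreal (exp (s * y - s\<^sup>2 / 2)) * f y)"
      by (simp add: ennreal_mult mult.assoc)
  qed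
  also have "\<dots> = (\<integral>\<^sup>+y. ennreal (exp (s * y - s\<^sup>2 / 2)) * f y \<partial>std_normal_distribution)"
    by (subst nn_integral_density) auto
  finally show ?thesis .
qed

lemma nn_integral_std_normal_exp:
  "(\<integral>\<^sup>+y. ennreal (exp (s * y - s\<^sup>2 / 2)) \<partial>std_normal_distribution) = 1"
  using nn_integral_std_normal_shift[of "\<lambda>_. 1" s] std_normal.emeasure_space_1 by simp

lemma std_normal_PiM_shift:
  assumes J: "finite J"
  shows "distr (PiM J (\<lambda>_. std_normal_distribution)) (PiM J (\<lambda>_. std_normal_distribution)) (\<lambda>y. \<lambda>i\<in>J. y i + s i)
    = density (PiM J (\<lambda>_. std_normal_distribution)) (\<lambda>y. \<Prod>i\<in>J. ennreal (exp (s i * y i - (s i)\<^sup>2 / 2)))"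
    (is "distr ?P ?P ?T = _")
proof -
  let ?D = "\<lambda>i. density std_normal_distribution (\<lambda>y. ennreal (exp (s i * y - (s i)\<^sup>2 / 2)))"
  have "prob_space (?D i)" for i
    by (rule prob_spaceI) (simp add: emeasure_density nn_integral_std_normal_exp cong: nn_integral_cong)
  then interpret D: product_sigma_finite ?D
    by (intro product_sigma_finite.intro prob_space_imp_sigma_finite)
  have T[measurable]: "?T \<in> measurable ?P ?P"
    by (intro measurable_restrict) measurable
  have "distr ?P ?P ?T = PiM J ?D"
  proof (rule D.PiM_eqI[OF J])
    show "sets (distr ?P ?P ?T) = sets (PiM J ?D)" by (auto intro!: sets_PiM_cong)
    fix A assume "\<And>i. i \<in> J \<Longrightarrow> A i \<in> sets (?D i)"
    then have A[measurable]: "\<And>i. i \<in> J \<Longrightarrow> A i \<in> sets borel" by simp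
    have "emeasure (distr ?P ?P ?T) (Pi\<^sub>E J A) = (\<integral>\<^sup>+x. indicator (Pi\<^sub>E J A) x \<partial>distr ?P ?P ?T)"
      using A J by (subst nn_integral_indicator) (auto intro!: sets_PiM_I_finite)
    also have "\<dots> = (\<integral>\<^sup>+x. indicator (Pi\<^sub>E J A) (?T x) \<partial>?P)"
      using A J by (subst nn_integral_distr) (auto intro!: borel_measurable_indicator sets_PiM_I_finite)
    also have "\<dots> = (\<integral>\<^sup>+x. (\<Prod>i\<in>J. indicator (A i) (x i + s i)) \<partial>?P)"
      using J by (intro nn_integral_cong) (simp add: indicator_PiE_eq_prod)
    also have "\<dots> = (\<Prod>i\<in>J. \<integral>\<^sup>+y. indicator (A i) (y + s i) \<partial>std_normal_distribution)"
      using A by (intro std_normal_prod.product_nn_integral_prod J) measurable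
    also have "\<dots> = (\<Prod>i\<in>J. emeasure (?D i) (A i))"
      using A by (intro prod.cong refl) (simp add: nn_integral_std_normal_shift[of "indicator _"] emeasure_density)
    finally show "emeasure (distr ?P ?P ?T) (Pi\<^sub>E J A) = (\<Prod>i\<in>J. emeasure (?D i) (A i))" .
  qed
  also have "\<dots> = density ?P (\<lambda>y. \<Prod>i\<in>J. ennreal (exp (s i * y i - (s i)\<^sup>2 / 2)))"
    by (intro PiM_density J prob_space_std_normal) (auto simp: nn_integral_std_normal_exp)
  finally show ?thesis .
qed

text \<open>The shear fixes the first m coordinates, and s depends on nothing else. Given those it
  is a translation by a constant vector, to which \<open>std_normal_PiM_shift\<close> applies;
  Fubini joins the two groups of coordinates.\<close>

lemma std_normal_vec_shear:
  fixes s :: "(nat \<Rightarrow> real) \<Rightarrow> nat \<Rightarrow> real"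
  assumes m: "m \<le> d"
    and s[measurable]: "\<And>i. (\<lambda>z. s z i) \<in> borel_measurable (vec_space d)"
    and s_cong: "\<And>z z' i. (\<And>j. j < m \<Longrightarrow> z j = z' j) \<Longrightarrow> s z i = s z' i"
  shows "distr (std_normal_vec d) (vec_space d) (\<lambda>z. \<lambda>i\<in>{..<d}. z i + (if m \<le> i then s z i else 0))
    = density (std_normal_vec d) (\<lambda>z. \<Prod>i\<in>{m..<d}. ennreal (exp (s z i * z i - (s z i)\<^sup>2 / 2)))"
    (is "distr _ _ ?T = density _ ?r")
proof (rule measure_eqI)
  have un: "{..<d} = {..<m} \<union> {m..<d}" using m by auto
  let ?P = "PiM {..<m} (\<lambda>_. std_normal_distribution)" and ?Q = "PiM {m..<d} (\<lambda>_. std_normal_distribution)"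
  let ?mg = "\<lambda>x y. merge {..<m} {m..<d} (x, y)"
  have T[measurable]: "?T \<in> measurable (vec_space d) (vec_space d)"
    by (subst (2) vec_space_def, intro measurable_restrict) (auto intro!: borel_measurable_add)
  have r[measurable]: "?r \<in> borel_measurable (vec_space d)"
  proof -
    have "(\<lambda>z. s z i * z i - (s z i)\<^sup>2 / 2) \<in> borel_measurable (vec_space d)" if "i \<in> {m..<d}" for i
    proof -
      have [measurable]: "i \<in> {..<d}" using that by simp
      show ?thesis by measurable
    qed
    then show ?thesis by (intro borel_measurable_prod_ennreal) simp
  qed
  fix A assume "A \<in> sets (distr (std_normal_vec d) (vec_space d) ?T)"
  then have A[measurable]: "A \<in> sets (vec_space d)" by simp
  have fold: "integral\<^sup>N (std_normal_vec d) f = (\<integral>\<^sup>+x. (\<integral>\<^sup>+y. f (?mg x y) \<partial>?Q) \<partial>?P)"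
    if "f \<in> borel_measurable (vec_space d)" for f
    unfolding un using that
    by (intro std_normal_prod.product_nn_integral_fold) (auto simp flip: un, measurable)
  have "emeasure (distr (std_normal_vec d) (vec_space d) ?T) A = (\<integral>\<^sup>+z. indicator A (?T z) \<partial>std_normal_vec d)"
  proof -
    have "emeasure (distr (std_normal_vec d) (vec_space d) ?T) A = (\<integral>\<^sup>+z. indicator A z \<partial>distr (std_normal_vec d) (vec_space d) ?T)"
      by simp
    also have "\<dots> = (\<integral>\<^sup>+z. indicator A (?T z) \<partial>std_normal_vec d)"
      by (rule nn_integral_distr) measurable
    finally show ?thesis .
  qed
  also have "\<dots> = (\<integral>\<^sup>+x. (\<integral>\<^sup>+y. indicator A (?T (?mg x y)) \<partial>?Q) \<partial>?P)"
    by (rule fold) measurable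
  also have "\<dots> = (\<integral>\<^sup>+x. (\<integral>\<^sup>+y. ?r (?mg x y) * indicator A (?mg x y) \<partial>?Q) \<partial>?P)"
  proof (rule nn_integral_cong)
    fix x assume x: "x \<in> space ?P"
    define c where "c i = s x i" for i
    have sc: "s (?mg x y) i = c i" for y i
      unfolding c_def by (rule s_cong) (simp add: merge_def)
    have [measurable]: "(\<lambda>y. ?mg x y) \<in> measurable ?Q (vec_space d)"
    proof -
      have "(\<lambda>y. ?mg x y) \<in> measurable ?Q (PiM ({..<m} \<union> {m..<d}) (\<lambda>_. std_normal_distribution))"
        using measurable_compose[OF measurable_Pair1'[OF x] measurable_merge] by (simp add: comp_def)
      then show ?thesis unfolding un[symmetric] by (simp add: measurable_cong_sets[OF refl sets_std_normal_vec])
    qed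
    have [measurable]: "(\<lambda>y. \<Prod>i\<in>{m..<d}. ennreal (exp (c i * y i - (c i)\<^sup>2 / 2))) \<in> borel_measurable ?Q"
      by (intro borel_measurable_prod_ennreal) measurable
    have "(\<integral>\<^sup>+y. indicator A (?T (?mg x y)) \<partial>?Q) = (\<integral>\<^sup>+y. indicator A (?mg x (\<lambda>i\<in>{m..<d}. y i + c i)) \<partial>?Q)"
    proof (intro nn_integral_cong)
      fix y
      have "?T (?mg x y) = ?mg x (\<lambda>i\<in>{m..<d}. y i + c i)"
        unfolding sc using m by (auto simp: fun_eq_iff merge_def)
      then show "indicator A (?T (?mg x y)) = indicator A (?mg x (\<lambda>i\<in>{m..<d}. y i + c i))" by simp
    qed
    also have "\<dots> = (\<integral>\<^sup>+y. indicator A (?mg x y) \<partial>distr ?Q ?Q (\<lambda>y. \<lambda>i\<in>{m..<d}. y i + c i))"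
      by (subst nn_integral_distr) (auto intro!: measurable_restrict)
    also have "\<dots> = (\<integral>\<^sup>+y. (\<Prod>i\<in>{m..<d}. ennreal (exp (c i * y i - (c i)\<^sup>2 / 2))) * indicator A (?mg x y) \<partial>?Q)"
      unfolding std_normal_PiM_shift[OF finite_atLeastLessThan]
      by (subst nn_integral_density) auto
    also have "\<dots> = (\<integral>\<^sup>+y. ?r (?mg x y) * indicator A (?mg x y) \<partial>?Q)"
      unfolding sc by (intro nn_integral_cong arg_cong2[where f = "(*)"] prod.cong refl) (auto simp: merge_def)
    finally show "(\<integral>\<^sup>+y. indicator A (?T (?mg x y)) \<partial>?Q) = (\<integral>\<^sup>+y. ?r (?mg x y) * indicator A (?mg x y) \<partial>?Q)" .
  qed
  also have "\<dots> = (\<integral>\<^sup>+z. ?r z * indicator A z \<partial>std_normal_vec d)"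
    by (rule fold[symmetric]) measurable
  also have "\<dots> = emeasure (density (std_normal_vec d) ?r) A"
    by (subst emeasure_density) (auto, measurable)
  finally show "emeasure (distr (std_normal_vec d) (vec_space d) ?T) A = emeasure (density (std_normal_vec d) ?r) A" .
qed (simp add: sets_std_normal_vec)

text \<open>Integrability makes the real integral a difference of two finite nonnegative integrals,
  each measurable in the argument of the kernel.\<close>

lemma measurable_kernel_integral:
  fixes f :: "'a \<Rightarrow> 'b \<Rightarrow> real"
  assumes f[measurable]: "(\<lambda>(x, y). f x y) \<in> borel_measurable (M \<Otimes>\<^sub>M N)"
    and L[measurable]: "L \<in> measurable M (subprob_algebra N)"
    and i: "\<And>x. x \<in> space M \<Longrightarrow> integrable (L x) (f x)"
  shows "(\<lambda>x. \<integral>y. f x y \<partial>L x) \<in> borel_measurable M"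
proof -
  have "(\<lambda>x. enn2real (\<integral>\<^sup>+y. ennreal (f x y) \<partial>L x) - enn2real (\<integral>\<^sup>+y. ennreal (- f x y) \<partial>L x)) \<in> borel_measurable M"
    by (intro borel_measurable_diff borel_measurable_enn2real nn_integral_measurable_subprob_algebra2[OF _ L]) measurable
  then show ?thesis
    by (rule measurable_cong[THEN iffD1, rotated]) (simp add: real_lebesgue_integral_def i)
qed

section \<open>Integrals under approximate privacy\<close>

text \<open>Layer cake: the integral of f is the integral of its tail probabilities over the levels
  from 0 to T. The inequality for sets is applied at every level, and the additive \<delta>
  accumulates over a range of length T.\<close>

lemma integral_le_of_measure_le:
  fixes f :: "'a \<Rightarrow> real"
  assumes Q: "prob_space Q" "prob_space Q'" and sets: "sets Q = sets Q'"
    and le: "\<And>S. S \<in> sets Q \<Longrightarrow> measure Q S \<le> a * measure Q' S + \<delta>" and a: "0 \<le> a" and \<delta>: "0 \<le> \<delta>"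
    and f[measurable]: "f \<in> borel_measurable Q" and f0: "\<And>x. 0 \<le> f x" and fT: "\<And>x. f x \<le> T"
  shows "(\<integral>x. f x \<partial>Q) \<le> a * (\<integral>x. f x \<partial>Q') + \<delta> * T"
proof -
  interpret Q: prob_space Q by fact
  interpret Q': prob_space Q' by fact
  have T0: "0 \<le> T" using f0 fT by (meson order_trans)
  have f'[measurable]: "f \<in> borel_measurable Q'" using f sets by (simp cong: measurable_cong_sets)
  have layer: "(\<integral>\<^sup>+x. ennreal (f x) \<partial>R) = (\<integral>\<^sup>+t. indicator {0..T} t * emeasure R {x \<in> space R. t < f x} \<partial>lborel)"
    if "prob_space R" and [measurable]: "f \<in> borel_measurable R" for R
  proof -
    interpret R: prob_space R by fact
    interpret pair_sigma_finite R lborel ..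
    have 1: "ennreal (f x) = (\<integral>\<^sup>+t. indicator {0..T} t * indicator {t. t < f x} t \<partial>lborel)" for x
    proof -
      have "(\<integral>\<^sup>+t. indicator {0..T} t * indicator {t. t < f x} t \<partial>lborel) = (\<integral>\<^sup>+t. indicator {0..<f x} t \<partial>lborel)"
        using fT[of x] by (intro nn_integral_cong) (auto simp: indicator_def)
      also have "\<dots> = ennreal (f x)" using f0[of x] by simp
      finally show ?thesis by simp
    qed
    have "(\<integral>\<^sup>+x. ennreal (f x) \<partial>R) = (\<integral>\<^sup>+x. (\<integral>\<^sup>+t. indicator {0..T} t * indicator {t. t < f x} t \<partial>lborel) \<partial>R)"
      by (simp add: 1)
    also have "\<dots> = (\<integral>\<^sup>+t. (\<integral>\<^sup>+x. indicator {0..T} t * indicator {t. t < f x} t \<partial>R) \<partial>lborel)"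
      by (rule Fubini'[symmetric]) (simp add: indicator_def, measurable)
    also have "\<dots> = (\<integral>\<^sup>+t. indicator {0..T} t * emeasure R {x \<in> space R. t < f x} \<partial>lborel)"
    proof (intro nn_integral_cong)
      fix t :: real
      have "(\<integral>\<^sup>+x. indicator {0..T} t * indicator {t. t < f x} t \<partial>R) = indicator {0..T} t * (\<integral>\<^sup>+x. indicator {t. t < f x} t \<partial>R)"
        by (subst nn_integral_cmult) (simp_all add: indicator_def)
      also have "(\<integral>\<^sup>+x. indicator {t. t < f x} t \<partial>R) = (\<integral>\<^sup>+x. indicator {x \<in> space R. t < f x} x \<partial>R)"
        by (intro nn_integral_cong) (auto simp: indicator_def)
      also have "\<dots> = emeasure R {x \<in> space R. t < f x}" by simp
      finally show "(\<integral>\<^sup>+x. indicator {0..T} t * indicator {t. t < f x} t \<partial>R) = indicator {0..T} t * emeasure R {x \<in> space R. t < f x}" .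
    qed
    finally show ?thesis .
  qed
  have m: "(\<lambda>t. emeasure Q' {x \<in> space Q'. t < f x}) \<in> borel_measurable lborel"
  proof -
    have "(\<lambda>t. \<integral>\<^sup>+x. indicator {x \<in> space Q'. t < f x} x \<partial>Q') \<in> borel_measurable lborel"
      by (intro Q'.borel_measurable_nn_integral) (simp add: indicator_def, measurable)
    then show ?thesis by simp
  qed
  have sp: "space Q = space Q'" using sets by (rule sets_eq_imp_space_eq)
  have "(\<integral>\<^sup>+x. ennreal (f x) \<partial>Q) \<le> (\<integral>\<^sup>+t. ennreal a * (indicator {0..T} t * emeasure Q' {x \<in> space Q'. t < f x}) + ennreal \<delta> * indicator {0..T} t \<partial>lborel)"
    unfolding layer[OF Q(1) f]
  proof (intro nn_integral_mono)
    fix t :: real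
    have "emeasure Q {x \<in> space Q. t < f x} \<le> ennreal a * emeasure Q' {x \<in> space Q'. t < f x} + ennreal \<delta>"
    proof -
      have "ennreal (measure Q {x \<in> space Q. t < f x}) \<le> ennreal (a * measure Q' {x \<in> space Q. t < f x} + \<delta>)"
        by (intro ennreal_leI le) measurable
      also have "\<dots> = ennreal a * ennreal (measure Q' {x \<in> space Q. t < f x}) + ennreal \<delta>"
        using a \<delta> by (simp add: ennreal_mult ennreal_plus)
      finally show ?thesis by (simp add: sp Q.emeasure_eq_measure Q'.emeasure_eq_measure)
    qed
    then show "indicator {0..T} t * emeasure Q {x \<in> space Q. t < f x} \<le> ennreal a * (indicator {0..T} t * emeasure Q' {x \<in> space Q'. t < f x}) + ennreal \<delta> * indicator {0..T} t"
      by (auto simp: indicator_def)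
  qed
  also have "\<dots> = ennreal a * (\<integral>\<^sup>+x. ennreal (f x) \<partial>Q') + ennreal \<delta> * ennreal T"
    unfolding layer[OF Q(2) f'] using m T0
    by (subst nn_integral_add) (auto simp: nn_integral_cmult)
  also have "(\<integral>\<^sup>+x. ennreal (f x) \<partial>Q') = ennreal (\<integral>x. f x \<partial>Q')"
    using f0 fT by (intro nn_integral_eq_integral Q'.integrable_const_bound[where B = T]) auto
  also have "(\<integral>\<^sup>+x. ennreal (f x) \<partial>Q) = ennreal (\<integral>x. f x \<partial>Q)"
    using f0 fT by (intro nn_integral_eq_integral Q.integrable_const_bound[where B = T]) auto
  finally show ?thesis
    using a \<delta> T0 f0 by (simp add: Bochner_Integration.integral_nonneg flip: ennreal_mult ennreal_plus)
qed

text \<open>The positive part of f uses the inequality from Q to Q', the negative part the reversed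
  one. Each loses \<delta> * T, and the multiplicative losses add up to the integral of the absolute
  value.\<close>

lemma integral_le_of_close:
  fixes f :: "'a \<Rightarrow> real"
  assumes Q: "prob_space Q" "prob_space Q'" and sets: "sets Q = sets Q'"
    and le: "\<And>S. S \<in> sets Q \<Longrightarrow> measure Q S \<le> exp \<epsilon> * measure Q' S + \<delta>"
    and le': "\<And>S. S \<in> sets Q \<Longrightarrow> measure Q' S \<le> exp \<epsilon> * measure Q S + \<delta>"
    and \<epsilon>: "0 \<le> \<epsilon>" and \<delta>: "0 \<le> \<delta>"
    and f[measurable]: "f \<in> borel_measurable Q" and fT: "\<And>x. \<bar>f x\<bar> \<le> T"
  shows "(\<integral>x. f x \<partial>Q) \<le> (\<integral>x. f x \<partial>Q') + (exp \<epsilon> - 1) * (\<integral>x. \<bar>f x\<bar> \<partial>Q') + 2 * \<delta> * T"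
proof -
  interpret Q: prob_space Q by fact
  interpret Q': prob_space Q' by fact
  have f'[measurable]: "f \<in> borel_measurable Q'" using f sets by (simp cong: measurable_cong_sets)
  let ?p = "\<lambda>x. max 0 (f x)" and ?n = "\<lambda>x. max 0 (- f x)"
  have b: "\<bar>?p x\<bar> \<le> T" "\<bar>?n x\<bar> \<le> T" for x using fT[of x] by auto
  have T0: "0 \<le> T" using b(1) by (meson abs_ge_zero order_trans)
  have b': "?p x \<le> T" "?n x \<le> T" for x using b[of x] by auto
  have i: "integrable Q ?p" "integrable Q ?n" "integrable Q' ?p" "integrable Q' ?n"
    using b by (auto intro!: Q.integrable_const_bound[where B = T] Q'.integrable_const_bound[where B = T])
  have 1: "(\<integral>x. ?p x \<partial>Q) \<le> exp \<epsilon> * (\<integral>x. ?p x \<partial>Q') + \<delta> * T"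
    using b' by (intro integral_le_of_measure_le[OF Q sets _ _ \<delta>] le) auto
  have 2: "(\<integral>x. ?n x \<partial>Q') \<le> exp \<epsilon> * (\<integral>x. ?n x \<partial>Q) + \<delta> * T"
    using b' by (intro integral_le_of_measure_le[OF Q(2,1) sets[symmetric] _ _ \<delta>] le') (auto simp: sets)
  have n0: "0 \<le> (\<integral>x. ?n x \<partial>Q')" by simp
  have 3: "(\<integral>x. ?n x \<partial>Q') - (exp \<epsilon> - 1) * (\<integral>x. ?n x \<partial>Q') - \<delta> * T \<le> (\<integral>x. ?n x \<partial>Q)"
  proof -
    have "exp (- \<epsilon>) * (\<integral>x. ?n x \<partial>Q') \<le> exp (- \<epsilon>) * (exp \<epsilon> * (\<integral>x. ?n x \<partial>Q) + \<delta> * T)"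
      using 2 by (intro mult_left_mono) auto
    also have "\<dots> = (\<integral>x. ?n x \<partial>Q) + exp (- \<epsilon>) * (\<delta> * T)"
      by (simp add: distrib_left exp_minus)
    also have "exp (- \<epsilon>) * (\<delta> * T) \<le> 1 * (\<delta> * T)"
      using \<epsilon> \<delta> T0 by (intro mult_right_mono) auto
    finally have "exp (- \<epsilon>) * (\<integral>x. ?n x \<partial>Q') \<le> (\<integral>x. ?n x \<partial>Q) + \<delta> * T" by simp
    \<comment> \<open>The factor exp (- \<epsilon>) is weakened to 1 - (exp \<epsilon> - 1), so that
      both parts lose the same factor; this is y + 1 / y \<ge> 2 for y = exp \<epsilon>.\<close>
    moreover have "(2 - exp \<epsilon>) * (\<integral>x. ?n x \<partial>Q') \<le> exp (- \<epsilon>) * (\<integral>x. ?n x \<partial>Q')"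
    proof (intro mult_right_mono n0)
      have "2 \<le> exp \<epsilon> + inverse (exp \<epsilon>)"
        using sum_squares_ge_zero[of "exp \<epsilon> - 1" 0] by (simp add: field_simps power2_eq_square)
      then show "2 - exp \<epsilon> \<le> exp (- \<epsilon>)" by (simp add: exp_minus)
    qed
    ultimately show ?thesis by (simp add: algebra_simps)
  qed
  have e: "(\<integral>x. f x \<partial>Q) = (\<integral>x. ?p x \<partial>Q) - (\<integral>x. ?n x \<partial>Q)"
    unfolding Bochner_Integration.integral_diff[OF i(1,2), symmetric]
    by (intro Bochner_Integration.integral_cong refl) (simp add: max_def)
  have e': "(\<integral>x. f x \<partial>Q') = (\<integral>x. ?p x \<partial>Q') - (\<integral>x. ?n x \<partial>Q')"
    unfolding Bochner_Integration.integral_diff[OF i(3,4), symmetric]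
    by (intro Bochner_Integration.integral_cong refl) (simp add: max_def)
  have e'': "(\<integral>x. \<bar>f x\<bar> \<partial>Q') = (\<integral>x. ?p x \<partial>Q') + (\<integral>x. ?n x \<partial>Q')"
    unfolding Bochner_Integration.integral_add[OF i(3,4), symmetric]
    by (intro Bochner_Integration.integral_cong refl) (simp add: max_def)
  show ?thesis unfolding e e' e'' using 1 3 by (simp add: algebra_simps)
qed

text \<open>Exchanging sample k with an independent copy preserves the joint law, by Fubini for the
  two copies of G. It serves to move a statistic from a sample that the mechanism has seen to one
  that it has not.\<close>

lemma PiM_resample:
  fixes n k :: nat
  assumes G: "prob_space G" and k: "k < n"
  shows "distr (PiM {..<n} (\<lambda>_. G) \<Otimes>\<^sub>M G) (PiM {..<n} (\<lambda>_. G) \<Otimes>\<^sub>M G) (\<lambda>(X, x). (X(k := x), X k))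
    = PiM {..<n} (\<lambda>_. G) \<Otimes>\<^sub>M G" (is "distr ?D ?D ?T = _")
proof (rule measure_eqI)
  interpret G: prob_space G by fact
  interpret P: product_sigma_finite "\<lambda>_::nat. G"
    by (intro product_sigma_finite.intro G.sigma_finite_measure_axioms)
  interpret GG: pair_sigma_finite G G ..
  define I where "I = {..<n} - {k}"
  have I: "finite I" "k \<notin> I" and nI: "{..<n} = insert k I" using k by (auto simp: I_def)
  let ?N = "PiM {..<n} (\<lambda>_. G)"
  have kn: "k \<in> {..<n}" using k by simp
  have upd[measurable]: "(\<lambda>p. (fst p)(k := snd p)) \<in> measurable ?D ?N"
    using kn by (intro measurable_fun_upd[where J = "{..<n}"]) auto
  have kc[measurable]: "(\<lambda>X. X k) \<in> measurable ?N G" by (rule measurable_component_singleton[OF kn])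
  have T[measurable]: "?T \<in> measurable ?D ?D"
    unfolding case_prod_beta by measurable
  fix A assume "A \<in> sets (distr ?D ?D ?T)"
  then have A[measurable]: "A \<in> sets ?D" by simp
  define F :: "(nat \<Rightarrow> 'a) \<Rightarrow> 'a \<Rightarrow> ennreal" where "F X x = indicator A (X, x)" for X x
  have F[measurable]: "(\<lambda>p. F (fst p) (snd p)) \<in> borel_measurable ?D"
    unfolding F_def by simp
  have F1: "(\<lambda>p. F ((fst p)(k := snd p)) (fst p k)) \<in> borel_measurable ?D"
    using measurable_compose[OF T F] by (simp add: case_prod_beta)
  have fold: "(\<integral>\<^sup>+X. H X \<partial>?N) = (\<integral>\<^sup>+Y. (\<integral>\<^sup>+y. H (Y(k := y)) \<partial>G) \<partial>PiM I (\<lambda>_. G))"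
    if "H \<in> borel_measurable ?N" for H
    using that unfolding nI by (intro P.product_nn_integral_insert I)
  have "emeasure (distr ?D ?D ?T) A = (\<integral>\<^sup>+p. indicator A p \<partial>distr ?D ?D ?T)"
    by simp
  also have "\<dots> = (\<integral>\<^sup>+p. indicator A (?T p) \<partial>?D)"
    by (rule nn_integral_distr) measurable
  also have "\<dots> = (\<integral>\<^sup>+p. F ((fst p)(k := snd p)) (fst p k) \<partial>?D)"
    by (simp add: F_def case_prod_beta)
  also have "\<dots> = (\<integral>\<^sup>+X. (\<integral>\<^sup>+x. F (X(k := x)) (X k) \<partial>G) \<partial>?N)"
    using G.nn_integral_fst[OF F1] by simp
  also have "\<dots> = (\<integral>\<^sup>+Y. (\<integral>\<^sup>+y. (\<integral>\<^sup>+x. F (Y(k := x)) y \<partial>G) \<partial>G) \<partial>PiM I (\<lambda>_. G))"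
    using G.borel_measurable_nn_integral_fst[OF F1] by (subst fold) simp_all
  also have "\<dots> = (\<integral>\<^sup>+Y. (\<integral>\<^sup>+y. (\<integral>\<^sup>+x. F (Y(k := y)) x \<partial>G) \<partial>G) \<partial>PiM I (\<lambda>_. G))"
  proof (rule nn_integral_cong)
    fix Y assume Y: "Y \<in> space (PiM I (\<lambda>_. G))"
    have u: "(\<lambda>x. Y(k := x)) \<in> measurable G ?N"
      unfolding nI by (rule measurable_component_update[OF Y I(2)])
    have "(\<lambda>(x, y). F (Y(k := x)) y) \<in> borel_measurable (G \<Otimes>\<^sub>M G)"
    proof -
      have "(\<lambda>p. (Y(k := fst p), snd p)) \<in> measurable (G \<Otimes>\<^sub>M G) ?D"
        using u by measurable
      from measurable_compose[OF this F] show ?thesis by (simp add: case_prod_beta)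
    qed
    from GG.Fubini'[OF this]
    show "(\<integral>\<^sup>+y. (\<integral>\<^sup>+x. F (Y(k := x)) y \<partial>G) \<partial>G) = (\<integral>\<^sup>+y. (\<integral>\<^sup>+x. F (Y(k := y)) x \<partial>G) \<partial>G)" .
  qed
  also have "\<dots> = (\<integral>\<^sup>+X. (\<integral>\<^sup>+x. F X x \<partial>G) \<partial>?N)"
    using G.borel_measurable_nn_integral_fst[OF F] by (subst fold) simp_all
  also have "\<dots> = (\<integral>\<^sup>+p. F (fst p) (snd p) \<partial>?D)"
    using G.nn_integral_fst[OF F] by simp
  also have "\<dots> = emeasure ?D A"
    by (simp add: F_def)
  finally show "emeasure (distr ?D ?D ?T) A = emeasure ?D A" .
qed simp

section \<open>Small dimension\<close>

lemma measurable_mat_component: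
  assumes "i < d" "j < d"
  shows "(\<lambda>A. A i j) \<in> borel_measurable (mat_space d)"
proof -
  have "(\<lambda>A. A i) \<in> measurable (mat_space d) (vec_space d)"
    unfolding mat_space_def using assms by (intro measurable_component_singleton) auto
  then show ?thesis
    by (rule measurable_compose) (rule measurable_vec_component[OF assms(2)])
qed

lemma measurable_quad_form: "(\<lambda>A. quad_form d A x) \<in> borel_measurable (mat_space d)"
  unfolding quad_form_def
  by (intro borel_measurable_sum borel_measurable_times measurable_mat_component) auto

lemma measurable_frob_sq: "(\<lambda>A. frob_sq d A S) \<in> borel_measurable (mat_space d)"
  unfolding frob_sq_def
  by (intro borel_measurable_sum borel_measurable_power borel_measurable_diff measurable_mat_component) auto

text \<open>The definition has one condition for every real vector. Both sides are continuous in x,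
  so rational vectors suffice, and taking them extensional on {..<d} makes the family
  countable.\<close>

lemma W_set_measurable: "W_set d \<in> sets (mat_space d)"
proof -
  let ?C = "\<lambda>A x. 0.09 * (\<Sum>i<d. (x i)\<^sup>2) \<le> quad_form d A x \<and> quad_form d A x \<le> 10 * (\<Sum>i<d. (x i)\<^sup>2)"
  define Q :: "(nat \<Rightarrow> real) set" where "Q = Pi\<^sub>E {..<d} (\<lambda>_. \<rat>)"
  have Q: "countable Q" unfolding Q_def by (intro countable_PiE) (auto simp: countable_rat)
  have ext: "?C A x" if QC: "\<forall>x\<in>Q. ?C A x" for A x
  proof -
    have "\<exists>f. (\<forall>k. f k \<in> \<rat>) \<and> f \<longlonglongrightarrow> x i" for i
      using closure_sequential[of "x i" "\<rat>"] Rats_closure_real by auto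
    then obtain f where f: "\<And>i k. f i k \<in> \<rat>" "\<And>i. f i \<longlonglongrightarrow> x i" by metis
    define y where "y k = (\<lambda>i\<in>{..<d}. f i k)" for k
    have yQ: "y k \<in> Q" for k using f(1) by (auto simp: y_def Q_def)
    have lim: "(\<lambda>k. y k i) \<longlonglongrightarrow> x i" if "i < d" for i
      using f(2)[of i] that by (simp add: y_def)
    have q: "(\<lambda>k. quad_form d A (y k)) \<longlonglongrightarrow> quad_form d A x"
      unfolding quad_form_def by (intro tendsto_sum tendsto_mult tendsto_const lim) auto
    have s: "(\<lambda>k. c * (\<Sum>i<d. (y k i)\<^sup>2)) \<longlonglongrightarrow> c * (\<Sum>i<d. (x i)\<^sup>2)" for c :: real
      by (intro tendsto_mult tendsto_const tendsto_sum tendsto_power lim) auto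
    show ?thesis
    proof
      show "0.09 * (\<Sum>i<d. (x i)\<^sup>2) \<le> quad_form d A x"
        by (rule LIMSEQ_le[OF s q]) (use QC yQ in blast)
      show "quad_form d A x \<le> 10 * (\<Sum>i<d. (x i)\<^sup>2)"
        by (rule LIMSEQ_le[OF q s]) (use QC yQ in blast)
    qed
  qed
  have "W_set d = {A \<in> space (mat_space d). (\<forall>i\<in>{..<d}. \<forall>j\<in>{..<d}. A i j = A j i) \<and> (\<forall>x\<in>Q. ?C A x)}"
    unfolding W_set_def symmetric_mat_def using ext by blast
  also have "\<dots> \<in> sets (mat_space d)"
  proof (intro sets.sets_Collect_conj)
    show "{A \<in> space (mat_space d). \<forall>i\<in>{..<d}. \<forall>j\<in>{..<d}. A i j = A j i} \<in> sets (mat_space d)"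
      by (intro sets.sets_Collect_finite_All borel_measurable_eq measurable_mat_component) auto
    show "{A \<in> space (mat_space d). \<forall>x\<in>Q. ?C A x} \<in> sets (mat_space d)"
      by (intro sets.sets_Collect_countable_All'[OF _ Q] sets.sets_Collect_conj borel_measurable_le measurable_quad_form) auto
  qed
  finally show ?thesis .
qed

lemma prob_space_linear_law: "prob_space (linear_law d A)"
proof -
  interpret P: prob_space "std_normal_vec d" by (rule prob_space_std_normal_vec)
  show ?thesis unfolding linear_law_def by (intro P.prob_space_distr) measurable
qed

lemma sets_linear_law [simp]: "sets (linear_law d A) = sets (vec_space d)"
  by (simp add: linear_law_def)

lemma gaussian_sqrt_factor: "gaussian d S = linear_law d (sqrt_factor d S)"
  by (simp add: gaussian_def linear_law_def)

lemma prob_space_data_law: "prob_space (data_law d n S)"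
  unfolding data_law_def gaussian_sqrt_factor by (intro prob_space_PiM prob_space_linear_law)

lemma sets_data_law: "sets (data_law d n S) = sets (data_space d n)"
  unfolding data_law_def data_space_def gaussian_sqrt_factor by (intro sets_PiM_cong) auto

section \<open>Mechanisms and group privacy\<close>

lemma mechanism_sets:
  assumes "mechanism d n M" "X \<in> space (data_space d n)"
  shows "sets (M X) = sets (mat_space d)"
  using assms by (auto simp: mechanism_def dest: sets_kernel)

text \<open>\<open>neighbours\<close> demands that the samples differ; equal data satisfy the bound
  because exp \<epsilon> \<ge> 1. The parameter of the mechanism may be negative, hence the passage
  to a nonnegative upper bound \<delta>.\<close>

lemma diff_private_le:
  assumes dp: "diff_private d n \<epsilon> \<delta>' M" and X: "X \<in> space (data_space d n)" "X' \<in> space (data_space d n)"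
    and diff: "\<And>j. j < n \<Longrightarrow> j \<noteq> k \<Longrightarrow> X j = X' j" and k: "k < n"
    and S: "S \<in> sets (mat_space d)" and \<epsilon>: "0 \<le> \<epsilon>" and \<delta>: "\<delta>' \<le> \<delta>" "0 \<le> \<delta>"
  shows "measure (M X) S \<le> exp \<epsilon> * measure (M X') S + \<delta>"
proof (cases "X k = X' k")
  case True
  have "X j = X' j" for j
    using True diff X by (cases "j < n") (auto simp: data_space_def space_PiM PiE_def extensional_def)
  then have "X = X'" by auto
  moreover have "1 * measure (M X') S \<le> exp \<epsilon> * measure (M X') S"
    using \<epsilon> by (intro mult_right_mono) auto
  ultimately show ?thesis using \<delta> by simp
next
  case False
  then have "neighbours d n X X'"
    unfolding neighbours_def using X diff k by blast
  then have "measure (M X) S \<le> exp \<epsilon> * measure (M X') S + \<delta>'"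
    using dp S unfolding diff_private_def by blast
  then show ?thesis using \<delta> by simp
qed

lemma group_privacy:
  assumes dp: "diff_private d n \<epsilon> \<delta>' M" and X: "X \<in> space (data_space d n)" "X' \<in> space (data_space d n)"
    and S: "S \<in> sets (mat_space d)" and \<epsilon>: "0 \<le> \<epsilon>" and \<delta>: "\<delta>' \<le> \<delta>" "0 \<le> \<delta>"
  shows "measure (M X) S \<le> exp (n * \<epsilon>) * (measure (M X') S + n * \<delta>)"
proof -
  \<comment> \<open>Hybrid data: the first k samples come from X', the others from X. Neighbouring
    hybrids agree except possibly at sample k.\<close>
  define H where "H k j = (if j < k then X' j else X j)" for k j
  have H: "H k \<in> space (data_space d n)" for k
    using X by (auto simp: H_def data_space_def space_PiM PiE_def extensional_def)
  \<comment> \<open>Keeping k * \<delta> under the factor exp (k * \<epsilon>) replaces the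
    geometric series of additive losses by a cruder bound that survives the induction.\<close>
  have *: "measure (M X) S \<le> exp (k * \<epsilon>) * (measure (M (H k)) S + k * \<delta>)" if "k \<le> n" for k
    using that
  proof (induction k)
    case 0
    have "H 0 = X" by (auto simp: H_def)
    then show ?case by simp
  next
    case (Suc k)
    have "measure (M (H k)) S \<le> exp \<epsilon> * measure (M (H (Suc k))) S + \<delta>"
      using Suc.prems by (intro diff_private_le[OF dp H H _ _ S \<epsilon> \<delta>, where k = k]) (auto simp: H_def)
    moreover have "\<delta> * 1 \<le> \<delta> * exp \<epsilon>" "k * \<delta> * 1 \<le> k * \<delta> * exp \<epsilon>"
      using \<epsilon> \<delta> by (intro mult_left_mono; simp)+
    ultimately have "measure (M (H k)) S + k * \<delta> \<le> exp \<epsilon> * (measure (M (H (Suc k))) S + Suc k * \<delta>)"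
      by (simp add: algebra_simps)
    then have "exp (k * \<epsilon>) * (measure (M (H k)) S + k * \<delta>) \<le> exp (k * \<epsilon>) * (exp \<epsilon> * (measure (M (H (Suc k))) S + Suc k * \<delta>))"
      by (intro mult_left_mono) auto
    also have "\<dots> = exp (Suc k * \<epsilon>) * (measure (M (H (Suc k))) S + Suc k * \<delta>)"
    proof -
      have "real (Suc k) * \<epsilon> = k * \<epsilon> + \<epsilon>" by (simp add: algebra_simps)
      then show ?thesis by (simp add: exp_add)
    qed
    finally show ?case using Suc by simp
  qed
  have "H n j = X' j" for j
    using X by (auto simp: H_def data_space_def space_PiM PiE_def extensional_def)
  then have "H n = X'" by auto
  then show ?thesis using *[of n] by simp
qed

section \<open>Scalar matrices and the two-point prior\<close>

definition scalar_mat :: "nat \<Rightarrow> real \<Rightarrow> nat \<Rightarrow> nat \<Rightarrow> real" where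
  "scalar_mat d c = (\<lambda>i\<in>{..<d}. \<lambda>j\<in>{..<d}. if i = j then c else 0)"

lemma scalar_mat_space: "scalar_mat d c \<in> space (mat_space d)"
  by (auto simp: scalar_mat_def mat_space_def vec_space_def space_PiM)

lemma quad_form_scalar_mat: "quad_form d (scalar_mat d c) x = c * (\<Sum>i<d. (x i)\<^sup>2)"
proof -
  have "(\<Sum>j<d. x i * scalar_mat d c i j * x j) = c * (x i)\<^sup>2" if "i < d" for i
  proof -
    have "(\<Sum>j<d. x i * scalar_mat d c i j * x j) = (\<Sum>j<d. if j = i then c * (x i)\<^sup>2 else 0)"
      using that by (intro sum.cong) (auto simp: scalar_mat_def power2_eq_square)
    then show ?thesis using that by simp
  qed
  then show ?thesis unfolding quad_form_def by (simp add: sum_distrib_left)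
qed

lemma frob_sq_scalar_mat: "frob_sq d (scalar_mat d a) (scalar_mat d b) = d * (a - b)\<^sup>2"
proof -
  have "(\<Sum>j<d. (scalar_mat d a i j - scalar_mat d b i j)\<^sup>2) = (a - b)\<^sup>2" if "i < d" for i
  proof -
    have "(\<Sum>j<d. (scalar_mat d a i j - scalar_mat d b i j)\<^sup>2) = (\<Sum>j<d. if j = i then (a - b)\<^sup>2 else 0)"
      using that by (intro sum.cong) (auto simp: scalar_mat_def)
    then show ?thesis using that by simp
  qed
  then show ?thesis unfolding frob_sq_def by simp
qed

lemma symmetric_scalar_mat: "symmetric_mat d (scalar_mat d c)"
  by (auto simp: symmetric_mat_def scalar_mat_def)

lemma pos_def_scalar_mat:
  assumes "c > 0" shows "pos_def d (scalar_mat d c)"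
  unfolding pos_def_def quad_form_scalar_mat
proof (intro conjI symmetric_scalar_mat allI impI)
  fix x :: "nat \<Rightarrow> real" assume "\<exists>i<d. x i \<noteq> 0"
  then obtain i where "i < d" "x i \<noteq> 0" by blast
  then have "0 < (\<Sum>i<d. (x i)\<^sup>2)" by (intro sum_pos2[of _ i]) auto
  then show "0 < c * (\<Sum>i<d. (x i)\<^sup>2)" using assms by simp
qed

lemma scalar_mat_in_W:
  assumes "0.09 \<le> c" "c \<le> 10" shows "scalar_mat d c \<in> W_set d"
  unfolding W_set_def mem_Collect_eq quad_form_scalar_mat using assms
  by (intro conjI allI scalar_mat_space symmetric_scalar_mat mult_right_mono sum_nonneg) auto

lemma singleton_mat_measurable:
  assumes "S \<in> space (mat_space d)"
  shows "{S} \<in> sets (mat_space d)"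
proof -
  have "{S} = {A \<in> space (mat_space d). \<forall>i\<in>{..<d}. \<forall>j\<in>{..<d}. A i j = S i j}"
  proof -
    have "A = S" if A: "A \<in> space (mat_space d)" "\<forall>i\<in>{..<d}. \<forall>j\<in>{..<d}. A i j = S i j" for A
    proof (intro ext)
      fix i j
      show "A i j = S i j"
        using A assms by (cases "i < d"; cases "j < d")
          (auto simp: mat_space_def vec_space_def space_PiM PiE_def extensional_def Pi_def)
    qed
    then show ?thesis using assms by auto
  qed
  also have "\<dots> \<in> sets (mat_space d)"
    by (intro sets.sets_Collect_finite_All borel_measurable_eq measurable_mat_component) auto
  finally show ?thesis .
qed

lemma frob_sq_parallelogram: "frob_sq d S S' \<le> 2 * frob_sq d A S + 2 * frob_sq d A S'"
proof -
  have *: "(a - b)\<^sup>2 \<le> 2 * (c - a)\<^sup>2 + 2 * (c - b)\<^sup>2" for a b c :: real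
    using zero_le_power2[of "(c - a) + (c - b)"] by (simp add: power2_eq_square algebra_simps)
  show ?thesis
    unfolding frob_sq_def sum_distrib_left sum.distrib[symmetric] by (intro sum_mono *)
qed

text \<open>Markov's inequality: whatever the data, the output lies at squared distance at least r
  with probability at least 1 - a. The bound is uniform in X, so the average over the samples
  inherits it.\<close>

lemma err_given_ge:
  assumes M: "mechanism d n M" and S: "S \<in> space (mat_space d)" and r: "0 \<le> r" and a: "a \<le> 1"
    and le: "\<And>X. X \<in> space (data_space d n) \<Longrightarrow> measure (M X) {A \<in> space (mat_space d). frob_sq d A S < r} \<le> a"
  shows "ennreal (r * (1 - a)) \<le> err_given d n M S"
proof -
  interpret D: prob_space "data_law d n S" by (rule prob_space_data_law)
  let ?B = "{A \<in> space (mat_space d). frob_sq d A S < r}"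
  have sp: "space (data_law d n S) = space (data_space d n)" using sets_data_law by (rule sets_eq_imp_space_eq)
  have B: "?B \<in> sets (mat_space d)" using measurable_frob_sq by measurable
  have "ennreal (r * (1 - a)) \<le> (\<integral>\<^sup>+A. ennreal (frob_sq d A S) \<partial>M X)" if X: "X \<in> space (data_law d n S)" for X
  proof -
    have X': "X \<in> space (data_space d n)" using X sp by simp
    interpret MX: prob_space "M X" using M X' by (auto simp: mechanism_def)
    have s: "sets (M X) = sets (mat_space d)" by (rule mechanism_sets[OF M X'])
    then have sp': "space (M X) = space (mat_space d)" by (rule sets_eq_imp_space_eq)
    have "r * (1 - a) \<le> r * measure (M X) (space (M X) - ?B)"
      using le[OF X'] r B s by (intro mult_left_mono) (auto simp: MX.prob_compl)
    then have "ennreal (r * (1 - a)) \<le> ennreal r * emeasure (M X) (space (M X) - ?B)"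
      using r by (simp add: MX.emeasure_eq_measure ennreal_leI flip: ennreal_mult)
    also have "\<dots> = (\<integral>\<^sup>+A. ennreal r * indicator (space (M X) - ?B) A \<partial>M X)"
      using B s by (subst nn_integral_cmult_indicator) auto
    also have "\<dots> \<le> (\<integral>\<^sup>+A. ennreal (frob_sq d A S) \<partial>M X)"
      by (intro nn_integral_mono) (auto simp: indicator_def sp' intro!: ennreal_leI)
    finally show ?thesis .
  qed
  then have "(\<integral>\<^sup>+X. ennreal (r * (1 - a)) \<partial>data_law d n S) \<le> err_given d n M S"
    unfolding err_given_def by (intro nn_integral_mono)
  then show ?thesis by (simp add: D.emeasure_space_1)
qed

text \<open>Group privacy makes the output nearly independent of the whole data set, so a mechanism
  cannot tell the two ends of the window apart.\<close>

lemma two_point_prior: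
  assumes d: "d \<ge> 1" and n: "n \<ge> 1" and \<epsilon>: "0 < \<epsilon>" and \<delta>: "\<delta> \<le> 1 / (3 * real n)"
  shows "\<exists>P. prob_space P \<and> sets P = sets (mat_space d) \<and> (AE S in P. pos_def d S) \<and> emeasure P (W_set d) > 0 \<and>
    (real n * \<epsilon> \<le> 1 / 10 \<longrightarrow> (\<forall>M. mechanism d n M \<longrightarrow> diff_private d n \<epsilon> \<delta> M \<longrightarrow>
      (\<forall>\<alpha>::real. \<alpha> \<ge> 0 \<longrightarrow> err_sq d n P M = ennreal (\<alpha>\<^sup>2) \<longrightarrow> \<not> \<alpha> \<le> sqrt d / 15)))"
proof -
  define S where "S b = scalar_mat d (if b then 1 / 10 else 10)" for b
  define P where "P = distr (measure_pmf (bernoulli_pmf (1 / 2))) (mat_space d) S"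
  have Ssp: "S b \<in> space (mat_space d)" for b by (simp add: S_def scalar_mat_space)
  have SW: "S b \<in> W_set d" for b unfolding S_def by (rule scalar_mat_in_W) auto
  have [measurable]: "S \<in> measurable (measure_pmf (bernoulli_pmf (1 / 2))) (mat_space d)"
    using Ssp by auto
  have neq: "S True \<noteq> S False"
  proof
    assume "S True = S False"
    then have "S True 0 0 = S False 0 0" by simp
    then show False using d by (simp add: S_def scalar_mat_def)
  qed
  have prob: "prob_space P" unfolding P_def by (intro measure_pmf.prob_space_distr) measurable
  have sets: "sets P = sets (mat_space d)" by (simp add: P_def)
  have em: "emeasure P A = ennreal (1 / 2) * indicator A (S True) + ennreal (1 / 2) * indicator A (S False)"
    if A[measurable]: "A \<in> sets (mat_space d)" for A
  proof -
    have "emeasure P A = (\<integral>\<^sup>+s. indicator A s \<partial>P)" using sets by simp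
    also have "\<dots> = (\<integral>\<^sup>+b. indicator A (S b) \<partial>measure_pmf (bernoulli_pmf (1 / 2)))"
      unfolding P_def by (rule nn_integral_distr) measurable
    also have "\<dots> = ennreal (1 / 2) * indicator A (S True) + ennreal (1 / 2) * indicator A (S False)"
      by (simp add: nn_integral_bernoulli_pmf mult.commute)
    finally show ?thesis .
  qed
  have half: "ennreal (1 / 2) + ennreal (1 / 2) = 1"
    by (subst ennreal_plus[symmetric]) auto
  have PW: "emeasure P (W_set d) = 1"
    unfolding em[OF W_set_measurable] half[symmetric] using SW by simp
  have AE: "AE T in P. pos_def d T"
  proof -
    have m: "{S True, S False} \<in> sets (mat_space d)"
      using singleton_mat_measurable[OF Ssp[of True]] singleton_mat_measurable[OF Ssp[of False]]
      by (metis insert_is_Un sets.Un)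
    have "emeasure P {S True, S False} = 1" unfolding em[OF m] half[symmetric] by simp
    then have "AE T in P. T \<in> {S True, S False}"
      using m sets prob by (intro prob_space.AE_prob_1) (auto simp: measure_def)
    moreover have "pos_def d (S b)" for b unfolding S_def by (rule pos_def_scalar_mat) auto
    ultimately show ?thesis by auto
  qed
  have "\<not> \<alpha> \<le> sqrt d / 15"
    if n\<epsilon>: "real n * \<epsilon> \<le> 1 / 10" and M: "mechanism d n M" and dp: "diff_private d n \<epsilon> \<delta> M" and \<alpha>: "\<alpha> \<ge> 0" and err: "err_sq d n P M = ennreal (\<alpha>\<^sup>2)" for M and \<alpha> :: real
  proof -
    \<comment> \<open>The two matrices are at squared distance d * 9.9^2 = 4 r, so by the
      parallelogram bound no output is closer than r, in squared distance, to both.\<close>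
    define r where "r = d * (99 / 10)\<^sup>2 / (4 :: real)"
    have r0: "r \<ge> 0" by (simp add: r_def)
    define B where "B b = {A \<in> space (mat_space d). frob_sq d A (S b) < r}" for b
    have B: "B b \<in> sets (mat_space d)" for b unfolding B_def using measurable_frob_sq by measurable
    have disj: "B True \<inter> B False = {}"
    proof -
      have "frob_sq d (S True) (S False) = 4 * r"
        unfolding S_def by (simp add: frob_sq_scalar_mat r_def power2_eq_square)
      then have "2 * r \<le> frob_sq d A (S True) + frob_sq d A (S False)" for A
        using frob_sq_parallelogram[of d "S True" "S False" A] by simp
      then have "\<not> (frob_sq d A (S True) < r \<and> frob_sq d A (S False) < r)" for A
        by (smt (verit))
      then show ?thesis by (auto simp: B_def)
    qed
    obtain X0 where X0: "X0 \<in> space (data_space d n)"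
      using prob_space.not_empty[OF prob_space_data_law[of d n "S True"]]
        sets_eq_imp_space_eq[OF sets_data_law[of d n "S True"]] by auto
    interpret M0: prob_space "M X0" using M X0 by (auto simp: mechanism_def)
    have p: "measure (M X0) (B True) + measure (M X0) (B False) \<le> 1"
    proof -
      have "measure (M X0) (B True) + measure (M X0) (B False) = measure (M X0) (B True \<union> B False)"
        using B disj mechanism_sets[OF M X0] by (subst M0.finite_measure_Union) auto
      then show ?thesis by simp
    qed
    \<comment> \<open>Group privacy compares every run with the run on \<open>X0\<close>. The number
      1.11 bounds exp (n * \<epsilon>) for n * \<epsilon> \<le> 1/10, and 1/3 bounds n *
      \<delta>.\<close>
    define a where "a b = 1.11 * (measure (M X0) (B b) + 1 / 3)" for b
    have e: "exp (real n * \<epsilon>) \<le> 1.11"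
    proof -
      have "exp (real n * \<epsilon>) \<le> exp (1 / 10)" using n\<epsilon> by simp
      also have "\<dots> \<le> 1 + 1 / 10 + (1 / 10)\<^sup>2" by (rule exp_bound) auto
      also have "\<dots> = 1.11" by (simp add: power2_eq_square)
      finally show ?thesis .
    qed
    have le: "measure (M X) (B b) \<le> a b" if X: "X \<in> space (data_space d n)" for X b
    proof -
      have "measure (M X) (B b) \<le> exp (real n * \<epsilon>) * (measure (M X0) (B b) + real n * (1 / (3 * real n)))"
        using \<epsilon> \<delta> n by (intro group_privacy[OF dp X X0 B]) auto
      also have "real n * (1 / (3 * real n)) = 1 / 3" using n by simp
      also have "exp (real n * \<epsilon>) * (measure (M X0) (B b) + 1 / 3) \<le> a b"
        unfolding a_def using e by (intro mult_right_mono) auto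
      finally show ?thesis .
    qed
    \<comment> \<open>\<open>err_given_ge\<close> asks for a probability bound of at most 1, hence
      the minimum.\<close>
    have ge: "ennreal (r * (1 - min 1 (a b))) \<le> err_given d n M (S b)" for b
      using le r0 M0.prob_le_1 unfolding B_def[symmetric]
      by (intro err_given_ge[OF M Ssp r0]) (auto simp flip: B_def simp: mechanism_def intro!: prob_space.prob_le_1 M[unfolded mechanism_def, THEN conjunct2, rule_format])
    have "ennreal (\<alpha>\<^sup>2) = (\<integral>\<^sup>+T. indicator (W_set d) T * err_given d n M T \<partial>P)"
      using err unfolding err_sq_def PW by (simp add: divide_ennreal_def)
    also have "\<dots> \<ge> (\<integral>\<^sup>+T. err_given d n M (S True) * indicator {S True} T + err_given d n M (S False) * indicator {S False} T \<partial>P)"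
      using neq SW by (intro nn_integral_mono) (auto simp: indicator_def)
    also (xtrans) have "(\<integral>\<^sup>+T. err_given d n M (S True) * indicator {S True} T + err_given d n M (S False) * indicator {S False} T \<partial>P)
      = err_given d n M (S True) * emeasure P {S True} + err_given d n M (S False) * emeasure P {S False}"
    proof -
      have [measurable]: "{S b} \<in> sets P" for b using singleton_mat_measurable[OF Ssp] sets by simp
      show ?thesis by (subst nn_integral_add) (auto simp: nn_integral_cmult_indicator)
    qed
    also have "\<dots> = err_given d n M (S True) * ennreal (1 / 2) + err_given d n M (S False) * ennreal (1 / 2)"
      using em singleton_mat_measurable[OF Ssp] neq by simp
    also (xtrans) have "\<dots> \<ge> ennreal (r * (1 - min 1 (a True))) * ennreal (1 / 2) + ennreal (r * (1 - min 1 (a False))) * ennreal (1 / 2)"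
      using ge by (intro add_mono mult_right_mono) auto
    also (xtrans) have "ennreal (r * (1 - min 1 (a True))) * ennreal (1 / 2) + ennreal (r * (1 - min 1 (a False))) * ennreal (1 / 2)
      = ennreal (r * (1 - min 1 (a True)) * (1 / 2) + r * (1 - min 1 (a False)) * (1 / 2))"
    proof -
      have mh: "ennreal x * ennreal (1 / 2) = ennreal (x * (1 / 2))" if "x \<ge> 0" for x
        using that by (intro ennreal_mult[symmetric]) auto
      have x0: "r * (1 - min 1 (a b)) \<ge> 0" for b using r0 by simp
      show ?thesis unfolding mh[OF x0] by (rule ennreal_plus[symmetric]) (use x0 in auto)
    qed
    finally have up: "r * (1 - min 1 (a True)) * (1 / 2) + r * (1 - min 1 (a False)) * (1 / 2) \<le> \<alpha>\<^sup>2"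
      by (simp add: ennreal_le_iff)
    have mn: "r * (1 - a b) \<le> r * (1 - min 1 (a b))" for b using r0 by (intro mult_left_mono) auto
    have "r * (2 - (a True + a False)) / 2 = r * (1 - a True) * (1 / 2) + r * (1 - a False) * (1 / 2)"
      by (simp add: field_simps)
    then have "r * (2 - (a True + a False)) / 2 \<le> r * (1 - min 1 (a True)) * (1 / 2) + r * (1 - min 1 (a False)) * (1 / 2)"
      using mn[of True] mn[of False] by linarith
    with up have "r * (2 - (a True + a False)) / 2 \<le> \<alpha>\<^sup>2" by linarith
    \<comment> \<open>1.11 * (1 + 2/3) = 1.85: the disjoint balls share probability at most 1, and
      each receives an extra 1/3. As 1.85 is below 2, a positive fraction of the error r
      survives.\<close>
    moreover have "a True + a False \<le> 1.85" using p by (simp add: a_def field_simps)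
    then have "r * 0.15 / 2 \<le> r * (2 - (a True + a False)) / 2"
      using r0 by (intro divide_right_mono mult_left_mono) auto
    ultimately have "r * 0.15 / 2 \<le> \<alpha>\<^sup>2" by linarith
    moreover have "real d / 225 < r * 0.15 / 2"
      using d by (simp add: r_def power2_eq_square)
    moreover have "\<alpha>\<^sup>2 \<le> real d / 225" if "\<alpha> \<le> sqrt d / 15"
      using power_mono[OF that \<alpha>, of 2] by (simp add: power_divide)
    ultimately show ?thesis by linarith
  qed
  then show ?thesis
    using prob sets AE PW by (intro exI[of _ P]) auto
qed

section \<open>Privacy bound for a single sample\<close>

text \<open>Compare with the run in which sample k is replaced by a fresh copy; there the statistic is
  evaluated at a sample independent of the output and has mean zero.\<close>

lemma dp_score_bound:
  fixes h :: "(nat \<Rightarrow> real) \<Rightarrow> (nat \<Rightarrow> nat \<Rightarrow> real) \<Rightarrow> real"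
  assumes M: "mechanism d n M" and dp: "diff_private d n \<epsilon> \<delta>' M"
    and \<epsilon>: "0 \<le> \<epsilon>" and \<delta>: "\<delta>' \<le> \<delta>" "0 \<le> \<delta>" and k: "k < n"
    and G: "prob_space G" and sG: "sets G = sets (vec_space d)"
    and h: "(\<lambda>(x, A). h x A) \<in> borel_measurable (vec_space d \<Otimes>\<^sub>M mat_space d)"
    and hT: "\<And>x A. \<bar>h x A\<bar> \<le> T x" and T: "integrable G T"
    and mean0: "\<And>A. A \<in> space (mat_space d) \<Longrightarrow> (\<integral>x. h x A \<partial>G) = 0"
    and abs: "\<And>A. A \<in> space (mat_space d) \<Longrightarrow> (\<integral>x. \<bar>h x A\<bar> \<partial>G) \<le> g A"
    and g: "g \<in> borel_measurable (mat_space d)" and gc: "\<And>A. \<bar>g A\<bar> \<le> c"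
  shows "(\<integral>X. (\<integral>A. h (X k) A \<partial>M X) \<partial>PiM {..<n} (\<lambda>_. G))
    \<le> (exp \<epsilon> - 1) * (\<integral>X. (\<integral>A. g A \<partial>M X) \<partial>PiM {..<n} (\<lambda>_. G)) + 2 * \<delta> * (\<integral>x. T x \<partial>G)"
proof -
  interpret G: prob_space G by fact
  let ?D = "PiM {..<n} (\<lambda>_. G)"
  have "prob_space ?D" by (intro prob_space_PiM G)
  then interpret D: prob_space ?D .
  interpret DG: pair_sigma_finite ?D G ..
  interpret DGp: pair_prob_space ?D G ..
  have sD: "sets ?D = sets (data_space d n)"
    unfolding data_space_def by (intro sets_PiM_cong refl sG)
  have spD: "space ?D = space (data_space d n)" by (rule sets_eq_imp_space_eq[OF sD])
  have spG: "space G = space (vec_space d)" by (rule sets_eq_imp_space_eq[OF sG])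
  have kern[measurable]: "M \<in> measurable ?D (subprob_algebra (mat_space d))"
    using M by (simp add: mechanism_def measurable_cong_sets[OF sD refl])
  have prob: "prob_space (M X)" if "X \<in> space ?D" for X
    using M that spD by (simp add: mechanism_def)
  have sM: "sets (M X) = sets (mat_space d)" if "X \<in> space ?D" for X
    using mechanism_sets[OF M] that spD by simp
  have spM: "space (M X) = space (mat_space d)" if "X \<in> space ?D" for X
    by (rule sets_eq_imp_space_eq[OF sM[OF that]])
  have h'[measurable]: "(\<lambda>p. h (fst p) (snd p)) \<in> borel_measurable (G \<Otimes>\<^sub>M mat_space d)"
    using h by (simp add: case_prod_beta measurable_cong_sets[OF sets_pair_measure_cong[OF sG refl] refl])
  note [measurable] = g borel_measurable_integrable[OF T]
  have T0: "0 \<le> T x" for x using hT[of x] by (meson abs_ge_zero order_trans)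
  have hx[measurable]: "h x \<in> borel_measurable (mat_space d)" if "x \<in> space G" for x
    using measurable_compose[OF measurable_Pair1'[OF that] h'] by simp
  have hA: "(\<lambda>x. h x A) \<in> borel_measurable G" if "A \<in> space (mat_space d)" for A
    using measurable_compose[OF measurable_Pair2'[OF that] h'] by simp
  have hxM: "h x \<in> borel_measurable (M X)" if "x \<in> space G" "X \<in> space ?D" for x X
    using hx[OF that(1)] by (simp add: measurable_cong_sets[OF sM[OF that(2)] refl])
  have int_h: "integrable (M X) (h x)" "integrable (M X) (\<lambda>A. \<bar>h x A\<bar>)" if "x \<in> space G" "X \<in> space ?D" for x X
  proof -
    interpret MX: prob_space "M X" by (rule prob[OF that(2)])
    show "integrable (M X) (h x)"
      using hT hxM[OF that] by (intro MX.integrable_const_bound[where B = "T x"]) auto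
    then show "integrable (M X) (\<lambda>A. \<bar>h x A\<bar>)" by (rule integrable_abs)
  qed
  define b where "b X x = (\<integral>A. h x A \<partial>M X)" for X x
  define e where "e X x = (\<integral>A. \<bar>h x A\<bar> \<partial>M X)" for X x
  have kern2: "(\<lambda>p. M (fst p)) \<in> measurable (?D \<Otimes>\<^sub>M G) (subprob_algebra (mat_space d))"
    by measurable
  have h3: "(\<lambda>(p, A). h (snd p) A) \<in> borel_measurable ((?D \<Otimes>\<^sub>M G) \<Otimes>\<^sub>M mat_space d)"
  proof -
    have "(\<lambda>q. (snd (fst q), snd q)) \<in> measurable ((?D \<Otimes>\<^sub>M G) \<Otimes>\<^sub>M mat_space d) (G \<Otimes>\<^sub>M mat_space d)"
      by measurable
    from measurable_compose[OF this h'] show ?thesis by (simp add: case_prod_beta)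
  qed
  have bm: "(\<lambda>p. b (fst p) (snd p)) \<in> borel_measurable (?D \<Otimes>\<^sub>M G)"
    unfolding b_def by (rule measurable_kernel_integral[OF h3 kern2]) (auto simp: space_pair_measure int_h)
  have em: "(\<lambda>p. e (fst p) (snd p)) \<in> borel_measurable (?D \<Otimes>\<^sub>M G)"
    unfolding e_def
    by (rule measurable_kernel_integral[OF _ kern2]) (use h3 in \<open>auto simp: space_pair_measure int_h case_prod_beta\<close>)
  have eT: "0 \<le> e X x" "e X x \<le> T x" "\<bar>b X x\<bar> \<le> T x" if "x \<in> space G" "X \<in> space ?D" for X x
  proof -
    interpret MX: prob_space "M X" by (rule prob[OF that(2)])
    show "0 \<le> e X x" unfolding e_def by simp
    show e: "e X x \<le> T x"
      unfolding e_def using int_h[OF that] hT by (intro MX.integral_le_const) auto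
    show "\<bar>b X x\<bar> \<le> T x"
      using order_trans[OF integral_abs_bound[of "M X" "h x"] e[unfolded e_def]] unfolding b_def .
  qed
  have Tp: "integrable (?D \<Otimes>\<^sub>M G) (\<lambda>p. T (snd p))" "(\<integral>p. T (snd p) \<partial>(?D \<Otimes>\<^sub>M G)) = (\<integral>x. T x \<partial>G)"
  proof -
    have "distr (?D \<Otimes>\<^sub>M G) G snd = G"
    proof (intro measure_eqI)
      fix S assume "S \<in> sets (distr (?D \<Otimes>\<^sub>M G) G snd)"
      then have S: "S \<in> sets G" by simp
      have "snd -` S \<inter> space (?D \<Otimes>\<^sub>M G) = space ?D \<times> S"
        using sets.sets_into_space[OF S] by (auto simp: space_pair_measure)
      then show "emeasure (distr (?D \<Otimes>\<^sub>M G) G snd) S = emeasure G S"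
        using S by (simp add: emeasure_distr G.emeasure_pair_measure_Times D.emeasure_space_1)
    qed simp
    then show "integrable (?D \<Otimes>\<^sub>M G) (\<lambda>p. T (snd p))" "(\<integral>p. T (snd p) \<partial>(?D \<Otimes>\<^sub>M G)) = (\<integral>x. T x \<partial>G)"
      using integrable_distr_eq[of snd "?D \<Otimes>\<^sub>M G" G T] integral_distr[of snd "?D \<Otimes>\<^sub>M G" G T] T by auto
  qed
  have bi: "integrable (?D \<Otimes>\<^sub>M G) (\<lambda>p. b (fst p) (snd p))"
    by (rule Bochner_Integration.integrable_bound[OF Tp(1) bm])
      (intro AE_I2, auto simp: space_pair_measure abs_of_nonneg[OF T0] intro: eT)
  have ei: "integrable (?D \<Otimes>\<^sub>M G) (\<lambda>p. e (fst p) (snd p))"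
    by (rule Bochner_Integration.integrable_bound[OF Tp(1) em])
      (intro AE_I2, auto simp: space_pair_measure abs_of_nonneg[OF T0] abs_of_nonneg[OF eT(1)] intro: eT)
  \<comment> \<open>The right side of \<open>integral_le_of_close\<close> for a run on the data
    \<open>fst p\<close>, with the statistic taken at the independent sample
    \<open>snd p\<close>.\<close>
  define R where "R p = b (fst p) (snd p) + (exp \<epsilon> - 1) * e (fst p) (snd p) + 2 * \<delta> * T (snd p)" for p
  have Ri: "integrable (?D \<Otimes>\<^sub>M G) R"
    unfolding R_def using bi ei Tp(1) by auto
  let ?s = "\<lambda>(X, x). (X(k := x), X k)"
  have kn: "k \<in> {..<n}" using k by simp
  have upd[measurable]: "(\<lambda>p. (fst p)(k := snd p)) \<in> measurable (?D \<Otimes>\<^sub>M G) ?D"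
    using kn by (intro measurable_fun_upd[where J = "{..<n}"]) auto
  have kc[measurable]: "(\<lambda>X. X k) \<in> measurable ?D G" by (rule measurable_component_singleton[OF kn])
  have sm: "?s \<in> measurable (?D \<Otimes>\<^sub>M G) (?D \<Otimes>\<^sub>M G)"
    unfolding case_prod_beta by measurable
  \<comment> \<open>After the swap the mechanism runs on the modified data while h sees the original
    sample k. By exchangeability the mean is the same as that of \<open>R\<close>, where h sees a
    sample independent of the run.\<close>
  have Rs: "integrable (?D \<Otimes>\<^sub>M G) (\<lambda>p. R (?s p))" "(\<integral>p. R (?s p) \<partial>(?D \<Otimes>\<^sub>M G)) = (\<integral>p. R p \<partial>(?D \<Otimes>\<^sub>M G))"
    using integrable_distr_eq[OF sm, of R] integral_distr[OF sm, of R] Ri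
    unfolding PiM_resample[OF G k] by auto
  have bk: "(\<lambda>X. b X (X k)) \<in> borel_measurable ?D"
    using measurable_compose[OF _ bm, of "\<lambda>X. (X, X k)" ?D] by simp
  have Tk: "integrable ?D (\<lambda>X. T (X k))"
  proof -
    have "distr ?D G (\<lambda>X. X k) = G" using G by (intro distr_PiM_component kn)
    then show ?thesis using integrable_distr_eq[OF kc, of T] T by simp
  qed
  have Xk: "X k \<in> space G" if "X \<in> space ?D" for X
    using that kn by (auto simp: space_PiM)
  have bki: "integrable ?D (\<lambda>X. b X (X k))"
    by (rule Bochner_Integration.integrable_bound[OF Tk bk])
      (intro AE_I2, auto simp: abs_of_nonneg[OF T0] intro!: eT Xk)
  have fi: "integrable (?D \<Otimes>\<^sub>M G) (\<lambda>p. b (fst p) (fst p k))" "(\<integral>p. b (fst p) (fst p k) \<partial>(?D \<Otimes>\<^sub>M G)) = (\<integral>X. b X (X k) \<partial>?D)"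
  proof -
    have "distr (?D \<Otimes>\<^sub>M G) ?D fst = ?D"
      by (rule G.distr_pair_fst)
    then show "integrable (?D \<Otimes>\<^sub>M G) (\<lambda>p. b (fst p) (fst p k))" "(\<integral>p. b (fst p) (fst p k) \<partial>(?D \<Otimes>\<^sub>M G)) = (\<integral>X. b X (X k) \<partial>?D)"
      using integrable_distr_eq[of fst "?D \<Otimes>\<^sub>M G" ?D "\<lambda>X. b X (X k)"] integral_distr[of fst "?D \<Otimes>\<^sub>M G" ?D "\<lambda>X. b X (X k)"] bki bk by auto
  qed
  \<comment> \<open>For fixed X and x the sample at which h is evaluated is fixed, so its envelope
    \<open>T (X k)\<close> serves as the constant bound. After averaging, the additive loss is 2 *
    \<delta> times the mean of T, without truncating h.\<close>
  have pt: "b X (X k) \<le> R (X(k := x), X k)" if X: "X \<in> space ?D" and x: "x \<in> space G" for X x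
  proof -
    have X': "X(k := x) \<in> space ?D" using X x kn by (auto simp: space_PiM PiE_def extensional_def)
    have le: "measure (M X) S \<le> exp \<epsilon> * measure (M (X(k := x))) S + \<delta>"
      "measure (M (X(k := x))) S \<le> exp \<epsilon> * measure (M X) S + \<delta>" if "S \<in> sets (M X)" for S
      using that X X' k \<epsilon> \<delta> sM[OF X] spD by (auto intro!: diff_private_le[OF dp, where k = k])
    show ?thesis
      unfolding R_def b_def e_def fst_conv snd_conv
      using \<epsilon> \<delta> hT sM[OF X] sM[OF X'] hxM[OF Xk[OF X] X]
      by (intro integral_le_of_close[OF prob[OF X] prob[OF X'] _ le]) auto
  qed
  have hpi: "integrable (G \<Otimes>\<^sub>M M X) (\<lambda>p. h (fst p) (snd p))" if X: "X \<in> space ?D" for X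
  proof -
    interpret MX: prob_space "M X" by (rule prob[OF X])
    interpret GM: pair_sigma_finite G "M X" ..
    have "distr (G \<Otimes>\<^sub>M M X) G fst = G" by (rule MX.distr_pair_fst)
    then have Ti: "integrable (G \<Otimes>\<^sub>M M X) (\<lambda>p. T (fst p))"
      using integrable_distr_eq[of fst "G \<Otimes>\<^sub>M M X" G T] T by auto
    show ?thesis
    proof (rule Bochner_Integration.integrable_bound[OF Ti])
      show "(\<lambda>p. h (fst p) (snd p)) \<in> borel_measurable (G \<Otimes>\<^sub>M M X)"
        using h' by (simp add: measurable_cong_sets[OF sets_pair_measure_cong[OF refl sM[OF X]] refl])
      show "AE p in G \<Otimes>\<^sub>M M X. norm (h (fst p) (snd p)) \<le> norm (T (fst p))"
        using hT by (intro AE_I2) (simp add: abs_of_nonneg[OF T0])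
    qed
  qed
  have fub: "(\<integral>x. (\<integral>A. f (x, A) \<partial>M X) \<partial>G) = (\<integral>A. (\<integral>x. f (x, A) \<partial>G) \<partial>M X)"
    if X: "X \<in> space ?D" and f: "integrable (G \<Otimes>\<^sub>M M X) f" for X and f :: "_ \<Rightarrow> real"
  proof -
    interpret MX: prob_space "M X" by (rule prob[OF X])
    interpret GM: pair_sigma_finite G "M X" ..
    show ?thesis using GM.Fubini_integral[of "\<lambda>x A. f (x, A)"] f by simp
  qed
  have "(\<integral>X. b X (X k) \<partial>?D) = (\<integral>p. b (fst p) (fst p k) \<partial>(?D \<Otimes>\<^sub>M G))" using fi by simp
  also have "\<dots> \<le> (\<integral>p. R (?s p) \<partial>(?D \<Otimes>\<^sub>M G))"
    by (intro integral_mono fi(1) Rs(1)) (auto simp: space_pair_measure intro: pt)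
  also have "\<dots> = (\<integral>p. R p \<partial>(?D \<Otimes>\<^sub>M G))" by (rule Rs(2))
  also have "\<dots> = (\<integral>p. b (fst p) (snd p) \<partial>(?D \<Otimes>\<^sub>M G)) + (exp \<epsilon> - 1) * (\<integral>p. e (fst p) (snd p) \<partial>(?D \<Otimes>\<^sub>M G)) + 2 * \<delta> * (\<integral>x. T x \<partial>G)"
    unfolding R_def using bi ei Tp by simp
  also have "(\<integral>p. b (fst p) (snd p) \<partial>(?D \<Otimes>\<^sub>M G)) = (\<integral>X. (\<integral>x. b X x \<partial>G) \<partial>?D)"
    using DG.integral_fst'[OF bi] by simp
  also have "(\<integral>p. e (fst p) (snd p) \<partial>(?D \<Otimes>\<^sub>M G)) = (\<integral>X. (\<integral>x. e X x \<partial>G) \<partial>?D)"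
    using DG.integral_fst'[OF ei] by simp
  also have "(\<integral>X. (\<integral>x. b X x \<partial>G) \<partial>?D) = (\<integral>X. 0 \<partial>?D)"
  proof (intro Bochner_Integration.integral_cong refl)
    fix X assume X: "X \<in> space ?D"
    have "(\<integral>x. b X x \<partial>G) = (\<integral>A. (\<integral>x. h x A \<partial>G) \<partial>M X)"
      using fub[OF X hpi[OF X]] unfolding b_def by simp
    also have "\<dots> = (\<integral>A. 0 \<partial>M X)"
      using mean0 spM[OF X] by (intro Bochner_Integration.integral_cong refl) simp
    finally show "(\<integral>x. b X x \<partial>G) = 0" by simp
  qed
  also have "(exp \<epsilon> - 1) * (\<integral>X. (\<integral>x. e X x \<partial>G) \<partial>?D) \<le> (exp \<epsilon> - 1) * (\<integral>X. (\<integral>A. g A \<partial>M X) \<partial>?D)"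
  proof (intro mult_left_mono integral_mono)
    show "integrable ?D (\<lambda>X. \<integral>x. e X x \<partial>G)" using DG.integrable_fst'[OF ei] by simp
    have gi: "integrable (M X) g" if "X \<in> space ?D" for X
    proof -
      interpret MX: prob_space "M X" by (rule prob[OF that])
      show ?thesis using gc g by (intro MX.integrable_const_bound[where B = c]) (auto simp: measurable_cong_sets[OF sM[OF that] refl])
    qed
    have gm: "(\<lambda>X. \<integral>A. g A \<partial>M X) \<in> borel_measurable ?D"
      by (rule measurable_kernel_integral[OF _ kern gi]) measurable
    show "integrable ?D (\<lambda>X. \<integral>A. g A \<partial>M X)"
    proof (intro D.integrable_const_bound[where B = c] AE_I2 gm)
      fix X assume X: "X \<in> space ?D"
      interpret MX: prob_space "M X" by (rule prob[OF X])
      have "\<bar>\<integral>A. g A \<partial>M X\<bar> \<le> (\<integral>A. \<bar>g A\<bar> \<partial>M X)" by (rule integral_abs_bound)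
      also have "\<dots> \<le> c" using gc gi[OF X] by (intro MX.integral_le_const) auto
      finally show "norm (\<integral>A. g A \<partial>M X) \<le> c" by simp
    qed
    show "0 \<le> exp \<epsilon> - 1" using \<epsilon> by simp
    fix X assume X: "X \<in> space ?D"
    have i: "integrable (G \<Otimes>\<^sub>M M X) (\<lambda>p. \<bar>h (fst p) (snd p)\<bar>)" using hpi[OF X] by simp
    have "(\<integral>x. e X x \<partial>G) = (\<integral>A. (\<integral>x. \<bar>h x A\<bar> \<partial>G) \<partial>M X)"
      using fub[OF X i] unfolding e_def by simp
    also have "\<dots> \<le> (\<integral>A. g A \<partial>M X)"
    proof (intro integral_mono gi X)
      interpret MX: prob_space "M X" by (rule prob[OF X])
      interpret GM: pair_sigma_finite G "M X" ..
      show "integrable (M X) (\<lambda>A. \<integral>x. \<bar>h x A\<bar> \<partial>G)" by (rule GM.integrable_snd) (use i in \<open>simp only: case_prod_beta'\<close>)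
    qed (use abs spM[OF X] in auto)
    finally show "(\<integral>x. e X x \<partial>G) \<le> (\<integral>A. g A \<partial>M X)" .
  qed
  finally show ?thesis unfolding b_def by simp
qed

section \<open>Operator norm of a random matrix with uniform entries\<close>

definition sym_unif :: "real measure" where
  "sym_unif = density lborel (\<lambda>x. ennreal (indicator {-1..1} x / 2))"

lemma sets_sym_unif [simp, measurable_cong]: "sets sym_unif = sets borel"
  by (simp add: sym_unif_def)

lemma space_sym_unif [simp]: "space sym_unif = UNIV"
  by (simp add: sym_unif_def)

lemma prob_space_sym_unif: "prob_space sym_unif"
proof (rule prob_spaceI)
  have "emeasure sym_unif (space sym_unif) = (\<integral>\<^sup>+x. ennreal (1 / 2) * indicator {-1..1::real} x \<partial>lborel)"
  proof -
    have "ennreal (indicator {-1..1} x / 2) * indicator UNIV x = ennreal (1 / 2) * indicator {-1..1} x" for x :: real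
      by (cases "x \<in> {-1..1}") auto
    then show ?thesis unfolding sym_unif_def by (subst emeasure_density) auto
  qed
  also have "\<dots> = ennreal (1 / 2) * ennreal 2"
    by (subst nn_integral_cmult_indicator) auto
  also have "\<dots> = 1" by (subst ennreal_mult[symmetric]) auto
  finally show "emeasure sym_unif (space sym_unif) = 1" .
qed

interpretation sym_unif: prob_space sym_unif
  by (rule prob_space_sym_unif)

interpretation sym_unif_prod: product_sigma_finite "\<lambda>_::'i. sym_unif"
  by unfold_locales

lemma AE_sym_unif: "AE x in sym_unif. \<bar>x\<bar> \<le> 1"
  unfolding sym_unif_def by (subst AE_density) (auto simp: indicator_def abs_le_iff)

lemma integral_sym_unif_FTC:
  fixes F f :: "real \<Rightarrow> real"
  assumes F: "\<And>x. -1 \<le> x \<Longrightarrow> x \<le> 1 \<Longrightarrow> DERIV F x :> f x" and f: "continuous_on UNIV f"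
  shows "(\<integral>x. f x \<partial>sym_unif) = (F 1 - F (-1)) / 2"
proof -
  have [measurable]: "f \<in> borel_measurable borel" using f by (rule borel_measurable_continuous_onI)
  have "(\<integral>x. f x \<partial>sym_unif) = (\<integral>x. (indicator {-1..1} x / 2) * f x \<partial>lborel)"
    unfolding sym_unif_def by (subst integral_density) auto
  also have "\<dots> = (\<integral>x. (f x * indicator {-1..1} x) / 2 \<partial>lborel)"
    by (simp add: mult.commute)
  also have "\<dots> = (F 1 - F (-1)) / 2"
    using integral_FTC_Icc_real[of "-1" 1 F f] F f by (simp add: continuous_on_eq_continuous_at)
  finally show ?thesis .
qed

lemma sym_unif_mean: "(\<integral>x. a * x \<partial>sym_unif) = 0"
  by (subst integral_sym_unif_FTC[where F = "\<lambda>x. a * x\<^sup>2 / 2"])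
    (auto intro!: derivative_eq_intros continuous_intros)

lemma sym_unif_second_moment: "(\<integral>x. x\<^sup>2 \<partial>sym_unif) = 1 / 3"
  by (subst integral_sym_unif_FTC[where F = "\<lambda>x. x ^ 3 / 3"])
    (auto intro!: derivative_eq_intros continuous_intros)

text \<open>Hoeffding's lemma for a centred variable in an interval of length 2 |a|: the exponent is
  (2 |a|)^2 / 8 = a^2 / 2.\<close>

lemma sym_unif_mgf: "(\<integral>\<^sup>+x. ennreal (exp (a * x)) \<partial>sym_unif) \<le> ennreal (exp (a\<^sup>2 / 2))"
proof -
  interpret interval_bounded_random_variable sym_unif "\<lambda>x. a * x" "- \<bar>a\<bar>" "\<bar>a\<bar>"
  proof
    show "AE x in sym_unif. a * x \<in> {- \<bar>a\<bar>..\<bar>a\<bar>}"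
      using AE_sym_unif
    proof eventually_elim
      fix x :: real assume "\<bar>x\<bar> \<le> 1"
      then have "\<bar>a * x\<bar> \<le> \<bar>a\<bar>" by (simp add: abs_mult mult_left_le)
      then show "a * x \<in> {- \<bar>a\<bar>..\<bar>a\<bar>}" by auto
    qed
  qed measurable
  show ?thesis
    using Hoeffdings_lemma_nn_integral_0[of 1, OF _ sym_unif_mean] by (simp add: power2_eq_square)
qed

text \<open>Chernoff bound with parameter t: exp (- t^2) from the threshold, at most exp (t^2 / 2)
  from the product of the moment generating functions.\<close>

lemma sym_unif_tail:
  assumes K: "finite K" and c: "(\<Sum>p\<in>K. (c p)\<^sup>2) \<le> 1" and t: "t > 0"
  shows "emeasure (PiM K (\<lambda>_. sym_unif)) {B \<in> space (PiM K (\<lambda>_. sym_unif)). t < (\<Sum>p\<in>K. B p * c p)} \<le> ennreal (exp (- t\<^sup>2 / 2))"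
proof -
  let ?U = "PiM K (\<lambda>_. sym_unif)"
  have m[measurable]: "(\<lambda>B. \<Sum>p\<in>K. B p * c p) \<in> borel_measurable ?U"
    by measurable
  have "emeasure ?U {B \<in> space ?U. t < (\<Sum>p\<in>K. B p * c p)}
      = (\<integral>\<^sup>+B. indicator {B \<in> space ?U. t < (\<Sum>p\<in>K. B p * c p)} B \<partial>?U)"
    by simp
  also have "\<dots> \<le> (\<integral>\<^sup>+B. ennreal (exp (- t\<^sup>2)) * (\<Prod>p\<in>K. ennreal (exp (t * c p * B p))) \<partial>?U)"
  proof (intro nn_integral_mono)
    fix B
    have "(\<Prod>p\<in>K. ennreal (exp (t * c p * B p))) = ennreal (exp (t * (\<Sum>p\<in>K. B p * c p)))"
      using K by (simp add: prod_ennreal sum_distrib_left exp_sum mult_ac)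
    then have "ennreal (exp (- t\<^sup>2)) * (\<Prod>p\<in>K. ennreal (exp (t * c p * B p))) = ennreal (exp (t * (\<Sum>p\<in>K. B p * c p) - t * t))"
      by (simp add: power2_eq_square mult.commute flip: ennreal_mult exp_add)
    moreover have "1 \<le> exp (t * (\<Sum>p\<in>K. B p * c p) - t * t)" if "t < (\<Sum>p\<in>K. B p * c p)"
      using that t by simp
    ultimately show "indicator {B \<in> space ?U. t < (\<Sum>p\<in>K. B p * c p)} B \<le> ennreal (exp (- t\<^sup>2)) * (\<Prod>p\<in>K. ennreal (exp (t * c p * B p)))"
      by (auto simp: indicator_def)
  qed
  also have "\<dots> = ennreal (exp (- t\<^sup>2)) * (\<integral>\<^sup>+B. (\<Prod>p\<in>K. ennreal (exp (t * c p * B p))) \<partial>?U)"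
    by (intro nn_integral_cmult borel_measurable_prod_ennreal) measurable
  also have "(\<integral>\<^sup>+B. (\<Prod>p\<in>K. ennreal (exp (t * c p * B p))) \<partial>?U) = (\<Prod>p\<in>K. \<integral>\<^sup>+x. ennreal (exp (t * c p * x)) \<partial>sym_unif)"
    by (intro sym_unif_prod.product_nn_integral_prod K) measurable
  also have "\<dots> \<le> (\<Prod>p\<in>K. ennreal (exp ((t * c p)\<^sup>2 / 2)))"
    by (intro prod_mono_ennreal sym_unif_mgf)
  also have "\<dots> = ennreal (exp (t\<^sup>2 / 2 * (\<Sum>p\<in>K. (c p)\<^sup>2)))"
    using K by (simp add: prod_ennreal sum_distrib_left exp_sum power_mult_distrib)
  also have "\<dots> \<le> ennreal (exp (t\<^sup>2 / 2))"
    using c by (intro ennreal_leI) (simp add: mult_left_le)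
  finally show ?thesis
    by (simp add: mult_left_mono flip: ennreal_mult exp_add)
qed

text \<open>The points z / (4 sqrt (card I)) with z in the net are a quarter-net of the unit ball,
  obtained by rounding towards 0. The l1 bound makes them easy to count: weight z by
  (4/5) to the power of its l1 norm and use that 9 * (5/4)^4 is below 22.\<close>

definition int_net :: "nat set \<Rightarrow> (nat \<Rightarrow> int) set" where
  "int_net I = {z \<in> Pi\<^sub>E I (\<lambda>_. UNIV). (\<Sum>i\<in>I. \<bar>z i\<bar>) \<le> 4 * int (card I) \<and> (\<Sum>i\<in>I. (z i)\<^sup>2) \<le> 16 * int (card I)}"

text \<open>The limit 9 is (1 + q) / (1 - q) for q = 4/5, the two-sided geometric series; it is the
  factor per coordinate in the count.\<close>

lemma geometric_int_sum: "(\<Sum>z\<in>{- int k..int k}. (4 / 5 :: real) ^ nat \<bar>z\<bar>) = 9 - 8 * (4 / 5) ^ k"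
proof (induction k)
  case (Suc k)
  have "{- int (Suc k)..int (Suc k)} = insert (- int (Suc k)) (insert (int (Suc k)) {- int k..int k})" by auto
  then show ?case using Suc by (simp add: nat_add_distrib)
qed simp

lemma int_net_finite_card:
  assumes I: "finite I"
  shows "finite (int_net I)" "real (card (int_net I)) \<le> 22 ^ card I"
proof -
  let ?N = "card I" and ?box = "Pi\<^sub>E I (\<lambda>_. {- int (4 * card I)..int (4 * card I)})"
  have sub: "int_net I \<subseteq> ?box"
  proof
    fix z assume z: "z \<in> int_net I"
    have "- (4 * int ?N) \<le> z i \<and> z i \<le> 4 * int ?N" if "i \<in> I" for i
    proof -
      have "\<bar>z i\<bar> \<le> (\<Sum>i\<in>I. \<bar>z i\<bar>)" using I that by (intro member_le_sum) auto
      moreover have "(\<Sum>i\<in>I. \<bar>z i\<bar>) \<le> 4 * int ?N" using z by (simp add: int_net_def)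
      ultimately show ?thesis by linarith
    qed
    then show "z \<in> ?box" using z by (auto simp: int_net_def PiE_iff)
  qed
  have fb: "finite ?box" using I by (intro finite_PiE) auto
  show fin: "finite (int_net I)" by (rule finite_subset[OF sub fb])
  have "real (card (int_net I)) * (4 / 5) ^ (4 * ?N) = (\<Sum>z\<in>int_net I. (4 / 5) ^ (4 * ?N))" by simp
  also have "\<dots> \<le> (\<Sum>z\<in>int_net I. \<Prod>i\<in>I. (4 / 5) ^ nat \<bar>z i\<bar>)"
  proof (rule sum_mono)
    fix z assume z: "z \<in> int_net I"
    have "(\<Sum>i\<in>I. nat \<bar>z i\<bar>) \<le> 4 * ?N"
    proof -
      have "int (\<Sum>i\<in>I. nat \<bar>z i\<bar>) = (\<Sum>i\<in>I. \<bar>z i\<bar>)" by simp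
      also have "\<dots> \<le> 4 * int ?N" using z by (simp add: int_net_def)
      finally show ?thesis by linarith
    qed
    then have "(4 / 5 :: real) ^ (4 * ?N) \<le> (4 / 5) ^ (\<Sum>i\<in>I. nat \<bar>z i\<bar>)"
      by (intro power_decreasing) auto
    then show "(4 / 5 :: real) ^ (4 * ?N) \<le> (\<Prod>i\<in>I. (4 / 5) ^ nat \<bar>z i\<bar>)"
      by (simp add: power_sum)
  qed
  \<comment> \<open>Enlarging the net to a box makes the sum of the product weights factor over the
    coordinates.\<close>
  also have "\<dots> \<le> (\<Sum>z\<in>?box. \<Prod>i\<in>I. (4 / 5) ^ nat \<bar>z i\<bar>)"
    by (intro sum_mono2 fb sub prod_nonneg) auto
  also have "\<dots> = (\<Prod>i\<in>I. \<Sum>z\<in>{- int (4 * ?N)..int (4 * ?N)}. (4 / 5) ^ nat \<bar>z\<bar>)"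
    using I by (subst prod_sum_PiE) auto
  also have "\<dots> \<le> (\<Prod>i\<in>I. 9)"
    unfolding geometric_int_sum by (intro prod_mono) (auto simp: power_le_one intro: order_trans[OF mult_left_mono[OF power_le_one]])
  finally have *: "real (card (int_net I)) * (4 / 5) ^ (4 * ?N) \<le> 9 ^ ?N" by simp
  have "real (card (int_net I)) = real (card (int_net I)) * (4 / 5) ^ (4 * ?N) * (5 / 4) ^ (4 * ?N)"
    by (simp add: mult.assoc flip: power_mult_distrib)
  also have "\<dots> \<le> 9 ^ ?N * (5 / 4) ^ (4 * ?N)"
    using * by (intro mult_right_mono) auto
  also have "\<dots> = (9 * (5 / 4) ^ 4) ^ ?N" by (simp add: power_mult power_mult_distrib)
  also have "\<dots> \<le> 22 ^ ?N" by (intro power_mono) (auto simp: power_divide)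
  finally show "real (card (int_net I)) \<le> 22 ^ ?N" .
qed

definition int_trunc :: "real \<Rightarrow> int" where
  "int_trunc y = (if y \<ge> 0 then \<lfloor>y\<rfloor> else - \<lfloor>- y\<rfloor>)"

text \<open>Rounding towards 0 does not increase absolute values, so a rounded vector stays in the
  unit ball; rounding to the nearest integer would not ensure this.\<close>

lemma int_trunc: "\<bar>real_of_int (int_trunc y)\<bar> \<le> \<bar>y\<bar>" "\<bar>y - real_of_int (int_trunc y)\<bar> \<le> 1"
proof -
  have fl: "0 \<le> real_of_int \<lfloor>x\<rfloor>" "real_of_int \<lfloor>x\<rfloor> \<le> x" "x - real_of_int \<lfloor>x\<rfloor> \<le> 1" if "x \<ge> 0" for x :: real
    using that by (auto, linarith)
  show "\<bar>real_of_int (int_trunc y)\<bar> \<le> \<bar>y\<bar>" "\<bar>y - real_of_int (int_trunc y)\<bar> \<le> 1"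
    using fl[of y] fl[of "- y"] by (cases "y \<ge> 0"; simp add: int_trunc_def; linarith)+
qed

text \<open>The scale s has s^2 = 16 * card I and every coordinate moves by at most 1 / s, so the
  squared residual is at most 1/16. It is stated after multiplication by 4, as a vector that lies in
  the unit ball again.\<close>

lemma int_net_round:
  assumes I: "finite I" "I \<noteq> {}" and v: "(\<Sum>i\<in>I. (v i)\<^sup>2) \<le> 1"
  obtains z where "z \<in> int_net I"
    "(\<Sum>i\<in>I. (real_of_int (z i) / (4 * sqrt (card I)))\<^sup>2) \<le> 1"
    "(\<Sum>i\<in>I. (4 * (v i - real_of_int (z i) / (4 * sqrt (card I))))\<^sup>2) \<le> 1"
proof -
  define s where "s = 4 * sqrt (card I)"
  have N: "card I > 0" using I by (simp add: card_gt_0_iff)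
  have s0: "s > 0" and s2: "s\<^sup>2 = 16 * card I" using N by (auto simp: s_def power_mult_distrib)
  define z where "z = (\<lambda>i\<in>I. int_trunc (s * v i))"
  have z1: "\<bar>real_of_int (z i)\<bar> \<le> s * \<bar>v i\<bar>" if "i \<in> I" for i
    using int_trunc(1)[of "s * v i"] that s0 by (simp add: z_def abs_mult)
  have z2: "\<bar>v i - z i / s\<bar> \<le> 1 / s" if "i \<in> I" for i
  proof -
    have "v i - z i / s = (s * v i - z i) / s" using s0 by (simp add: field_simps)
    then show ?thesis using int_trunc(2)[of "s * v i"] that s0 by (simp add: z_def divide_right_mono)
  qed
  have zs: "(\<Sum>i\<in>I. (real_of_int (z i) / s)\<^sup>2) \<le> 1"
  proof -
    have "(\<Sum>i\<in>I. (real_of_int (z i) / s)\<^sup>2) \<le> (\<Sum>i\<in>I. (v i)\<^sup>2)"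
    proof (rule sum_mono)
      fix i assume "i \<in> I"
      then have "\<bar>real_of_int (z i) / s\<bar> \<le> \<bar>v i\<bar>" using z1 s0 by (simp add: abs_divide divide_le_eq mult.commute)
      then show "(real_of_int (z i) / s)\<^sup>2 \<le> (v i)\<^sup>2" by (rule abs_le_square_iff[THEN iffD1])
    qed
    then show ?thesis using v by simp
  qed
  have "z \<in> int_net I"
  proof -
    have "real_of_int (\<Sum>i\<in>I. \<bar>z i\<bar>) \<le> (\<Sum>i\<in>I. s * \<bar>v i\<bar>)"
      using z1 by (auto intro!: sum_mono)
    also have "\<dots> = s * (\<Sum>i\<in>I. \<bar>v i\<bar>)" by (simp add: sum_distrib_left)
    \<comment> \<open>Cauchy-Schwarz bounds the l1 norm of a unit vector by the root of the
      dimension; scaled by s this is the bound 4 * card I in the net.\<close>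
    also have "(\<Sum>i\<in>I. \<bar>v i\<bar>) \<le> sqrt (card I)"
    proof (rule real_le_rsqrt)
      have "(\<Sum>i\<in>I. \<bar>v i\<bar>)\<^sup>2 \<le> (\<Sum>i\<in>I. \<bar>v i\<bar>\<^sup>2) * card I" by (rule sum_squared_le_sum_of_squares)
      also have "\<dots> \<le> 1 * real (card I)" using v by (intro mult_right_mono) auto
      finally show "(\<Sum>i\<in>I. \<bar>v i\<bar>)\<^sup>2 \<le> card I" by simp
    qed
    also have "s * sqrt (card I) = real_of_int (4 * int (card I))" by (simp add: s_def)
    finally have 1: "(\<Sum>i\<in>I. \<bar>z i\<bar>) \<le> 4 * int (card I)" using s0 by (simp only: of_int_le_iff mult_left_mono)
    have "(\<Sum>i\<in>I. (real_of_int (z i))\<^sup>2) / s\<^sup>2 \<le> 1"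
      using zs by (simp add: power_divide sum_divide_distrib)
    then have "real_of_int (\<Sum>i\<in>I. (z i)\<^sup>2) \<le> real_of_int (16 * int (card I))"
      using s0 N by (simp add: divide_le_eq s2 split: if_splits)
    then have "(\<Sum>i\<in>I. (z i)\<^sup>2) \<le> 16 * int (card I)" by (simp only: of_int_le_iff)
    with 1 show ?thesis by (auto simp: int_net_def z_def)
  qed
  moreover have "(\<Sum>i\<in>I. (4 * (v i - real_of_int (z i) / s))\<^sup>2) \<le> 1"
  proof -
    have "(\<Sum>i\<in>I. (4 * (v i - real_of_int (z i) / s))\<^sup>2) \<le> (\<Sum>i\<in>I. 16 / s\<^sup>2)"
    proof (rule sum_mono)
      fix i assume "i \<in> I"
      then have "(v i - z i / s)\<^sup>2 \<le> (1 / s)\<^sup>2" using z2 s0 by (intro abs_le_square_iff[THEN iffD1]) simp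
      then show "(4 * (v i - real_of_int (z i) / s))\<^sup>2 \<le> 16 / s\<^sup>2" 
        by (simp only: power_mult_distrib) (simp add: power_divide)
    qed
    also have "\<dots> = 1" using N by (simp add: s2)
    finally show ?thesis .
  qed
  ultimately show ?thesis using zs that[of z] by (simp add: s_def)
qed

text \<open>Self-improvement of a supremum. With net points v', u' for v, u the form splits into its
  value at the net pair and two terms whose residuals are a quarter of vectors in the unit ball, so
  Sup \<le> t + Sup / 2. As the supremum is finite, it is at most 2 t; homogeneity extends this to
  all vectors.\<close>

lemma bilinear_net_bound:
  fixes B :: "nat \<times> nat \<Rightarrow> real" and I J :: "nat set"
  defines "b \<equiv> (\<lambda>v u. \<Sum>p\<in>I \<times> J. B p * (v (fst p) * u (snd p)))"
  assumes I: "finite I" "I \<noteq> {}" and J: "finite J" "J \<noteq> {}"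
    and net: "\<And>z w. z \<in> int_net I \<Longrightarrow> w \<in> int_net J \<Longrightarrow>
      (\<Sum>i\<in>I. (real_of_int (z i) / (4 * sqrt (card I)))\<^sup>2) \<le> 1 \<Longrightarrow>
      (\<Sum>j\<in>J. (real_of_int (w j) / (4 * sqrt (card J)))\<^sup>2) \<le> 1 \<Longrightarrow>
      b (\<lambda>i. real_of_int (z i) / (4 * sqrt (card I))) (\<lambda>j. real_of_int (w j) / (4 * sqrt (card J))) \<le> t"
  shows "b v u \<le> 2 * t * (sqrt (\<Sum>i\<in>I. (v i)\<^sup>2) * sqrt (\<Sum>j\<in>J. (u j)\<^sup>2))"
proof -
  define V :: "nat set \<Rightarrow> (nat \<Rightarrow> real) set" where "V I = {v. (\<Sum>i\<in>I. (v i)\<^sup>2) \<le> 1}" for I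
  define X where "X = {b v u | v u. v \<in> V I \<and> u \<in> V J}"
  have lin: "b (\<lambda>i. c * v i) u = c * b v u" "b v (\<lambda>i. c * u i) = c * b v u" for c v u
    unfolding b_def sum_distrib_left by (auto intro!: sum.cong)
  have add: "b v u = b v' u' + 1 / 4 * b (\<lambda>i. 4 * (v i - v' i)) u + 1 / 4 * b v' (\<lambda>i. 4 * (u i - u' i))" for v u v' u'
    unfolding b_def sum_distrib_left sum.distrib[symmetric] by (auto intro!: sum.cong simp: algebra_simps)
  have le1: "\<bar>v i\<bar> \<le> 1" if "v \<in> V I" "i \<in> I" "finite I" for v i I
  proof -
    have "(v i)\<^sup>2 \<le> (\<Sum>i\<in>I. (v i)\<^sup>2)" using that by (intro member_le_sum) auto
    then show ?thesis using that by (simp add: V_def abs_square_le_1[symmetric])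
  qed
  have bdd: "bdd_above X"
  proof (rule bdd_aboveI[of _ "\<Sum>p\<in>I \<times> J. \<bar>B p\<bar>"])
    fix x assume "x \<in> X"
    then obtain v u where x: "x = b v u" "v \<in> V I" "u \<in> V J" by (auto simp: X_def)
    show "x \<le> (\<Sum>p\<in>I \<times> J. \<bar>B p\<bar>)"
      unfolding x b_def
    proof (rule sum_mono)
      fix p assume p: "p \<in> I \<times> J"
      have "\<bar>v (fst p) * u (snd p)\<bar> \<le> 1"
        using le1[OF x(2), of "fst p"] le1[OF x(3), of "snd p"] p I J by (auto simp: abs_mult intro!: mult_le_one)
      then have "\<bar>B p * (v (fst p) * u (snd p))\<bar> \<le> \<bar>B p\<bar>" by (simp add: abs_mult mult_left_le del: abs_mult_pos)
      then show "B p * (v (fst p) * u (snd p)) \<le> \<bar>B p\<bar>" by linarith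
    qed
  qed
  have ne: "X \<noteq> {}"
  proof -
    have "(\<lambda>_. 0) \<in> V I" "(\<lambda>_. 0) \<in> V J" by (auto simp: V_def)
    then show ?thesis by (auto simp: X_def)
  qed
  have up: "b v u \<le> Sup X" if "v \<in> V I" "u \<in> V J" for v u
    using that by (intro cSup_upper bdd) (auto simp: X_def)
  have "Sup X \<le> t + Sup X / 2"
  proof (rule cSup_least[OF ne])
    fix x assume "x \<in> X"
    then obtain v u where x: "x = b v u" "v \<in> V I" "u \<in> V J" by (auto simp: X_def)
    obtain z where z: "z \<in> int_net I" "(\<Sum>i\<in>I. (real_of_int (z i) / (4 * sqrt (card I)))\<^sup>2) \<le> 1"
      "(\<Sum>i\<in>I. (4 * (v i - real_of_int (z i) / (4 * sqrt (card I))))\<^sup>2) \<le> 1"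
      using int_net_round[OF I, of v] x(2) unfolding V_def by blast
    obtain w where w: "w \<in> int_net J" "(\<Sum>i\<in>J. (real_of_int (w i) / (4 * sqrt (card J)))\<^sup>2) \<le> 1"
      "(\<Sum>i\<in>J. (4 * (u i - real_of_int (w i) / (4 * sqrt (card J))))\<^sup>2) \<le> 1"
      using int_net_round[OF J, of u] x(3) unfolding V_def by blast
    define v' where "v' = (\<lambda>i. real_of_int (z i) / (4 * sqrt (card I)))"
    define u' where "u' = (\<lambda>i. real_of_int (w i) / (4 * sqrt (card J)))"
    have "b v' u' \<le> t" unfolding v'_def u'_def by (rule net[OF z(1) w(1) z(2) w(2)])
    moreover have "b (\<lambda>i. 4 * (v i - v' i)) u \<le> Sup X"
      using z(3) x(3) by (intro up) (auto simp: V_def v'_def)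
    moreover have "b v' (\<lambda>i. 4 * (u i - u' i)) \<le> Sup X"
      using z(2) w(3) by (intro up) (auto simp: V_def v'_def u'_def)
    ultimately show "x \<le> t + Sup X / 2" unfolding x(1) using add[of v u v' u'] by linarith
  qed
  then have S: "Sup X \<le> 2 * t" by simp
  define nv where "nv = sqrt (\<Sum>i\<in>I. (v i)\<^sup>2)"
  define nu where "nu = sqrt (\<Sum>j\<in>J. (u j)\<^sup>2)"
  have nn: "nv \<ge> 0" "nu \<ge> 0" by (auto simp: nv_def nu_def sum_nonneg)
  show ?thesis
  proof (cases "nv = 0 \<or> nu = 0")
    case True
    then have "(\<forall>i\<in>I. v i = 0) \<or> (\<forall>j\<in>J. u j = 0)"
      using I J by (auto simp: nv_def nu_def sum_nonneg_eq_0_iff)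
    then have "b v u = 0" unfolding b_def by (intro sum.neutral) auto
    then show ?thesis using True unfolding nv_def nu_def by auto
  next
    case False
    then have pos: "nv > 0" "nu > 0" using nn by auto
    have sq: "nv\<^sup>2 = (\<Sum>i\<in>I. (v i)\<^sup>2)" "nu\<^sup>2 = (\<Sum>j\<in>J. (u j)\<^sup>2)" by (auto simp: nv_def nu_def sum_nonneg)
    have "(\<lambda>i. 1 / nv * v i) \<in> V I" "(\<lambda>i. 1 / nu * u i) \<in> V J"
      using pos by (auto simp: V_def power_divide sq[symmetric] simp flip: sum_divide_distrib)
    then have "1 / nv * (1 / nu * b v u) \<le> Sup X"
      using up[of "\<lambda>i. 1 / nv * v i" "\<lambda>i. 1 / nu * u i"] by (simp only: lin)
    with S have "1 / nv * (1 / nu * b v u) \<le> 2 * t" by linarith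
    then have "b v u \<le> 2 * t * (nv * nu)" using pos by (simp add: field_simps)
    then show ?thesis unfolding nv_def nu_def .
  qed
qed

section \<open>The regression prior\<close>

text \<open>The threshold provides numerical margins: it gives \<gamma> \<le> 1/30 and absorbs the
  loss of 1/4 in \<open>card K\<close> that an odd d causes.\<close>

locale regression_prior =
  fixes d :: nat
  assumes d100: "100 \<le> d"
begin

definition m :: nat where "m = d div 2"

definition K :: "(nat \<times> nat) set" where "K = {m..<d} \<times> {..<m}"

text \<open>With this scale an operator norm of 8 sqrt d for B becomes 8/3 for \<gamma> B, small
  enough for the window, while the squared Frobenius norm of \<gamma> B keeps the order d.\<close>

definition \<gamma> :: real where "\<gamma> = 1 / (3 * sqrt d)"

text \<open>For m \<le> i < d this is the conditional mean of coordinate i given the first m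
  coordinates.\<close>

definition shift :: "(nat \<times> nat \<Rightarrow> real) \<Rightarrow> (nat \<Rightarrow> real) \<Rightarrow> nat \<Rightarrow> real" where
  "shift B z i = \<gamma> * (\<Sum>j<m. B (i, j) * z j)"

text \<open>factor B is the matrix of the map (u, w) to (u, gamma B u + w).\<close>

definition factor :: "(nat \<times> nat \<Rightarrow> real) \<Rightarrow> nat \<Rightarrow> nat \<Rightarrow> real" where
  "factor B i k = (if i = k then 1 else 0) + (if m \<le> i \<and> k < m then \<gamma> * B (i, k) else 0)"

text \<open>The blocks are I, \<gamma> B^T in the first row and \<gamma> B, I + \<gamma>^2 B B^T in
  the second; the restriction puts the matrix into \<open>space (mat_space d)\<close>.\<close>

definition Cov :: "(nat \<times> nat \<Rightarrow> real) \<Rightarrow> nat \<Rightarrow> nat \<Rightarrow> real" where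
  "Cov B = (\<lambda>i\<in>{..<d}. \<lambda>j\<in>{..<d}. \<Sum>k<d. factor B i k * factor B j k)"

definition prior :: "(nat \<times> nat \<Rightarrow> real) measure" where
  "prior = PiM K (\<lambda>_. sym_unif)"

lemma m_bounds: "0 < m" "m < d" "m \<le> d"
  using d100 by (auto simp: m_def)

lemma finite_K [simp]: "finite K" by (simp add: K_def)

lemma card_K: "card K = (d - m) * m" by (simp add: K_def)

lemma card_K_bounds: "real (card K) \<le> (real d)\<^sup>2 / 4" "0.2499 * (real d)\<^sup>2 \<le> real (card K)"
proof -
  have c: "real (card K) = (real d - real m) * real m" using m_bounds by (simp add: card_K of_nat_diff)
  have m: "real m \<le> real d / 2" "real d / 2 - 1 / 2 \<le> real m"
    unfolding m_def by linarith+
  have 1: "real (card K) = (real d)\<^sup>2 / 4 - (real d / 2 - real m)\<^sup>2"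
    unfolding c by (simp add: power2_eq_square field_simps)
  then show "real (card K) \<le> (real d)\<^sup>2 / 4" by simp
  have "(real d / 2 - real m)\<^sup>2 \<le> (1 / 2)\<^sup>2" using m by (intro power_mono) auto
  moreover have "100\<^sup>2 \<le> (real d)\<^sup>2" using d100 by (intro power_mono) auto
  ultimately show "0.2499 * (real d)\<^sup>2 \<le> real (card K)" unfolding 1 by (simp add: power2_eq_square)
qed

lemma \<gamma>_pos: "\<gamma> > 0" using d100 by (simp add: \<gamma>_def)

lemma \<gamma>_le: "\<gamma> \<le> 1 / 30"
proof -
  have "10 \<le> sqrt (real d)" using d100 by (intro real_le_rsqrt) auto
  then show ?thesis using frac_le[of 1 1 30 "3 * sqrt d"] by (simp add: \<gamma>_def)
qed

lemma factor_apply: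
  assumes "i < d"
  shows "(\<Sum>k<d. factor B i k * z k) = z i + (if m \<le> i then shift B z i else 0)"
proof -
  have "(\<Sum>k<d. factor B i k * z k) = (\<Sum>k<d. (if k = i then z i else 0) + (if m \<le> i \<and> k < m then \<gamma> * (B (i, k) * z k) else 0))"
    unfolding factor_def by (intro sum.cong) auto
  also have "\<dots> = z i + (\<Sum>k<d. if m \<le> i \<and> k < m then \<gamma> * (B (i, k) * z k) else 0)"
    using assms by (simp add: sum.distrib)
  also have "(\<Sum>k<d. if m \<le> i \<and> k < m then \<gamma> * (B (i, k) * z k) else 0) = (if m \<le> i then shift B z i else 0)"
  proof -
    have "{..<d} \<inter> {k. k < m} = {..<m}" using m_bounds by auto
    then show ?thesis by (simp add: sum.If_cases shift_def sum_distrib_left)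
  qed
  finally show ?thesis .
qed

text \<open>A row of \<open>factor B\<close> with index j < m is a unit vector, so its product with
  row i reads off one entry.\<close>

lemma Cov_K:
  assumes "(i, j) \<in> K" shows "Cov B i j = \<gamma> * B (i, j)"
proof -
  have ij: "m \<le> i" "i < d" "j < m" "j < d" "i \<noteq> j" using assms m_bounds by (auto simp: K_def)
  have "Cov B i j = (\<Sum>k<d. factor B j k * factor B i k)" using ij by (simp add: Cov_def mult.commute)
  also have "\<dots> = factor B i j" using ij by (subst factor_apply) auto
  also have "\<dots> = \<gamma> * B (i, j)" using ij by (simp add: factor_def)
  finally show ?thesis .
qed

lemma Cov_space: "Cov B \<in> space (mat_space d)"
  by (auto simp: Cov_def mat_space_def vec_space_def space_PiM)

lemma gaussian_Cov: "gaussian d (Cov B) = linear_law d (factor B)"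
  by (rule gaussian_eq_linear_law) (simp add: Cov_def)

lemma linear_law_factor:
  "linear_law d (factor B) = distr (std_normal_vec d) (vec_space d) (\<lambda>z. \<lambda>i\<in>{..<d}. z i + (if m \<le> i then shift B z i else 0))"
  unfolding linear_law_def
  by (intro distr_cong refl) (auto simp: factor_apply intro!: restrict_ext)

lemma shift_measurable: "(\<lambda>z. shift B z i) \<in> borel_measurable (vec_space d)"
proof -
  have "(\<lambda>z. B (i, j) * z j) \<in> borel_measurable (vec_space d)" if "j < m" for j
    using that m_bounds measurable_vec_component[of j d] by auto
  then show ?thesis unfolding shift_def
    by (intro borel_measurable_times[OF borel_measurable_const borel_measurable_sum]) simp
qed

text \<open>Likelihood ratio of one sample against the standard normal. The factor is unit
  triangular, so only the change of the quadratic exponent remains.\<close>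

definition lik :: "(nat \<times> nat \<Rightarrow> real) \<Rightarrow> (nat \<Rightarrow> real) \<Rightarrow> real" where
  "lik B z = exp (\<Sum>i\<in>{m..<d}. shift B z i * z i - (shift B z i)\<^sup>2 / 2)"

lemma linear_law_density: "linear_law d (factor B) = density (std_normal_vec d) (\<lambda>z. ennreal (lik B z))"
proof -
  have "linear_law d (factor B) = density (std_normal_vec d) (\<lambda>z. \<Prod>i\<in>{m..<d}. ennreal (exp (shift B z i * z i - (shift B z i)\<^sup>2 / 2)))"
    unfolding linear_law_factor
    by (rule std_normal_vec_shear) (rule m_bounds, rule shift_measurable, simp add: shift_def)
  then show ?thesis by (simp add: lik_def exp_sum prod_ennreal)
qed

text \<open>The squared norm of F^T x for F = \<open>factor B\<close>, with the columns before m and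
  from m on evaluated separately. Positive definiteness can be read off for every B, inside the
  window or not.\<close>

lemma quad_form_Cov:
  "quad_form d (Cov B) x = (\<Sum>k<m. (x k + \<gamma> * (\<Sum>i\<in>{m..<d}. x i * B (i, k)))\<^sup>2) + (\<Sum>i\<in>{m..<d}. (x i)\<^sup>2)"
proof -
  have "quad_form d (Cov B) x = (\<Sum>i<d. \<Sum>j<d. \<Sum>k<d. (x i * factor B i k) * (x j * factor B j k))"
    unfolding quad_form_def Cov_def by (simp add: sum_distrib_left sum_distrib_right mult_ac)
  also have "\<dots> = (\<Sum>i<d. \<Sum>k<d. \<Sum>j<d. (x i * factor B i k) * (x j * factor B j k))"
    by (intro sum.cong refl sum.swap)
  also have "\<dots> = (\<Sum>k<d. \<Sum>i<d. \<Sum>j<d. (x i * factor B i k) * (x j * factor B j k))"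
    by (rule sum.swap)
  also have "\<dots> = (\<Sum>k<d. (\<Sum>i<d. x i * factor B i k)\<^sup>2)"
    by (simp add: power2_eq_square sum_product)
  also have "\<dots> = (\<Sum>k<m. (\<Sum>i<d. x i * factor B i k)\<^sup>2) + (\<Sum>k\<in>{m..<d}. (\<Sum>i<d. x i * factor B i k)\<^sup>2)"
    using m_bounds by (subst sum.union_disjoint[symmetric]) (auto intro!: sum.cong)
  also have "(\<Sum>k<m. (\<Sum>i<d. x i * factor B i k)\<^sup>2) = (\<Sum>k<m. (x k + \<gamma> * (\<Sum>i\<in>{m..<d}. x i * B (i, k)))\<^sup>2)"
  proof (intro sum.cong refl arg_cong[where f = "\<lambda>y. y\<^sup>2"])
    fix k assume k: "k \<in> {..<m}"
    have "(\<Sum>i<d. x i * factor B i k) = (\<Sum>i<d. (if i = k then x k else 0) + (if m \<le> i then \<gamma> * (x i * B (i, k)) else 0))"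
      using k unfolding factor_def by (intro sum.cong) (auto simp: algebra_simps)
    also have "\<dots> = x k + (\<Sum>i<d. if m \<le> i then \<gamma> * (x i * B (i, k)) else 0)"
      using k m_bounds by (simp add: sum.distrib)
    also have "(\<Sum>i<d. if m \<le> i then \<gamma> * (x i * B (i, k)) else 0) = \<gamma> * (\<Sum>i\<in>{m..<d}. x i * B (i, k))"
    proof -
      have "{..<d} \<inter> {i. m \<le> i} = {m..<d}" by auto
      then show ?thesis by (simp add: sum.If_cases sum_distrib_left)
    qed
    finally show "(\<Sum>i<d. x i * factor B i k) = x k + \<gamma> * (\<Sum>i\<in>{m..<d}. x i * B (i, k))" .
  qed
  also have "(\<Sum>k\<in>{m..<d}. (\<Sum>i<d. x i * factor B i k)\<^sup>2) = (\<Sum>i\<in>{m..<d}. (x i)\<^sup>2)"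
  proof (intro sum.cong refl arg_cong[where f = "\<lambda>y. y\<^sup>2"])
    fix k assume k: "k \<in> {m..<d}"
    have "(\<Sum>i<d. x i * factor B i k) = (\<Sum>i<d. if i = k then x k else 0)"
      using k unfolding factor_def by (intro sum.cong) auto
    then show "(\<Sum>i<d. x i * factor B i k) = x k" using k by simp
  qed
  finally show ?thesis .
qed

lemma sum_split: "(\<Sum>i<d. f i) = (\<Sum>k<m. f k) + (\<Sum>i\<in>{m..<d}. f i)" for f :: "nat \<Rightarrow> real"
  using m_bounds by (subst sum.union_disjoint[symmetric]) (auto intro!: sum.cong)

lemma symmetric_Cov: "symmetric_mat d (Cov B)"
  by (simp add: symmetric_mat_def Cov_def mult.commute)

lemma pos_def_Cov: "pos_def d (Cov B)"
  unfolding pos_def_def quad_form_Cov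
proof (intro conjI symmetric_Cov allI impI)
  fix x :: "nat \<Rightarrow> real" assume "\<exists>i<d. x i \<noteq> 0"
  then obtain i where i: "i < d" "x i \<noteq> 0" by blast
  show "0 < (\<Sum>k<m. (x k + \<gamma> * (\<Sum>i\<in>{m..<d}. x i * B (i, k)))\<^sup>2) + (\<Sum>i\<in>{m..<d}. (x i)\<^sup>2)"
  proof (cases "\<exists>j\<in>{m..<d}. x j \<noteq> 0")
    case True
    then obtain j where "j \<in> {m..<d}" "x j \<noteq> 0" by blast
    then have "0 < (\<Sum>i\<in>{m..<d}. (x i)\<^sup>2)" by (intro sum_pos2[of _ j]) auto
    then show ?thesis by (intro add_nonneg_pos sum_nonneg) auto
  next
    case False
    then have "i < m" using i by (cases "i < m") auto
    have "(\<Sum>k<m. (x k + \<gamma> * (\<Sum>i\<in>{m..<d}. x i * B (i, k)))\<^sup>2) = (\<Sum>k<m. (x k)\<^sup>2)"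
      using False by (intro sum.cong refl) simp
    moreover have "0 < (\<Sum>k<m. (x k)\<^sup>2)" using i \<open>i < m\<close> by (intro sum_pos2[of _ i]) auto
    ultimately show ?thesis by (intro add_pos_nonneg sum_nonneg) auto
  qed
qed

text \<open>Let v be the lower part of x. The hypothesis is applied to v and to c = \<gamma> B^T v
  itself: the bilinear form then produces |c|^2, and division by |c| gives |c| \<le> 8/3 |v|. What
  remains is to compare |u + c|^2 with |u|^2 for the upper part u, by weighted Young
  inequalities.\<close>

lemma Cov_in_W:
  assumes "\<And>v u. (\<Sum>p\<in>K. B p * (v (fst p) * u (snd p))) \<le> 8 * sqrt d * (sqrt (\<Sum>i\<in>{m..<d}. (v i)\<^sup>2) * sqrt (\<Sum>j<m. (u j)\<^sup>2))"
  shows "Cov B \<in> W_set d"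
  unfolding W_set_def mem_Collect_eq
proof (intro conjI allI Cov_space symmetric_Cov)
  fix x :: "nat \<Rightarrow> real"
  define c where "c k = \<gamma> * (\<Sum>i\<in>{m..<d}. x i * B (i, k))" for k
  define a2 where "a2 = (\<Sum>k<m. (x k)\<^sup>2)"
  define b2 where "b2 = (\<Sum>i\<in>{m..<d}. (x i)\<^sup>2)"
  define c2 where "c2 = (\<Sum>k<m. (c k)\<^sup>2)"
  define q where "q = (\<Sum>k<m. (x k + c k)\<^sup>2)"
  have nn: "a2 \<ge> 0" "b2 \<ge> 0" "c2 \<ge> 0" "q \<ge> 0" by (auto simp: a2_def b2_def c2_def q_def sum_nonneg)
  have Q: "quad_form d (Cov B) x = q + b2" unfolding quad_form_Cov q_def b2_def c_def ..
  have N: "(\<Sum>i<d. (x i)\<^sup>2) = a2 + b2" unfolding sum_split a2_def b2_def ..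
  have c2b: "c2 \<le> 64 / 9 * b2"
  proof -
    have "c2 = (\<Sum>k<m. \<gamma> * (\<Sum>i\<in>{m..<d}. x i * B (i, k)) * c k)"
      unfolding c2_def power2_eq_square by (simp add: c_def)
    also have "\<dots> = \<gamma> * (\<Sum>i\<in>{m..<d}. \<Sum>k<m. B (i, k) * (x i * c k))"
      unfolding sum_distrib_left sum_distrib_right by (subst sum.swap) (simp add: mult_ac)
    also have "\<dots> = \<gamma> * (\<Sum>p\<in>K. B p * (x (fst p) * c (snd p)))"
      unfolding K_def by (simp add: sum.cartesian_product case_prod_beta)
    also have "\<dots> \<le> \<gamma> * (8 * sqrt d * (sqrt b2 * sqrt c2))"
      using assms[of x c] \<gamma>_pos unfolding b2_def c2_def by (intro mult_left_mono) auto
    also have "\<dots> = 8 / 3 * (sqrt b2 * sqrt c2)" using d100 by (simp add: \<gamma>_def)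
    finally have 1: "sqrt c2 * sqrt c2 \<le> (8 / 3 * sqrt b2) * sqrt c2" using nn by simp
    have "sqrt c2 \<le> 8 / 3 * sqrt b2"
    proof (cases "c2 = 0")
      case False
      then have "sqrt c2 > 0" using nn by simp
      then show ?thesis using 1 by (simp only: mult_le_cancel_right_pos)
    qed (use nn in simp)
    then have "(sqrt c2)\<^sup>2 \<le> (8 / 3 * sqrt b2)\<^sup>2" using nn by (intro power_mono) auto
    then show ?thesis using nn by (simp add: power_mult_distrib power_divide)
  qed
  \<comment> \<open>The weight 10 exhausts the upper limit for \<open>a2\<close>; for
    \<open>b2\<close> it leaves 10/9 * 64/9 + 1 = 721/81, below 10.\<close>
  have up: "q \<le> 10 * a2 + 10 / 9 * c2"
  proof -
    have "(a + c)\<^sup>2 \<le> 10 * a\<^sup>2 + 10 / 9 * c\<^sup>2" for a c :: real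
      using zero_le_power2[of "3 * a - c / 3"] by (simp add: power2_eq_square algebra_simps)
    then show ?thesis unfolding q_def a2_def c2_def sum_distrib_left sum.distrib[symmetric] by (intro sum_mono)
  qed
  \<comment> \<open>Here 0.09 * 11 \<le> 1 covers \<open>q\<close>, and 0.09 * (11/10 * 64/9 + 1)
    \<le> 1 covers \<open>b2\<close>.\<close>
  have lo: "a2 \<le> 11 * q + 11 / 10 * c2"
  proof -
    have "a\<^sup>2 \<le> 11 * (a + c)\<^sup>2 + 11 / 10 * c\<^sup>2" for a c :: real
      using zero_le_power2[of "10 * (a + c) + c"] by (simp add: power2_eq_square algebra_simps)
    then show ?thesis unfolding q_def a2_def c2_def sum_distrib_left sum.distrib[symmetric] by (intro sum_mono)
  qed
  show "0.09 * (\<Sum>i<d. (x i)\<^sup>2) \<le> quad_form d (Cov B) x"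
    unfolding Q N using lo c2b nn by (simp add: field_simps)
  show "quad_form d (Cov B) x \<le> 10 * (\<Sum>i<d. (x i)\<^sup>2)"
    unfolding Q N using up c2b nn by (simp add: field_simps)
qed

lemma prior_component_measurable: "p \<in> K \<Longrightarrow> (\<lambda>B. B p) \<in> borel_measurable prior"
  unfolding prior_def by measurable

lemma prob_space_prior: "prob_space prior"
  unfolding prior_def by (intro prob_space_PiM prob_space_sym_unif)

lemma Cov_measurable: "Cov \<in> measurable prior (mat_space d)"
proof -
  have f: "(\<lambda>B. factor B i k) \<in> borel_measurable prior" if "i < d" for i k
  proof (cases "m \<le> i \<and> k < m")
    case True
    then have "(i, k) \<in> K" using that by (simp add: K_def)
    note c = prior_component_measurable[OF this]
    have "(\<lambda>B. factor B i k) = (\<lambda>B. (if i = k then 1 else 0) + \<gamma> * B (i, k))"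
      using True by (simp add: factor_def fun_eq_iff)
    then show ?thesis
      by (simp only:) (intro borel_measurable_add borel_measurable_times borel_measurable_const c)
  next
    case False
    then have "(\<lambda>B. factor B i k) = (\<lambda>B. if i = k then 1 else 0)"
      by (auto simp: factor_def fun_eq_iff)
    then show ?thesis by (simp only: borel_measurable_const)
  qed
  have "(\<lambda>B. \<lambda>j\<in>{..<d}. \<Sum>k<d. factor B i k * factor B j k) \<in> measurable prior (vec_space d)" if "i < d" for i
    unfolding vec_space_def
  proof (rule measurable_restrict)
    fix j assume "j \<in> {..<d}"
    then have "(\<lambda>B. \<Sum>k<d. factor B i k * factor B j k) \<in> borel_measurable prior"
      using that by (intro borel_measurable_sum borel_measurable_times f) auto
    then show "(\<lambda>B. \<Sum>k<d. factor B i k * factor B j k) \<in> measurable prior lborel"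
      by (simp only: measurable_lborel1)
  qed
  then have "(\<lambda>B. Cov B) \<in> measurable prior (mat_space d)"
    unfolding Cov_def mat_space_def by (intro measurable_restrict) (simp only: lessThan_iff)
  then show ?thesis .
qed

text \<open>Union bound over at most 22^(d - m) * 22^m = 22^d pairs of net points, each with tail
  probability exp (-8 d) \<le> 256^-d, and 22/256 is below 1/8.\<close>

lemma prior_outside_W: "emeasure prior {B \<in> space prior. Cov B \<notin> W_set d} \<le> ennreal ((1 / 8) ^ d)"
proof -
  let ?I = "{m..<d}" and ?J = "{..<m}"
  define v where "v I z = (\<lambda>i. real_of_int (z i) / (4 * sqrt (card I)))" for I :: "nat set" and z :: "nat \<Rightarrow> int"
  \<comment> \<open>The tail bound needs coefficients of norm at most 1, so only net points in the
    unit ball are used.\<close>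
  define N where "N I = {z \<in> int_net I. (\<Sum>i\<in>I. (v I z i)\<^sup>2) \<le> 1}" for I
  \<comment> \<open>The net argument doubles t, which gives the 8 sqrt d of \<open>Cov_in_W\<close>;
    t^2 / 2 = 8 d is the exponent of the tail.\<close>
  define t where "t = 4 * sqrt d"
  have t: "t > 0" using d100 by (simp add: t_def)
  define E where "E q = {B \<in> space prior. t < (\<Sum>p\<in>K. B p * (v ?I (fst q) (fst p) * v ?J (snd q) (snd p)))}" for q
  have fN: "finite (N I)" "real (card (N I)) \<le> 22 ^ card I" if "finite I" for I
  proof -
    have sub: "N I \<subseteq> int_net I" by (auto simp: N_def)
    show "finite (N I)" using sub int_net_finite_card(1)[OF that] by (rule finite_subset)
    have "card (N I) \<le> card (int_net I)" by (rule card_mono[OF int_net_finite_card(1)[OF that] sub])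
    then show "real (card (N I)) \<le> 22 ^ card I" using int_net_finite_card(2)[OF that] by linarith
  qed
  have sub: "{B \<in> space prior. Cov B \<notin> W_set d} \<subseteq> (\<Union>q\<in>N ?I \<times> N ?J. E q)"
  proof
    fix B assume "B \<in> {B \<in> space prior. Cov B \<notin> W_set d}"
    then have B: "B \<in> space prior" "Cov B \<notin> W_set d" by auto
    show "B \<in> (\<Union>q\<in>N ?I \<times> N ?J. E q)"
    proof (rule ccontr)
      assume no: "B \<notin> (\<Union>q\<in>N ?I \<times> N ?J. E q)"
      have "Cov B \<in> W_set d"
      proof (rule Cov_in_W)
        fix w u :: "nat \<Rightarrow> real"
        have "(\<Sum>p\<in>?I \<times> ?J. B p * (w (fst p) * u (snd p))) \<le> 2 * t * (sqrt (\<Sum>i\<in>?I. (w i)\<^sup>2) * sqrt (\<Sum>j\<in>?J. (u j)\<^sup>2))"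
        proof (rule bilinear_net_bound)
          show "finite ?I" "finite ?J" "?I \<noteq> {}" "?J \<noteq> {}" using m_bounds by auto
          fix y z assume "y \<in> int_net ?I" "z \<in> int_net ?J"
            "(\<Sum>i\<in>?I. (real_of_int (y i) / (4 * sqrt (card ?I)))\<^sup>2) \<le> 1"
            "(\<Sum>j\<in>?J. (real_of_int (z j) / (4 * sqrt (card ?J)))\<^sup>2) \<le> 1"
          then have "(y, z) \<in> N ?I \<times> N ?J" unfolding N_def v_def by blast
          then have "B \<notin> E (y, z)" using no by blast
          then show "(\<Sum>p\<in>?I \<times> ?J. B p * (real_of_int (y (fst p)) / (4 * sqrt (card ?I)) * (real_of_int (z (snd p)) / (4 * sqrt (card ?J))))) \<le> t"
            using B(1) by (simp add: E_def v_def K_def not_less)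
        qed
        then show "(\<Sum>p\<in>K. B p * (w (fst p) * u (snd p))) \<le> 8 * sqrt d * (sqrt (\<Sum>i\<in>{m..<d}. (w i)\<^sup>2) * sqrt (\<Sum>j<m. (u j)\<^sup>2))"
          by (simp add: K_def t_def)
      qed
      then show False using B by simp
    qed
  qed
  have Em: "E q \<in> sets prior" for q
    unfolding E_def prior_def by measurable
  have fin: "finite (N ?I \<times> N ?J)" using fN(1) by auto
  have "emeasure prior {B \<in> space prior. Cov B \<notin> W_set d} \<le> emeasure prior (\<Union>q\<in>N ?I \<times> N ?J. E q)"
    using Em fin by (intro emeasure_mono sub sets.finite_UN) auto
  also have "\<dots> \<le> (\<Sum>q\<in>N ?I \<times> N ?J. emeasure prior (E q))"
    using Em by (intro emeasure_subadditive_finite fin) auto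
  also have "\<dots> \<le> (\<Sum>q\<in>N ?I \<times> N ?J. ennreal (exp (- t\<^sup>2 / 2)))"
  proof (rule sum_mono)
    fix q assume q: "q \<in> N ?I \<times> N ?J"
    have "(\<Sum>p\<in>K. (v ?I (fst q) (fst p) * v ?J (snd q) (snd p))\<^sup>2) = (\<Sum>i\<in>?I. (v ?I (fst q) i)\<^sup>2) * (\<Sum>j\<in>?J. (v ?J (snd q) j)\<^sup>2)"
      unfolding K_def sum_product sum.cartesian_product by (simp add: power_mult_distrib case_prod_beta)
    also have "\<dots> \<le> 1" using q by (intro mult_le_one) (auto simp: N_def sum_nonneg)
    finally show "emeasure prior (E q) \<le> ennreal (exp (- t\<^sup>2 / 2))"
      unfolding E_def prior_def by (intro sym_unif_tail t) auto
  qed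
  also have "\<dots> = ennreal (real (card (N ?I)) * real (card (N ?J)) * exp (- t\<^sup>2 / 2))"
    by (simp add: ennreal_of_nat_eq_real_of_nat card_cartesian_product flip: ennreal_mult)
  also have "\<dots> \<le> ennreal ((1 / 8) ^ d)"
  proof (rule ennreal_leI)
    have "real (card (N ?I)) * real (card (N ?J)) \<le> 22 ^ card ?I * 22 ^ card ?J"
      by (intro mult_mono fN) auto
    also have "\<dots> = 22 ^ d" using m_bounds by (simp flip: power_add)
    finally have 1: "real (card (N ?I)) * real (card (N ?J)) \<le> 22 ^ d" .
    have "2 ^ 8 \<le> exp (1::real) ^ 8" using exp_ge_add_one_self[of 1] by (intro power_mono) auto
    then have "256 \<le> exp (8::real)" by (simp flip: exp_of_nat_mult)
    then have "exp (- 8) \<le> (1 / 256 :: real)" by (simp add: exp_minus field_simps)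
    then have "exp (- 8 :: real) ^ d \<le> (1 / 256) ^ d" by (intro power_mono) auto
    moreover have "exp (- t\<^sup>2 / 2) = exp (- 8) ^ d"
      by (simp add: t_def power_mult_distrib flip: exp_of_nat_mult)
    ultimately have "real (card (N ?I)) * real (card (N ?J)) * exp (- t\<^sup>2 / 2) \<le> 22 ^ d * (1 / 256) ^ d"
      using 1 by (intro mult_mono) auto
    also have "\<dots> \<le> (1 / 8) ^ d" unfolding power_mult_distrib[symmetric] by (intro power_mono) auto
    finally show "real (card (N ?I)) * real (card (N ?J)) * exp (- t\<^sup>2 / 2) \<le> (1 / 8) ^ d" .
  qed
  finally show ?thesis .
qed

end

section \<open>Scores and the attack statistic\<close>

lemma std_normal_monomial:
  fixes e :: "nat \<Rightarrow> nat"
  shows "integrable (std_normal_vec d) (\<lambda>z. \<Prod>k<d. z k ^ e k)"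
    and "(\<integral>z. (\<Prod>k<d. z k ^ e k) \<partial>std_normal_vec d) = (\<Prod>k<d. \<integral>x. x ^ e k \<partial>std_normal_distribution)"
  by (intro std_normal_prod.product_integrable_prod[where f = "\<lambda>k x. x ^ e k"] integrable_std_normal_distribution_moment finite_lessThan)
    (intro std_normal_prod.product_integral_prod[where f = "\<lambda>k x. x ^ e k"] integrable_std_normal_distribution_moment finite_lessThan)

lemma std_normal_moments: "(\<integral>x. x ^ 0 \<partial>std_normal_distribution) = 1"
  "(\<integral>x. x ^ 1 \<partial>std_normal_distribution) = 0" "(\<integral>x. x ^ 2 \<partial>std_normal_distribution) = 1"
  using integral_std_normal_distribution_moment_odd[of 1] std_normal_distribution_even_moments(1)[of 1] std_normal.prob_space
  by (auto simp: fact_numeral)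

text \<open>The products are monomials in independent coordinates. As i, i' differ from j, j',
  unequal pairs leave some coordinate with exponent 1, whose factor has mean 0; equal pairs give
  second moments.\<close>

lemma std_normal_cross_moments:
  assumes "i < d" "j < d" "i' < d" "j' < d" "i \<noteq> j" "i \<noteq> j'" "i' \<noteq> j" "i' \<noteq> j'"
  shows "integrable (std_normal_vec d) (\<lambda>z. z i * z j)" "(\<integral>z. z i * z j \<partial>std_normal_vec d) = 0"
    and "integrable (std_normal_vec d) (\<lambda>z. (z i * z j) * (z i' * z j'))"
    and "(\<integral>z. (z i * z j) * (z i' * z j') \<partial>std_normal_vec d) = (if i = i' \<and> j = j' then 1 else 0)"
proof -
  let ?e = "\<lambda>i k. if k = i then 1 else 0 :: nat"
  have coord: "z i = (\<Prod>k<d. z k ^ ?e i k)" if "i < d" for i and z :: "nat \<Rightarrow> real"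
  proof -
    have "(\<Prod>k<d. z k ^ ?e i k) = (\<Prod>k<d. if k = i then z k else 1)" by (intro prod.cong) auto
    then show ?thesis using that by simp
  qed
  have 2: "z i * z j = (\<Prod>k<d. z k ^ (?e i k + ?e j k))" for z :: "nat \<Rightarrow> real"
    unfolding power_add prod.distrib using coord[OF assms(1), of z] coord[OF assms(2), of z] by simp
  have 4: "(z i * z j) * (z i' * z j') = (\<Prod>k<d. z k ^ (?e i k + ?e j k + (?e i' k + ?e j' k)))" for z :: "nat \<Rightarrow> real"
    unfolding power_add prod.distrib
    using coord[OF assms(1), of z] coord[OF assms(2), of z] coord[OF assms(3), of z] coord[OF assms(4), of z] by simp
  show "integrable (std_normal_vec d) (\<lambda>z. z i * z j)" unfolding 2 by (rule std_normal_monomial)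
  show "integrable (std_normal_vec d) (\<lambda>z. (z i * z j) * (z i' * z j'))" unfolding 4 by (rule std_normal_monomial)
  have one: "(\<Prod>k<d. \<integral>x. x ^ e k \<partial>std_normal_distribution) = 0" if "e i = 1" "i < d" for e :: "nat \<Rightarrow> nat" and i
    using that std_normal_moments(2) by (intro prod_zero) (auto intro!: bexI[of _ i])
  show "(\<integral>z. z i * z j \<partial>std_normal_vec d) = 0"
    unfolding 2 std_normal_monomial(2) using assms by (intro one[of _ i]) auto
  show "(\<integral>z. (z i * z j) * (z i' * z j') \<partial>std_normal_vec d) = (if i = i' \<and> j = j' then 1 else 0)"
  proof (cases "i = i' \<and> j = j'")
    case True
    have "(\<Prod>k<d. \<integral>x. x ^ (?e i k + ?e j k + (?e i' k + ?e j' k)) \<partial>std_normal_distribution) = 1"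
      using True assms std_normal_moments by (intro prod.neutral) (auto simp: numeral_2_eq_2)
    then show ?thesis unfolding 4 std_normal_monomial(2) using True by simp
  next
    case False
    have "(\<Prod>k<d. \<integral>x. x ^ (?e i k + ?e j k + (?e i' k + ?e j' k)) \<partial>std_normal_distribution) = 0"
    proof (cases "i = i'")
      case True
      then show ?thesis using False assms by (intro one[of _ j]) auto
    next
      case F: False
      then show ?thesis using assms by (intro one[of _ i]) auto
    qed
    then show ?thesis unfolding 4 std_normal_monomial(2) if_not_P[OF False] .
  qed
qed

context regression_prior
begin

text \<open>The derivative of the log-likelihood of x in B p is gamma * score B x p.\<close>

definition score :: "(nat \<times> nat \<Rightarrow> real) \<Rightarrow> (nat \<Rightarrow> real) \<Rightarrow> nat \<times> nat \<Rightarrow> real" where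
  "score B x p = (x (fst p) - shift B x (fst p)) * x (snd p)"

definition law :: "(nat \<times> nat \<Rightarrow> real) \<Rightarrow> (nat \<Rightarrow> real) measure" where
  "law B = linear_law d (factor B)"

definition push :: "(nat \<times> nat \<Rightarrow> real) \<Rightarrow> (nat \<Rightarrow> real) \<Rightarrow> nat \<Rightarrow> real" where
  "push B z = (\<lambda>i\<in>{..<d}. z i + (if m \<le> i then shift B z i else 0))"

abbreviation sample :: "nat \<Rightarrow> (nat \<times> nat \<Rightarrow> real) \<Rightarrow> (nat \<Rightarrow> nat \<Rightarrow> real) measure" where
  "sample n B \<equiv> PiM {..<n} (\<lambda>_. law B)"

lemma prob_space_law: "prob_space (law B)" unfolding law_def by (rule prob_space_linear_law)

lemma sets_law [simp, measurable_cong]: "sets (law B) = sets (vec_space d)" by (simp add: law_def)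

lemma law_eq_distr: "law B = distr (std_normal_vec d) (vec_space d) (push B)"
  unfolding law_def linear_law_factor push_def ..

lemma push_measurable: "push B \<in> measurable (std_normal_vec d) (vec_space d)"
proof -
  have "(\<lambda>z. \<lambda>i\<in>{..<d}. \<Sum>k<d. factor B i k * z k) \<in> measurable (vec_space d) (vec_space d)" by measurable
  moreover have "(\<lambda>z. \<lambda>i\<in>{..<d}. \<Sum>k<d. factor B i k * z k) = push B"
    unfolding push_def by (auto simp: factor_apply intro!: ext restrict_ext)
  ultimately show ?thesis using measurable_cong_sets[OF sets_std_normal_vec[of d] refl] by metis
qed

text \<open>On a pushed vector the residual v - \<gamma> B u is the noise itself. The scores become
  products of two independent standard normals, with a law that does not depend on B.\<close>

lemma score_push:
  assumes "p \<in> K" shows "score B (push B z) p = z (fst p) * z (snd p)"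
proof -
  have p: "m \<le> fst p" "fst p < d" "snd p < m" "snd p < d" using assms m_bounds by (auto simp: K_def)
  have "shift B (push B z) i = shift B z i" for i
    unfolding shift_def using m_bounds by (intro arg_cong[where f = "\<lambda>s. \<gamma> * s"] sum.cong) (auto simp: push_def)
  then show ?thesis using p by (simp add: score_def push_def)
qed

lemma score_measurable:
  assumes "p \<in> K" shows "(\<lambda>x. score B x p) \<in> borel_measurable (vec_space d)"
proof -
  have "fst p < d" "snd p < d" using assms m_bounds by (auto simp: K_def)
  then show ?thesis
    unfolding score_def
    by (intro borel_measurable_times borel_measurable_diff measurable_vec_component shift_measurable)
qed

lemma K_cross:
  assumes "p \<in> K" "p' \<in> K"
  shows "integrable (std_normal_vec d) (\<lambda>z. z (fst p) * z (snd p))" "(\<integral>z. z (fst p) * z (snd p) \<partial>std_normal_vec d) = 0"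
    and "integrable (std_normal_vec d) (\<lambda>z. (z (fst p) * z (snd p)) * (z (fst p') * z (snd p')))"
    and "(\<integral>z. (z (fst p) * z (snd p)) * (z (fst p') * z (snd p')) \<partial>std_normal_vec d) = (if p = p' then 1 else 0)"
proof -
  have "fst p < d" "snd p < d" "fst p' < d" "snd p' < d" "fst p \<noteq> snd p" "fst p \<noteq> snd p'" "fst p' \<noteq> snd p" "fst p' \<noteq> snd p'"
    using assms m_bounds by (auto simp: K_def)
  note c = std_normal_cross_moments[OF this]
  show "integrable (std_normal_vec d) (\<lambda>z. z (fst p) * z (snd p))" "(\<integral>z. z (fst p) * z (snd p) \<partial>std_normal_vec d) = 0"
    "integrable (std_normal_vec d) (\<lambda>z. (z (fst p) * z (snd p)) * (z (fst p') * z (snd p')))"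
    by (rule c)+
  show "(\<integral>z. (z (fst p) * z (snd p)) * (z (fst p') * z (snd p')) \<partial>std_normal_vec d) = (if p = p' then 1 else 0)"
    unfolding c(4) by (simp add: prod_eq_iff)
qed

text \<open>Under \<open>law B\<close> the scores are centred and orthonormal. The coefficients are
  arbitrary because they will be the weighted errors of a fixed output.\<close>

lemma score_sum_law:
  shows "integrable (law B) (\<lambda>x. \<Sum>p\<in>K. c p * score B x p)"
    and "(\<integral>x. (\<Sum>p\<in>K. c p * score B x p) \<partial>law B) = 0"
    and "integrable (law B) (\<lambda>x. (\<Sum>p\<in>K. c p * score B x p)\<^sup>2)"
    and "(\<integral>x. (\<Sum>p\<in>K. c p * score B x p)\<^sup>2 \<partial>law B) = (\<Sum>p\<in>K. (c p)\<^sup>2)"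
proof -
  have m: "(\<lambda>x. \<Sum>p\<in>K. c p * score B x p) \<in> borel_measurable (vec_space d)"
    using score_measurable by (intro borel_measurable_sum borel_measurable_times) auto
  have m2: "(\<lambda>x. (\<Sum>p\<in>K. c p * score B x p)\<^sup>2) \<in> borel_measurable (vec_space d)"
    using m by (rule borel_measurable_power)
  have e: "(\<Sum>p\<in>K. c p * score B (push B z) p) = (\<Sum>p\<in>K. c p * (z (fst p) * z (snd p)))" for z
    by (intro sum.cong) (auto simp: score_push)
  have e2: "(\<Sum>p\<in>K. c p * (z (fst p) * z (snd p)))\<^sup>2 = (\<Sum>p\<in>K. \<Sum>p'\<in>K. c p * c p' * ((z (fst p) * z (snd p)) * (z (fst p') * z (snd p'))))" for z
    unfolding power2_eq_square sum_product by (intro sum.cong) (auto simp: mult_ac)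
  let ?W = "\<lambda>p p' z. (z (fst p) * z (snd p)) * (z (fst p') * z (snd p')) :: real"
  have i1: "integrable (std_normal_vec d) (\<lambda>z. c p * (z (fst p) * z (snd p)))" if "p \<in> K" for p
    by (intro integrable_mult_right K_cross(1)[OF that that])
  have i2: "integrable (std_normal_vec d) (\<lambda>z. c p * c p' * ?W p p' z)" if "p \<in> K" "p' \<in> K" for p p'
    by (intro integrable_mult_right K_cross(3)[OF that])
  show "integrable (law B) (\<lambda>x. \<Sum>p\<in>K. c p * score B x p)"
    unfolding law_eq_distr integrable_distr_eq[OF push_measurable m] e
    by (intro Bochner_Integration.integrable_sum i1)
  have "(\<integral>x. (\<Sum>p\<in>K. c p * score B x p) \<partial>law B) = (\<Sum>p\<in>K. \<integral>z. c p * (z (fst p) * z (snd p)) \<partial>std_normal_vec d)"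
    unfolding law_eq_distr integral_distr[OF push_measurable m] e
    by (intro Bochner_Integration.integral_sum i1)
  also have "\<dots> = (\<Sum>p\<in>K. c p * 0)"
    by (intro sum.cong refl) (subst integral_mult_right_zero, subst K_cross(2), auto)
  finally show "(\<integral>x. (\<Sum>p\<in>K. c p * score B x p) \<partial>law B) = 0" by simp
  show "integrable (law B) (\<lambda>x. (\<Sum>p\<in>K. c p * score B x p)\<^sup>2)"
    unfolding law_eq_distr integrable_distr_eq[OF push_measurable m2] e e2
    by (intro Bochner_Integration.integrable_sum i2)
  have "(\<integral>x. (\<Sum>p\<in>K. c p * score B x p)\<^sup>2 \<partial>law B) = (\<Sum>p\<in>K. \<integral>z. (\<Sum>p'\<in>K. c p * c p' * ?W p p' z) \<partial>std_normal_vec d)"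
    unfolding law_eq_distr integral_distr[OF push_measurable m2] e e2
    by (intro Bochner_Integration.integral_sum Bochner_Integration.integrable_sum i2)
  also have "\<dots> = (\<Sum>p\<in>K. \<Sum>p'\<in>K. \<integral>z. c p * c p' * ?W p p' z \<partial>std_normal_vec d)"
    by (intro sum.cong refl Bochner_Integration.integral_sum i2)
  also have "\<dots> = (\<Sum>p\<in>K. \<Sum>p'\<in>K. c p * c p' * (if p = p' then 1 else 0))"
  proof (intro sum.cong refl)
    fix p p' assume "p \<in> K" "p' \<in> K"
    from K_cross(4)[OF this]
    show "(\<integral>z. c p * c p' * ?W p p' z \<partial>std_normal_vec d) = c p * c p' * (if p = p' then 1 else 0)"
      by (subst integral_mult_right_zero) (simp only:)
  qed
  also have "\<dots> = (\<Sum>p\<in>K. (c p)\<^sup>2)"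
    by (simp add: power2_eq_square if_distrib[where f = "\<lambda>x. _ * x"] cong: if_cong)
  finally show "(\<integral>x. (\<Sum>p\<in>K. c p * score B x p)\<^sup>2 \<partial>law B) = (\<Sum>p\<in>K. (c p)\<^sup>2)" .
qed

lemma score_abs_law:
  assumes p: "p \<in> K"
  shows "integrable (law B) (\<lambda>x. score B x p)" "(\<integral>x. score B x p \<partial>law B) = 0"
    and "(\<integral>x. \<bar>score B x p\<bar> \<partial>law B) \<le> 1"
proof -
  interpret prob_space "law B" by (rule prob_space_law)
  have e: "(\<Sum>p'\<in>K. (if p' = p then 1 else 0) * score B x p') = score B x p" for x
  proof -
    have "(\<Sum>p'\<in>K. (if p' = p then 1 else 0) * score B x p') = (\<Sum>p'\<in>K. if p' = p then score B x p else 0)"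
      by (intro sum.cong) auto
    then show ?thesis using p by simp
  qed
  note S = score_sum_law[of B "\<lambda>p'. if p' = p then 1 else 0", unfolded e]
  show i: "integrable (law B) (\<lambda>x. score B x p)" "(\<integral>x. score B x p \<partial>law B) = 0" using S by auto
  have "(\<Sum>p'\<in>K. (if p' = p then 1 else 0 :: real)\<^sup>2) = (\<Sum>p'\<in>K. if p' = p then 1 else 0)"
    by (intro sum.cong) auto
  also have "\<dots> = 1" using p by simp
  finally have s2: "(\<integral>x. (score B x p)\<^sup>2 \<partial>law B) = 1" using S(4) by simp
  have "(\<integral>x. \<bar>score B x p\<bar> \<partial>law B) \<le> (\<integral>x. (score B x p)\<^sup>2 / 2 + 1 / 2 \<partial>law B)"
  proof (intro integral_mono)
    show "integrable (law B) (\<lambda>x. (score B x p)\<^sup>2 / 2 + 1 / 2)" using S(3) by simp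
    show "\<bar>score B x p\<bar> \<le> (score B x p)\<^sup>2 / 2 + 1 / 2" for x
      using zero_le_power2[of "\<bar>score B x p\<bar> - 1"] by (simp add: power2_diff)
  qed (use i in simp)
  also have "\<dots> = 1" using S(3) s2 by (simp add: prob_space)
  finally show "(\<integral>x. \<bar>score B x p\<bar> \<partial>law B) \<le> 1" .
qed

section \<open>The attack statistic and its mean under privacy\<close>

definition clip :: "(nat \<Rightarrow> nat \<Rightarrow> real) \<Rightarrow> nat \<times> nat \<Rightarrow> real" where
  "clip A p = max (- \<gamma>) (min \<gamma> (A (fst p) (snd p)))"

definition loss :: "(nat \<times> nat \<Rightarrow> real) \<Rightarrow> (nat \<Rightarrow> nat \<Rightarrow> real) \<Rightarrow> real" where
  "loss B A = (\<Sum>p\<in>K. (clip A p - \<gamma> * B p)\<^sup>2)"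

text \<open>Score of one sample correlated with the weighted error. Subtracting \<gamma> * B p does
  not change the mean over the data, since the score is centred, but it lets the loss bound the
  second moment of the statistic at a fresh sample.\<close>

definition attack :: "(nat \<times> nat \<Rightarrow> real) \<Rightarrow> (nat \<Rightarrow> real) \<Rightarrow> (nat \<Rightarrow> nat \<Rightarrow> real) \<Rightarrow> real" where
  "attack B x A = (\<Sum>p\<in>K. (1 - (B p)\<^sup>2) * score B x p * (clip A p - \<gamma> * B p))"

lemma clip_measurable: "p \<in> K \<Longrightarrow> (\<lambda>A. clip A p) \<in> borel_measurable (mat_space d)"
  unfolding clip_def using m_bounds
  by (intro borel_measurable_max borel_measurable_min borel_measurable_const measurable_mat_component) (auto simp: K_def)

lemma abs_clip: "\<bar>clip A p\<bar> \<le> \<gamma>"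
  using \<gamma>_pos by (auto simp: clip_def)

lemma clip_diff:
  assumes "\<bar>b\<bar> \<le> 1" shows "\<bar>clip A p - \<gamma> * b\<bar> \<le> 2 * \<gamma>"
proof -
  have "\<bar>\<gamma> * b\<bar> \<le> \<gamma>" using assms \<gamma>_pos by (simp add: abs_mult mult_left_le)
  then show ?thesis using abs_clip[of A p] by linarith
qed

lemma loss_measurable: "loss B \<in> borel_measurable (mat_space d)"
  unfolding loss_def using clip_measurable by (intro borel_measurable_sum borel_measurable_power borel_measurable_diff) auto

lemma loss_bounds:
  assumes "\<And>p. p \<in> K \<Longrightarrow> \<bar>B p\<bar> \<le> 1"
  shows "0 \<le> loss B A" "loss B A \<le> 4 * \<gamma>\<^sup>2 * card K"
proof -
  show "0 \<le> loss B A" unfolding loss_def by (intro sum_nonneg) auto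
  have "(clip A p - \<gamma> * B p)\<^sup>2 \<le> 4 * \<gamma>\<^sup>2" if "p \<in> K" for p
  proof -
    have "(clip A p - \<gamma> * B p)\<^sup>2 \<le> (2 * \<gamma>)\<^sup>2"
      using clip_diff[OF assms[OF that], of A p] \<gamma>_pos by (intro abs_le_square_iff[THEN iffD1]) simp
    then show ?thesis by (simp add: power_mult_distrib)
  qed
  then have "loss B A \<le> (\<Sum>p\<in>K. 4 * \<gamma>\<^sup>2)" unfolding loss_def by (intro sum_mono)
  then show "loss B A \<le> 4 * \<gamma>\<^sup>2 * card K" by (simp add: mult.commute)
qed

text \<open>For a fixed output and a fresh sample, \<open>score_sum_law\<close> bounds the second
  moment of the statistic by the loss. AM-GM with a free \<beta>, in place of a square root, keeps
  the bound affine in the loss, so that it can later be averaged over runs and over B. The envelope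
  is 2 \<gamma> times the sum of the absolute scores, with mean at most 2 \<gamma> * card K.\<close>

lemma attack_dp:
  assumes M: "mechanism d n M" and dp: "diff_private d n \<epsilon> \<delta>' M" and \<epsilon>: "0 \<le> \<epsilon>"
    and \<delta>: "\<delta>' \<le> \<delta>" "0 \<le> \<delta>" and k: "k < n" and \<beta>: "\<beta> > 0"
    and B: "\<And>p. p \<in> K \<Longrightarrow> \<bar>B p\<bar> \<le> 1"
  shows "(\<integral>X. (\<integral>A. attack B (X k) A \<partial>M X) \<partial>sample n B)
    \<le> (exp \<epsilon> - 1) * (\<integral>X. (\<integral>A. loss B A / (2 * \<beta>) + \<beta> / 2 \<partial>M X) \<partial>sample n B) + 4 * \<delta> * \<gamma> * card K"
proof -
  interpret L: prob_space "law B" by (rule prob_space_law)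
  define T where "T x = 2 * \<gamma> * (\<Sum>p\<in>K. \<bar>score B x p\<bar>)" for x
  have Ti: "integrable (law B) T"
    unfolding T_def using score_abs_law(1) by (intro integrable_mult_right Bochner_Integration.integrable_sum integrable_abs) auto
  have w: "\<bar>1 - (B p)\<^sup>2\<bar> \<le> 1" if "p \<in> K" for p
  proof -
    have "(B p)\<^sup>2 \<le> 1" using B[OF that] by (simp add: abs_square_le_1)
    then show ?thesis by simp
  qed
  have "(\<integral>X. (\<integral>A. attack B (X k) A \<partial>M X) \<partial>sample n B)
    \<le> (exp \<epsilon> - 1) * (\<integral>X. (\<integral>A. loss B A / (2 * \<beta>) + \<beta> / 2 \<partial>M X) \<partial>sample n B) + 2 * \<delta> * (\<integral>x. T x \<partial>law B)"
  proof (rule dp_score_bound[OF M dp \<epsilon> \<delta> k prob_space_law sets_law])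
    show "integrable (law B) T" by (rule Ti)
    show "(\<lambda>(x, A). attack B x A) \<in> borel_measurable (vec_space d \<Otimes>\<^sub>M mat_space d)"
      unfolding attack_def case_prod_beta
    proof (intro borel_measurable_sum borel_measurable_times borel_measurable_diff borel_measurable_const)
      fix p assume p: "p \<in> K"
      show "(\<lambda>q. score B (fst q) p) \<in> borel_measurable (vec_space d \<Otimes>\<^sub>M mat_space d)"
        by (rule measurable_compose[OF measurable_fst score_measurable[OF p]])
      show "(\<lambda>q. clip (snd q) p) \<in> borel_measurable (vec_space d \<Otimes>\<^sub>M mat_space d)"
        by (rule measurable_compose[OF measurable_snd clip_measurable[OF p]])
    qed
    show "\<bar>attack B x A\<bar> \<le> T x" for x A
    proof -
      have "\<bar>attack B x A\<bar> \<le> (\<Sum>p\<in>K. \<bar>(1 - (B p)\<^sup>2) * score B x p * (clip A p - \<gamma> * B p)\<bar>)"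
        unfolding attack_def by (rule sum_abs)
      also have "\<dots> \<le> (\<Sum>p\<in>K. 1 * \<bar>score B x p\<bar> * (2 * \<gamma>))"
        unfolding abs_mult using w clip_diff[OF B] by (intro sum_mono mult_mono) auto
      finally show ?thesis by (simp add: T_def sum_distrib_left mult_ac)
    qed
    have att: "attack B x A = (\<Sum>p\<in>K. ((1 - (B p)\<^sup>2) * (clip A p - \<gamma> * B p)) * score B x p)" for x A
      unfolding attack_def by (intro sum.cong) (auto simp: mult_ac)
    show "(\<integral>x. attack B x A \<partial>law B) = 0" for A
      unfolding att by (rule score_sum_law)
    show "(\<integral>x. \<bar>attack B x A\<bar> \<partial>law B) \<le> loss B A / (2 * \<beta>) + \<beta> / 2" for A
    proof -
      note S = score_sum_law[of B "\<lambda>p. (1 - (B p)\<^sup>2) * (clip A p - \<gamma> * B p)", folded att]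
      have "(\<integral>x. \<bar>attack B x A\<bar> \<partial>law B) \<le> (\<integral>x. (attack B x A)\<^sup>2 / (2 * \<beta>) + \<beta> / 2 \<partial>law B)"
      proof (intro integral_mono)
        show "\<bar>attack B x A\<bar> \<le> (attack B x A)\<^sup>2 / (2 * \<beta>) + \<beta> / 2" for x
          using zero_le_power2[of "\<bar>attack B x A\<bar> - \<beta>"] \<beta> by (simp add: power2_eq_square field_simps)
      qed (use S in simp_all)
      also have "\<dots> = (\<Sum>p\<in>K. ((1 - (B p)\<^sup>2) * (clip A p - \<gamma> * B p))\<^sup>2) / (2 * \<beta>) + \<beta> / 2"
        using S by (simp add: L.prob_space)
      also have "(\<Sum>p\<in>K. ((1 - (B p)\<^sup>2) * (clip A p - \<gamma> * B p))\<^sup>2) \<le> loss B A"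
        unfolding loss_def
      proof (rule sum_mono)
        fix p assume "p \<in> K"
        then show "((1 - (B p)\<^sup>2) * (clip A p - \<gamma> * B p))\<^sup>2 \<le> (clip A p - \<gamma> * B p)\<^sup>2"
          using w[of p] by (simp add: power_mult_distrib mult_left_le_one_le abs_square_le_1)
      qed
      finally show ?thesis using \<beta> by (simp add: divide_right_mono)
    qed
    show "(\<lambda>A. loss B A / (2 * \<beta>) + \<beta> / 2) \<in> borel_measurable (mat_space d)" using loss_measurable by measurable
    show "\<bar>loss B A / (2 * \<beta>) + \<beta> / 2\<bar> \<le> 4 * \<gamma>\<^sup>2 * card K / (2 * \<beta>) + \<beta> / 2" for A
    proof -
      have "0 \<le> loss B A / (2 * \<beta>)" using loss_bounds(1)[OF B] \<beta> by (intro divide_nonneg_nonneg) auto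
      moreover have "loss B A / (2 * \<beta>) \<le> 4 * \<gamma>\<^sup>2 * card K / (2 * \<beta>)"
        using \<beta> by (intro divide_right_mono loss_bounds(2)[OF B]) auto
      ultimately show ?thesis using \<beta> by linarith
    qed
  qed
  moreover have "2 * \<delta> * (\<integral>x. T x \<partial>law B) \<le> 2 * \<delta> * (2 * \<gamma> * card K)"
  proof (rule mult_left_mono)
    have "(\<integral>x. T x \<partial>law B) = 2 * \<gamma> * (\<Sum>p\<in>K. \<integral>x. \<bar>score B x p\<bar> \<partial>law B)"
      unfolding T_def using score_abs_law(1) by (simp add: Bochner_Integration.integral_sum)
    also have "\<dots> \<le> 2 * \<gamma> * (\<Sum>p\<in>K. 1)"
      using score_abs_law(3) \<gamma>_pos by (intro mult_left_mono sum_mono) auto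
    finally show "(\<integral>x. T x \<partial>law B) \<le> 2 * \<gamma> * card K" by simp
  qed (use \<delta> in simp)
  ultimately show ?thesis by simp
qed

end

context regression_prior
begin

section \<open>Joint law of the regression matrix and the data\<close>

definition base :: "nat \<Rightarrow> (nat \<Rightarrow> nat \<Rightarrow> real) measure" where
  "base n = PiM {..<n} (\<lambda>_. std_normal_vec d)"

definition data_lik :: "nat \<Rightarrow> (nat \<times> nat \<Rightarrow> real) \<Rightarrow> (nat \<Rightarrow> nat \<Rightarrow> real) \<Rightarrow> real" where
  "data_lik n B X = (\<Prod>k<n. lik B (X k))"

text \<open>A density against a product measure: integrating over B at fixed X, as the integration
  by parts does, is then an instance of Fubini.\<close>

definition joint :: "nat \<Rightarrow> ((nat \<times> nat \<Rightarrow> real) \<times> (nat \<Rightarrow> nat \<Rightarrow> real)) measure" where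
  "joint n = density (prior \<Otimes>\<^sub>M base n) (\<lambda>(B, X). ennreal (data_lik n B X))"

lemma lik_pos: "lik B z > 0" by (simp add: lik_def)

lemma data_lik_pos: "data_lik n B X > 0"
  unfolding data_lik_def by (intro prod_pos) (simp add: lik_pos)

lemma sets_base: "sets (base n) = sets (data_space d n)"
  unfolding base_def data_space_def by (intro sets_PiM_cong refl sets_std_normal_vec)

lemma prob_space_base: "prob_space (base n)"
  unfolding base_def by (intro prob_space_PiM prob_space_std_normal_vec)

lemma lik_measurable: "(\<lambda>z. lik B z) \<in> borel_measurable (vec_space d)"
proof -
  have "(\<lambda>z. shift B z i * z i - (shift B z i)\<^sup>2 / 2) \<in> borel_measurable (vec_space d)" if "i \<in> {m..<d}" for i
  proof -
    note [measurable] = shift_measurable[of B i] measurable_vec_component[of i d]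
    have [measurable]: "(\<lambda>z. z i) \<in> borel_measurable (vec_space d)" using that by (intro measurable_vec_component) simp
    show ?thesis by measurable
  qed
  then show ?thesis
    unfolding lik_def by (intro measurable_compose[OF _ borel_measurable_exp] borel_measurable_sum)
qed

lemma PiM_law_density: "sample n B = density (base n) (\<lambda>X. ennreal (data_lik n B X))"
proof -
  have m: "(\<lambda>z. ennreal (lik B z)) \<in> borel_measurable (std_normal_vec d)"
    using lik_measurable[of B] by (intro measurable_compose[OF _ measurable_ennreal]) (simp add: measurable_cong_sets[OF sets_std_normal_vec refl])
  \<comment> \<open>Read off from the total mass of \<open>law B\<close>, so that no Gaussian
    integral has to be computed.\<close>
  have one: "(\<integral>\<^sup>+z. ennreal (lik B z) \<partial>std_normal_vec d) = 1"
  proof -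
    interpret prob_space "law B" by (rule prob_space_law)
    have "emeasure (law B) (space (law B)) = (\<integral>\<^sup>+z. ennreal (lik B z) * indicator (space (std_normal_vec d)) z \<partial>std_normal_vec d)"
      unfolding law_def linear_law_density space_density by (rule emeasure_density[OF m sets.top])
    also have "\<dots> = (\<integral>\<^sup>+z. ennreal (lik B z) \<partial>std_normal_vec d)"
      by (intro nn_integral_cong) simp
    finally show ?thesis using emeasure_space_1 by simp
  qed
  have "sample n B = density (PiM {..<n} (\<lambda>_. std_normal_vec d)) (\<lambda>X. \<Prod>k<n. ennreal (lik B (X k)))"
    unfolding law_def linear_law_density using m one prob_space_std_normal_vec by (intro PiM_density) auto
  then show ?thesis by (simp add: base_def data_lik_def prod_ennreal lik_pos less_imp_le)
qed

lemma base_component: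
  assumes "k < n" "i < d" shows "(\<lambda>X. X k i) \<in> borel_measurable (base n)"
proof -
  have "(\<lambda>X. X k) \<in> measurable (base n) (std_normal_vec d)"
    unfolding base_def using assms by (intro measurable_component_singleton) auto
  then have "(\<lambda>X. X k) \<in> measurable (base n) (vec_space d)"
    by (simp only: measurable_cong_sets[OF refl sets_std_normal_vec])
  then show ?thesis by (rule measurable_compose) (rule measurable_vec_component[OF assms(2)])
qed

lemma pair_X_measurable:
  assumes "k < n" "i < d" shows "(\<lambda>q. snd q k i) \<in> borel_measurable (prior \<Otimes>\<^sub>M base n)"
  by (rule measurable_compose[OF measurable_snd base_component[OF assms]])

lemma pair_B_measurable:
  assumes "p \<in> K" shows "(\<lambda>q. fst q p) \<in> borel_measurable (prior \<Otimes>\<^sub>M base n)"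
  by (rule measurable_compose[OF measurable_fst prior_component_measurable[OF assms]])

lemma pair_shift_measurable:
  assumes "k < n" "i \<in> {m..<d}"
  shows "(\<lambda>q. shift (fst q) (snd q k) i) \<in> borel_measurable (prior \<Otimes>\<^sub>M base n)"
  unfolding shift_def using assms m_bounds
  by (intro borel_measurable_times borel_measurable_const borel_measurable_sum pair_B_measurable pair_X_measurable) (auto simp: K_def)

lemma pair_score_measurable:
  assumes "k < n" "p \<in> K"
  shows "(\<lambda>q. score (fst q) (snd q k) p) \<in> borel_measurable (prior \<Otimes>\<^sub>M base n)"
  unfolding score_def using assms m_bounds
  by (intro borel_measurable_times borel_measurable_diff pair_X_measurable pair_shift_measurable) (auto simp: K_def)

lemma pair_lik_measurable: "(\<lambda>q. data_lik n (fst q) (snd q)) \<in> borel_measurable (prior \<Otimes>\<^sub>M base n)"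
proof -
  have "(\<lambda>q. lik (fst q) (snd q k)) \<in> borel_measurable (prior \<Otimes>\<^sub>M base n)" if "k < n" for k
  proof -
    have "(\<lambda>q. shift (fst q) (snd q k) i * snd q k i - (shift (fst q) (snd q k) i)\<^sup>2 / 2) \<in> borel_measurable (prior \<Otimes>\<^sub>M base n)" if "i \<in> {m..<d}" for i
      using \<open>k < n\<close> that
      by (intro borel_measurable_diff borel_measurable_times borel_measurable_divide borel_measurable_power borel_measurable_const pair_X_measurable pair_shift_measurable) auto
    then show ?thesis
      unfolding lik_def by (intro measurable_compose[OF _ borel_measurable_exp] borel_measurable_sum)
  qed
  then show ?thesis unfolding data_lik_def by (intro borel_measurable_prod) auto
qed

lemma pair_sigma_finite_joint: "pair_sigma_finite prior (base n)"
  using prob_space_imp_sigma_finite[OF prob_space_prior] prob_space_imp_sigma_finite[OF prob_space_base]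
  by (rule pair_sigma_finite.intro)

lemma sets_joint: "sets (joint n) = sets (prior \<Otimes>\<^sub>M base n)" by (simp add: joint_def)

lemma joint_measurable_iff: "f \<in> borel_measurable (joint n) \<longleftrightarrow> f \<in> borel_measurable (prior \<Otimes>\<^sub>M base n)"
  by (simp add: measurable_cong_sets[OF sets_joint refl])

text \<open>At fixed B the likelihood turns the base measure into n samples of \<open>law B\<close>,
  so \<open>joint\<close> is the prior followed by the sampling.\<close>

lemma nn_integral_joint:
  assumes f: "f \<in> borel_measurable (prior \<Otimes>\<^sub>M base n)"
  shows "(\<integral>\<^sup>+q. f q \<partial>joint n) = (\<integral>\<^sup>+B. (\<integral>\<^sup>+X. f (B, X) \<partial>sample n B) \<partial>prior)"
proof -
  interpret pair_sigma_finite prior "base n" by (rule pair_sigma_finite_joint)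
  have l: "(\<lambda>q. ennreal (data_lik n (fst q) (snd q))) \<in> borel_measurable (prior \<Otimes>\<^sub>M base n)"
    using pair_lik_measurable by (rule measurable_compose[OF _ measurable_ennreal])
  have "(\<integral>\<^sup>+q. f q \<partial>joint n) = (\<integral>\<^sup>+q. ennreal (data_lik n (fst q) (snd q)) * f q \<partial>(prior \<Otimes>\<^sub>M base n))"
    unfolding joint_def case_prod_beta by (rule nn_integral_density[OF l f])
  also have "\<dots> = (\<integral>\<^sup>+B. (\<integral>\<^sup>+X. ennreal (data_lik n B X) * f (B, X) \<partial>base n) \<partial>prior)"
    using M2.nn_integral_fst[OF borel_measurable_times_ennreal[OF l f]] by simp
  also have "\<dots> = (\<integral>\<^sup>+B. (\<integral>\<^sup>+X. f (B, X) \<partial>sample n B) \<partial>prior)"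
  proof (rule nn_integral_cong)
    fix B assume B: "B \<in> space prior"
    have l': "(\<lambda>X. ennreal (data_lik n B X)) \<in> borel_measurable (base n)"
      using measurable_compose[OF measurable_Pair1'[OF B] l] by simp
    have f': "(\<lambda>X. f (B, X)) \<in> borel_measurable (base n)"
      using measurable_compose[OF measurable_Pair1'[OF B] f] by simp
    show "(\<integral>\<^sup>+X. ennreal (data_lik n B X) * f (B, X) \<partial>base n) = (\<integral>\<^sup>+X. f (B, X) \<partial>sample n B)"
      unfolding PiM_law_density by (rule nn_integral_density[OF l' f', symmetric])
  qed
  finally show ?thesis .
qed

lemma integral_joint:
  fixes f :: "_ \<Rightarrow> real"
  assumes f: "integrable (joint n) f"
  shows "integrable prior (\<lambda>B. \<integral>X. f (B, X) \<partial>sample n B)"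
    and "(\<integral>q. f q \<partial>joint n) = (\<integral>B. (\<integral>X. f (B, X) \<partial>sample n B) \<partial>prior)"
proof -
  interpret pair_sigma_finite prior "base n" by (rule pair_sigma_finite_joint)
  have fm: "f \<in> borel_measurable (prior \<Otimes>\<^sub>M base n)"
    using borel_measurable_integrable[OF f] by (simp only: joint_measurable_iff)
  have nn: "AE q in prior \<Otimes>\<^sub>M base n. 0 \<le> data_lik n (fst q) (snd q)"
    using data_lik_pos by (intro AE_I2) (simp add: less_imp_le)
  have i: "integrable (prior \<Otimes>\<^sub>M base n) (\<lambda>q. data_lik n (fst q) (snd q) *\<^sub>R f q)"
    using f unfolding joint_def case_prod_beta integrable_density[OF fm pair_lik_measurable nn] .
  have e: "(\<integral>X. data_lik n B X *\<^sub>R f (B, X) \<partial>base n) = (\<integral>X. f (B, X) \<partial>sample n B)" if B: "B \<in> space prior" for B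
  proof -
    have l': "(\<lambda>X. data_lik n B X) \<in> borel_measurable (base n)"
      using measurable_compose[OF measurable_Pair1'[OF B] pair_lik_measurable] by simp
    have f': "(\<lambda>X. f (B, X)) \<in> borel_measurable (base n)"
      using measurable_compose[OF measurable_Pair1'[OF B] fm] by simp
    show ?thesis
      unfolding PiM_law_density using data_lik_pos
      by (intro integral_density[OF f' l', symmetric] AE_I2) (simp add: less_imp_le)
  qed
  have "integrable prior (\<lambda>B. \<integral>X. data_lik n B X *\<^sub>R f (B, X) \<partial>base n)"
    using integrable_fst'[OF i] by simp
  then show "integrable prior (\<lambda>B. \<integral>X. f (B, X) \<partial>sample n B)"
    by (rule Bochner_Integration.integrable_cong[THEN iffD1, OF refl, rotated]) (erule e)
  have "(\<integral>q. f q \<partial>joint n) = (\<integral>q. data_lik n (fst q) (snd q) *\<^sub>R f q \<partial>(prior \<Otimes>\<^sub>M base n))"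
    unfolding joint_def case_prod_beta by (rule integral_density[OF fm pair_lik_measurable nn])
  also have "\<dots> = (\<integral>B. (\<integral>X. data_lik n B X *\<^sub>R f (B, X) \<partial>base n) \<partial>prior)"
    using integral_fst'[OF i] by simp
  also have "\<dots> = (\<integral>B. (\<integral>X. f (B, X) \<partial>sample n B) \<partial>prior)"
    by (intro Bochner_Integration.integral_cong refl e)
  finally show "(\<integral>q. f q \<partial>joint n) = (\<integral>B. (\<integral>X. f (B, X) \<partial>sample n B) \<partial>prior)" .
qed

lemma prob_space_PiM_law: "prob_space (sample n B)"
  by (intro prob_space_PiM prob_space_law)

lemma prob_space_joint: "prob_space (joint n)"
proof (rule prob_spaceI)
  interpret P: prob_space prior by (rule prob_space_prior)
  interpret L: prob_space "sample n B" for B by (rule prob_space_PiM_law)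
  have "emeasure (joint n) (space (joint n)) = (\<integral>\<^sup>+q. 1 \<partial>joint n)" by simp
  also have "\<dots> = (\<integral>\<^sup>+B. (\<integral>\<^sup>+X. 1 \<partial>sample n B) \<partial>prior)" by (rule nn_integral_joint) simp
  also have "\<dots> = 1" by (simp add: L.emeasure_space_1 P.emeasure_space_1)
  finally show "emeasure (joint n) (space (joint n)) = 1" .
qed

lemma AE_prior: "AE B in prior. \<forall>p\<in>K. \<bar>B p\<bar> \<le> 1"
proof -
  have "AE B in prior. \<bar>B p\<bar> \<le> 1" if "p \<in> K" for p
    unfolding prior_def by (rule AE_PiM_component[OF prob_space_sym_unif that AE_sym_unif])
  then show ?thesis by (simp add: AE_finite_all)
qed

lemma AE_joint: "AE q in joint n. \<forall>p\<in>K. \<bar>fst q p\<bar> \<le> 1"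
proof -
  interpret pair_sigma_finite prior "base n" by (rule pair_sigma_finite_joint)
  interpret base: prob_space "base n" by (rule prob_space_base)
  have "AE q in prior \<Otimes>\<^sub>M base n. \<forall>p\<in>K. \<bar>fst q p\<bar> \<le> 1"
    by (rule AE_distrD[OF measurable_fst]) (simp only: base.distr_pair_fst AE_prior)
  then show ?thesis
    unfolding joint_def case_prod_beta
    by (subst AE_density) (auto intro!: measurable_compose[OF pair_lik_measurable measurable_ennreal])
qed

end

context regression_prior
begin

section \<open>Integration by parts in the prior\<close>

definition score_sum :: "nat \<Rightarrow> (nat \<times> nat \<Rightarrow> real) \<Rightarrow> (nat \<Rightarrow> nat \<Rightarrow> real) \<Rightarrow> nat \<times> nat \<Rightarrow> real" where
  "score_sum n B X p = (\<Sum>k<n. score B (X k) p)"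

lemma distr_PiM_law_component:
  assumes "k < n" shows "distr (sample n B) (law B) (\<lambda>X. X k) = law B"
  using assms prob_space_law by (intro distr_PiM_component) auto

lemma PiM_law_component_measurable:
  assumes "k < n" shows "(\<lambda>X. X k) \<in> measurable (sample n B) (law B)"
  using assms by (intro measurable_component_singleton) simp

lemma score_PiM_law:
  assumes k: "k < n" and p: "p \<in> K"
  shows "integrable (sample n B) (\<lambda>X. score B (X k) p)"
    and "(\<integral>X. score B (X k) p \<partial>sample n B) = 0"
    and "(\<integral>\<^sup>+X. ennreal \<bar>score B (X k) p\<bar> \<partial>sample n B) \<le> 1"
proof -
  have m: "(\<lambda>x. score B x p) \<in> borel_measurable (law B)"
    using score_measurable[OF p] by (simp add: measurable_cong_sets[OF sets_law refl])
  note d = distr_PiM_law_component[OF k, of B] and c = PiM_law_component_measurable[OF k, of B]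
  show "integrable (sample n B) (\<lambda>X. score B (X k) p)"
    using integrable_distr_eq[OF c m] score_abs_law(1)[OF p, of B] unfolding d by simp
  show "(\<integral>X. score B (X k) p \<partial>sample n B) = 0"
    using integral_distr[OF c m] score_abs_law(2)[OF p, of B] unfolding d by simp
  have m': "(\<lambda>x. ennreal \<bar>score B x p\<bar>) \<in> borel_measurable (law B)"
    using m by measurable
  have "(\<integral>\<^sup>+X. ennreal \<bar>score B (X k) p\<bar> \<partial>sample n B) = (\<integral>\<^sup>+x. ennreal \<bar>score B x p\<bar> \<partial>law B)"
    using nn_integral_distr[OF c, of "\<lambda>x. ennreal \<bar>score B x p\<bar>"] m' unfolding d by simp
  also have "\<dots> = ennreal (\<integral>x. \<bar>score B x p\<bar> \<partial>law B)"
    using score_abs_law(1)[OF p, of B] by (intro nn_integral_eq_integral) auto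
  also have "\<dots> \<le> 1" using score_abs_law(3)[OF p, of B] by simp
  finally show "(\<integral>\<^sup>+X. ennreal \<bar>score B (X k) p\<bar> \<partial>sample n B) \<le> 1" .
qed

lemma score_joint_integrable:
  assumes k: "k < n" and p: "p \<in> K"
  shows "integrable (joint n) (\<lambda>q. score (fst q) (snd q k) p)"
proof (rule integrableI_bounded)
  interpret P: prob_space prior by (rule prob_space_prior)
  show "(\<lambda>q. score (fst q) (snd q k) p) \<in> borel_measurable (joint n)"
    unfolding joint_measurable_iff by (rule pair_score_measurable[OF k p])
  have "(\<integral>\<^sup>+q. ennreal (norm (score (fst q) (snd q k) p)) \<partial>joint n)
      = (\<integral>\<^sup>+B. (\<integral>\<^sup>+X. ennreal \<bar>score B (X k) p\<bar> \<partial>sample n B) \<partial>prior)"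
    using pair_score_measurable[OF k p] by (subst nn_integral_joint) auto
  also have "\<dots> \<le> (\<integral>\<^sup>+B. 1 \<partial>prior)" by (intro nn_integral_mono score_PiM_law(3)[OF k p])
  also have "\<dots> < \<infinity>" by (simp add: P.emeasure_space_1)
  finally show "(\<integral>\<^sup>+q. ennreal (norm (score (fst q) (snd q k) p)) \<partial>joint n) < \<infinity>" .
qed

lemma score_sum_joint_integrable:
  assumes p: "p \<in> K"
  shows "integrable (joint n) (\<lambda>q. score_sum n (fst q) (snd q) p)"
  unfolding score_sum_def using score_joint_integrable[OF _ p] by (intro Bochner_Integration.integrable_sum) auto

lemma score_sum_bounded_integrable:
  fixes g :: "_ \<Rightarrow> real"
  assumes p: "p \<in> K" and g: "g \<in> borel_measurable (prior \<Otimes>\<^sub>M base n)" and gC: "AE q in joint n. \<bar>g q\<bar> \<le> C"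
  shows "integrable (joint n) (\<lambda>q. score_sum n (fst q) (snd q) p * g q)"
proof (rule Bochner_Integration.integrable_bound[OF integrable_mult_left[OF score_sum_joint_integrable[OF p]]])
  show "(\<lambda>q. score_sum n (fst q) (snd q) p * g q) \<in> borel_measurable (joint n)"
    using borel_measurable_integrable[OF score_sum_joint_integrable[OF p]] g[folded joint_measurable_iff]
    by (rule borel_measurable_times)
  show "AE q in joint n. norm (score_sum n (fst q) (snd q) p * g q) \<le> norm (score_sum n (fst q) (snd q) p * \<bar>C\<bar>)"
    using gC by eventually_elim (auto simp: abs_mult intro!: mult_left_mono)
qed

lemma bounded_joint_integrable:
  fixes g :: "_ \<Rightarrow> real"
  assumes g: "g \<in> borel_measurable (prior \<Otimes>\<^sub>M base n)" and gC: "AE q in joint n. \<bar>g q\<bar> \<le> C"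
  shows "integrable (joint n) g"
proof -
  interpret prob_space "joint n" by (rule prob_space_joint)
  show ?thesis using g[folded joint_measurable_iff] gC by (intro integrable_const_bound[where B = C]) auto
qed

lemma shift_upd:
  assumes p: "p \<in> K"
  shows "shift (Y(p := b)) z i = shift (Y(p := 0)) z i + b * (if i = fst p then \<gamma> * z (snd p) else 0)"
proof -
  have sp: "snd p < m" using p by (auto simp: K_def)
  have "(\<Sum>j<m. (Y(p := b)) (i, j) * z j) = (\<Sum>j<m. (Y(p := 0)) (i, j) * z j + (if j = snd p then (if i = fst p then b * z (snd p) else 0) else 0))"
    by (intro sum.cong refl) (auto simp: prod_eq_iff)
  also have "\<dots> = (\<Sum>j<m. (Y(p := 0)) (i, j) * z j) + (if i = fst p then b * z (snd p) else 0)"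
    using sp by (simp add: sum.distrib)
  finally show ?thesis unfolding shift_def by (auto simp: algebra_simps)
qed

lemma data_lik_exp: "data_lik n B X = exp (\<Sum>k<n. \<Sum>i\<in>{m..<d}. shift B (X k) i * X k i - (shift B (X k) i)\<^sup>2 / 2)"
  by (simp add: data_lik_def lik_def exp_sum)

text \<open>Only the row \<open>fst p\<close> of the shift moves with the entry at p, and it does so
  affinely, so the exponent is quadratic in b.\<close>

lemma data_lik_deriv:
  assumes p: "p \<in> K"
  shows "DERIV (\<lambda>b. data_lik n (Y(p := b)) X) b :> data_lik n (Y(p := b)) X * (\<gamma> * score_sum n (Y(p := b)) X p)"
proof -
  let ?D = "\<lambda>k i. if i = fst p then \<gamma> * X k (snd p) else 0"
  have s: "DERIV (\<lambda>b. shift (Y(p := b)) (X k) i) b :> ?D k i" for k i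
  proof -
    define s0 where "s0 = shift (Y(p := 0)) (X k) i"
    have "(\<lambda>b. shift (Y(p := b)) (X k) i) = (\<lambda>b. s0 + b * ?D k i)"
      unfolding s0_def by (rule ext) (rule shift_upd[OF p])
    then show ?thesis by (simp only:) (auto intro!: derivative_eq_intros)
  qed
  have t: "DERIV (\<lambda>b. shift (Y(p := b)) (X k) i * X k i - (shift (Y(p := b)) (X k) i)\<^sup>2 / 2) b :>
      ?D k i * (X k i - shift (Y(p := b)) (X k) i)" for k i
    by (rule DERIV_cong[OF DERIV_diff[OF DERIV_cmult_right[OF s] DERIV_cdivide[OF DERIV_power[OF s]]]])
      (simp add: algebra_simps)
  have "DERIV (\<lambda>b. data_lik n (Y(p := b)) X) b :> data_lik n (Y(p := b)) X * (\<Sum>k<n. \<Sum>i\<in>{m..<d}. ?D k i * (X k i - shift (Y(p := b)) (X k) i))"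
    unfolding data_lik_exp by (intro DERIV_fun_exp DERIV_sum t)
  also have "(\<Sum>k<n. \<Sum>i\<in>{m..<d}. ?D k i * (X k i - shift (Y(p := b)) (X k) i)) = \<gamma> * score_sum n (Y(p := b)) X p"
    unfolding score_sum_def sum_distrib_left
  proof (intro sum.cong refl)
    fix k
    have "(\<Sum>i\<in>{m..<d}. ?D k i * (X k i - shift (Y(p := b)) (X k) i)) = (\<Sum>i\<in>{m..<d}. if i = fst p then \<gamma> * score (Y(p := b)) (X k) p else 0)"
      by (intro sum.cong refl) (auto simp: score_def)
    also have "\<dots> = \<gamma> * score (Y(p := b)) (X k) p" using p by (auto simp: K_def)
    finally show "(\<Sum>i\<in>{m..<d}. ?D k i * (X k i - shift (Y(p := b)) (X k) i)) = \<gamma> * score (Y(p := b)) (X k) p" .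
  qed
  finally show ?thesis .
qed

text \<open>At fixed data the integrand is, in the entry b at p, the derivative of (1 - b^2) *
  likelihood * c, and 1 - b^2 vanishes at both ends. This is where c must not depend on B.\<close>

lemma stein_inner:
  assumes p: "p \<in> K" and i: "integrable prior (\<lambda>B. data_lik n B X * (((1 - (B p)\<^sup>2) * \<gamma> * score_sum n B X p - 2 * B p) * c))"
  shows "(\<integral>B. data_lik n B X * (((1 - (B p)\<^sup>2) * \<gamma> * score_sum n B X p - 2 * B p) * c) \<partial>prior) = 0"
proof -
  let ?f = "\<lambda>B. data_lik n B X * (((1 - (B p)\<^sup>2) * \<gamma> * score_sum n B X p - 2 * B p) * c)"
  define K' where "K' = K - {p}"
  have K: "insert p K' = K" and K': "finite K'" "p \<notin> K'" using p by (auto simp: K'_def)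
  have i': "integrable (PiM (insert p K') (\<lambda>_. sym_unif)) ?f"
    using i unfolding K prior_def .
  have "(\<integral>B. ?f B \<partial>prior) = (\<integral>B. ?f B \<partial>PiM (insert p K') (\<lambda>_. sym_unif))"
    unfolding K prior_def ..
  also have "\<dots> = (\<integral>Y. (\<integral>b. ?f (Y(p := b)) \<partial>sym_unif) \<partial>PiM K' (\<lambda>_. sym_unif))"
    by (rule sym_unif_prod.product_integral_insert[OF K' i'])
  also have "\<dots> = (\<integral>Y. 0 \<partial>PiM K' (\<lambda>_. sym_unif))"
  proof (intro Bochner_Integration.integral_cong refl)
    fix Y :: "nat \<times> nat \<Rightarrow> real"
    let ?L = "\<lambda>b. data_lik n (Y(p := b)) X"
    have cont: "continuous_on UNIV (\<lambda>b. shift (Y(p := b)) (X k) i)" for k i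
    proof -
      define s0 where "s0 = shift (Y(p := 0)) (X k) i"
      have "(\<lambda>b. shift (Y(p := b)) (X k) i) = (\<lambda>b. s0 + b * (if i = fst p then \<gamma> * X k (snd p) else 0))"
        unfolding s0_def by (rule ext) (rule shift_upd[OF p])
      then show ?thesis by (simp only:) (intro continuous_intros)
    qed
    have contL: "continuous_on UNIV ?L"
      unfolding data_lik_exp by (intro continuous_intros cont) simp_all
    have contS: "continuous_on UNIV (\<lambda>b. score_sum n (Y(p := b)) X p)"
      unfolding score_sum_def score_def by (intro continuous_intros cont)
    have "(\<integral>b. ?f (Y(p := b)) \<partial>sym_unif) = (\<integral>b. ?L b * (((1 - b\<^sup>2) * \<gamma> * score_sum n (Y(p := b)) X p - 2 * b) * c) \<partial>sym_unif)"
      by simp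
    also have "\<dots> = ((1 - 1\<^sup>2) * ?L 1 * c - (1 - (-1)\<^sup>2) * ?L (-1) * c) / 2"
    proof (rule integral_sym_unif_FTC)
      show "continuous_on UNIV (\<lambda>b. ?L b * (((1 - b\<^sup>2) * \<gamma> * score_sum n (Y(p := b)) X p - 2 * b) * c))"
        by (intro continuous_intros contL contS)
      show "DERIV (\<lambda>b. (1 - b\<^sup>2) * ?L b * c) b :> ?L b * (((1 - b\<^sup>2) * \<gamma> * score_sum n (Y(p := b)) X p - 2 * b) * c)" for b
      proof -
        have "DERIV (\<lambda>b. 1 - b\<^sup>2) b :> - 2 * b" for b :: real by (auto intro!: derivative_eq_intros)
        from DERIV_cong[OF DERIV_cmult_right[OF DERIV_mult[OF this data_lik_deriv[OF p]]]] show ?thesis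
          by (simp add: algebra_simps)
      qed
    qed
    finally show "(\<integral>b. ?f (Y(p := b)) \<partial>sym_unif) = 0" by simp
  qed
  finally show ?thesis by simp
qed

text \<open>Core of the fingerprinting argument: a bounded function of the data alone has the same
  correlation with the weighted score sum as with 2 B p / \<gamma>. An estimate that follows B p is
  therefore forced to correlate with the scores.\<close>

lemma stein:
  assumes p: "p \<in> K" and c: "c \<in> borel_measurable (base n)" and C: "\<And>X. \<bar>c X\<bar> \<le> C"
  shows "(\<integral>q. (((1 - (fst q p)\<^sup>2) * \<gamma> * score_sum n (fst q) (snd q) p - 2 * fst q p) * c (snd q)) \<partial>joint n) = 0"
proof -
  interpret pair_sigma_finite prior "base n" by (rule pair_sigma_finite_joint)
  have c': "(\<lambda>q. c (snd q)) \<in> borel_measurable (prior \<Otimes>\<^sub>M base n)" by (rule measurable_compose[OF measurable_snd c])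
  note Bm = pair_B_measurable[OF p, of n]
  have C0: "0 \<le> C" using C[of undefined] by linarith
  let ?g = "\<lambda>q. ((1 - (fst q p)\<^sup>2) * \<gamma> * score_sum n (fst q) (snd q) p - 2 * fst q p) * c (snd q)"
  have i: "integrable (joint n) ?g"
  proof -
    have 1: "integrable (joint n) (\<lambda>q. score_sum n (fst q) (snd q) p * ((1 - (fst q p)\<^sup>2) * \<gamma> * c (snd q)))"
    proof (rule score_sum_bounded_integrable[OF p])
      show "(\<lambda>q. (1 - (fst q p)\<^sup>2) * \<gamma> * c (snd q)) \<in> borel_measurable (prior \<Otimes>\<^sub>M base n)"
        using Bm c' by measurable
      show "AE q in joint n. \<bar>(1 - (fst q p)\<^sup>2) * \<gamma> * c (snd q)\<bar> \<le> 1 * \<gamma> * C"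
        using AE_joint
      proof eventually_elim
        fix q :: "(nat \<times> nat \<Rightarrow> real) \<times> (nat \<Rightarrow> nat \<Rightarrow> real)" assume "\<forall>p\<in>K. \<bar>fst q p\<bar> \<le> 1"
        then have "(fst q p)\<^sup>2 \<le> 1" using p by (simp add: abs_square_le_1)
        then have "\<bar>1 - (fst q p)\<^sup>2\<bar> \<le> 1" by simp
        then show "\<bar>(1 - (fst q p)\<^sup>2) * \<gamma> * c (snd q)\<bar> \<le> 1 * \<gamma> * C"
          unfolding abs_mult using C \<gamma>_pos by (intro mult_mono) auto
      qed
    qed
    have 2: "integrable (joint n) (\<lambda>q. 2 * fst q p * c (snd q))"
    proof (rule bounded_joint_integrable)
      show "(\<lambda>q. 2 * fst q p * c (snd q)) \<in> borel_measurable (prior \<Otimes>\<^sub>M base n)" using Bm c' by measurable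
      show "AE q in joint n. \<bar>2 * fst q p * c (snd q)\<bar> \<le> 2 * 1 * C"
        using AE_joint
      proof eventually_elim
        fix q :: "(nat \<times> nat \<Rightarrow> real) \<times> (nat \<Rightarrow> nat \<Rightarrow> real)" assume "\<forall>p\<in>K. \<bar>fst q p\<bar> \<le> 1"
        then show "\<bar>2 * fst q p * c (snd q)\<bar> \<le> 2 * 1 * C"
          unfolding abs_mult using p C C0 by (intro mult_mono) auto
      qed
    qed
    have "?g = (\<lambda>q. score_sum n (fst q) (snd q) p * ((1 - (fst q p)\<^sup>2) * \<gamma> * c (snd q)) - 2 * fst q p * c (snd q))"
      by (auto simp: algebra_simps)
    then show ?thesis using Bochner_Integration.integrable_diff[OF 1 2] by simp
  qed
  have gm: "?g \<in> borel_measurable (prior \<Otimes>\<^sub>M base n)"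
    using borel_measurable_integrable[OF i] by (simp only: joint_measurable_iff)
  have nn: "AE q in prior \<Otimes>\<^sub>M base n. 0 \<le> data_lik n (fst q) (snd q)"
    using data_lik_pos by (intro AE_I2) (simp add: less_imp_le)
  have i': "integrable (prior \<Otimes>\<^sub>M base n) (\<lambda>(B, X). data_lik n B X * (((1 - (B p)\<^sup>2) * \<gamma> * score_sum n B X p - 2 * B p) * c X))"
    using i unfolding joint_def case_prod_beta' integrable_density[OF gm pair_lik_measurable nn] by simp
  have "(\<integral>q. ?g q \<partial>joint n) = (\<integral>q. data_lik n (fst q) (snd q) *\<^sub>R ?g q \<partial>(prior \<Otimes>\<^sub>M base n))"
    unfolding joint_def case_prod_beta' by (rule integral_density[OF gm pair_lik_measurable nn])
  also have "\<dots> = (\<integral>X. (\<integral>B. data_lik n B X * (((1 - (B p)\<^sup>2) * \<gamma> * score_sum n B X p - 2 * B p) * c X) \<partial>prior) \<partial>base n)"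
    using integral_snd[OF i'] by (simp add: case_prod_beta')
  also have "\<dots> = (\<integral>X. 0 \<partial>base n)"
  \<comment> \<open>Fubini yields integrability in B for almost every X, and
    \<open>stein_inner\<close> asks for it.\<close>
  proof (rule integral_cong_AE)
    show "(\<lambda>X. \<integral>B. data_lik n B X * (((1 - (B p)\<^sup>2) * \<gamma> * score_sum n B X p - 2 * B p) * c X) \<partial>prior) \<in> borel_measurable (base n)"
      using borel_measurable_integrable[OF integrable_snd[OF i']] .
    show "AE X in base n. (\<integral>B. data_lik n B X * (((1 - (B p)\<^sup>2) * \<gamma> * score_sum n B X p - 2 * B p) * c X) \<partial>prior) = 0"
      using AE_integrable_snd[OF i'] by eventually_elim (rule stein_inner[OF p])
  qed simp
  finally show ?thesis by simp
qed

end

section \<open>Bounds for the total attack\<close>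

locale regression_mechanism = regression_prior +
  fixes n :: nat and M :: "(nat \<Rightarrow> nat \<Rightarrow> real) \<Rightarrow> (nat \<Rightarrow> nat \<Rightarrow> real) measure"
  assumes mech: "mechanism d n M"
begin

text \<open>The clipped output with the internal randomness integrated out. The default 0 off the
  data space makes \<gamma> a bound for every X, as \<open>stein\<close> demands.\<close>

definition est :: "nat \<times> nat \<Rightarrow> (nat \<Rightarrow> nat \<Rightarrow> real) \<Rightarrow> real" where
  "est p X = (if X \<in> space (base n) then \<integral>A. clip A p \<partial>M X else 0)"

definition risk :: "(nat \<times> nat \<Rightarrow> real) \<Rightarrow> (nat \<Rightarrow> nat \<Rightarrow> real) \<Rightarrow> real" where
  "risk B X = (\<integral>A. loss B A \<partial>M X)"

lemma space_base: "space (base n) = space (data_space d n)"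
  by (rule sets_eq_imp_space_eq[OF sets_base])

lemma M_prob: "X \<in> space (base n) \<Longrightarrow> prob_space (M X)"
  using mech by (simp add: mechanism_def space_base)

lemma M_sets: "X \<in> space (base n) \<Longrightarrow> sets (M X) = sets (mat_space d)"
  using mechanism_sets[OF mech] by (simp add: space_base)

lemma M_kernel: "M \<in> measurable (base n) (subprob_algebra (mat_space d))"
  using mech by (simp add: mechanism_def measurable_cong_sets[OF sets_base refl])

lemma M_kernel_pair: "(\<lambda>q. M (snd q)) \<in> measurable (prior \<Otimes>\<^sub>M base n) (subprob_algebra (mat_space d))"
  by (rule measurable_compose[OF measurable_snd M_kernel])

lemma M_measurable: "X \<in> space (base n) \<Longrightarrow> f \<in> borel_measurable (mat_space d) \<Longrightarrow> f \<in> borel_measurable (M X)"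
  by (simp add: measurable_cong_sets[OF M_sets refl])

lemma clip_integrable: "X \<in> space (base n) \<Longrightarrow> p \<in> K \<Longrightarrow> integrable (M X) (\<lambda>A. clip A p)"
  using M_measurable[OF _ clip_measurable] abs_clip
  by (intro finite_measure.integrable_const_bound[where B = \<gamma>] prob_space.finite_measure M_prob) auto

lemma est_measurable: "p \<in> K \<Longrightarrow> est p \<in> borel_measurable (base n)"
proof -
  assume p: "p \<in> K"
  have "(\<lambda>q. clip (snd q) p) \<in> borel_measurable (base n \<Otimes>\<^sub>M mat_space d)"
    by (rule measurable_compose[OF measurable_snd clip_measurable[OF p]])
  then have "(\<lambda>X. \<integral>A. clip A p \<partial>M X) \<in> borel_measurable (base n)"
    by (intro measurable_kernel_integral[OF _ M_kernel] clip_integrable p) (simp_all add: case_prod_beta')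
  then show ?thesis
    by (rule measurable_cong[THEN iffD1, rotated]) (simp add: est_def)
qed

lemma est_bound: "p \<in> K \<Longrightarrow> \<bar>est p X\<bar> \<le> \<gamma>"
proof (cases "X \<in> space (base n)")
  case True
  assume p: "p \<in> K"
  interpret prob_space "M X" by (rule M_prob[OF True])
  have "\<bar>\<integral>A. clip A p \<partial>M X\<bar> \<le> (\<integral>A. \<bar>clip A p\<bar> \<partial>M X)" by (rule integral_abs_bound)
  also have "\<dots> \<le> \<gamma>" using clip_integrable[OF True p] abs_clip by (intro integral_le_const) auto
  finally show ?thesis using True by (simp add: est_def)
next
  case False
  then show ?thesis using \<gamma>_pos by (simp add: est_def)
qed

text \<open>The attack is affine in the clipped entries, so the output enters its mean only through
  \<open>est\<close>, a function of the data alone; this makes \<open>stein\<close>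
  applicable.\<close>

lemma attack_integral:
  assumes X: "X \<in> space (base n)"
  shows "(\<integral>A. attack B x A \<partial>M X) = (\<Sum>p\<in>K. (1 - (B p)\<^sup>2) * score B x p * (est p X - \<gamma> * B p))"
proof -
  interpret prob_space "M X" by (rule M_prob[OF X])
  have i: "integrable (M X) (\<lambda>A. (1 - (B p)\<^sup>2) * score B x p * (clip A p - \<gamma> * B p))" if "p \<in> K" for p
    using clip_integrable[OF X that] by (intro integrable_mult_right Bochner_Integration.integrable_diff) auto
  have "(\<integral>A. attack B x A \<partial>M X) = (\<Sum>p\<in>K. \<integral>A. (1 - (B p)\<^sup>2) * score B x p * (clip A p - \<gamma> * B p) \<partial>M X)"
    unfolding attack_def by (intro Bochner_Integration.integral_sum i)
  also have "\<dots> = (\<Sum>p\<in>K. (1 - (B p)\<^sup>2) * score B x p * (est p X - \<gamma> * B p))"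
  proof (intro sum.cong refl)
    fix p assume p: "p \<in> K"
    have "(\<integral>A. clip A p - \<gamma> * B p \<partial>M X) = est p X - \<gamma> * B p"
      using clip_integrable[OF X p] X by (simp add: est_def prob_space)
    then show "(\<integral>A. (1 - (B p)\<^sup>2) * score B x p * (clip A p - \<gamma> * B p) \<partial>M X) = (1 - (B p)\<^sup>2) * score B x p * (est p X - \<gamma> * B p)"
      by (subst integral_mult_right_zero) simp
  qed
  finally show ?thesis .
qed

text \<open>The measurability of \<open>risk\<close> rests on integrability at every B, also outside
  the cube; hence a bound that depends on B.\<close>

lemma loss_bound_any: "\<bar>loss B A\<bar> \<le> (\<Sum>p\<in>K. (\<gamma> + \<gamma> * \<bar>B p\<bar>)\<^sup>2)"
proof -
  have "(clip A p - \<gamma> * B p)\<^sup>2 \<le> (\<gamma> + \<gamma> * \<bar>B p\<bar>)\<^sup>2" for p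
  proof (rule abs_le_square_iff[THEN iffD1])
    have "\<bar>\<gamma> * B p\<bar> = \<gamma> * \<bar>B p\<bar>" using \<gamma>_pos by (simp add: abs_mult)
    then show "\<bar>clip A p - \<gamma> * B p\<bar> \<le> \<bar>\<gamma> + \<gamma> * \<bar>B p\<bar>\<bar>" using abs_clip[of A p] by linarith
  qed
  then have "loss B A \<le> (\<Sum>p\<in>K. (\<gamma> + \<gamma> * \<bar>B p\<bar>)\<^sup>2)" unfolding loss_def by (intro sum_mono)
  moreover have "0 \<le> loss B A" unfolding loss_def by (intro sum_nonneg) auto
  ultimately show ?thesis by simp
qed

lemma loss_nonneg: "0 \<le> loss B A" unfolding loss_def by (intro sum_nonneg) auto

lemma loss_integrable: "X \<in> space (base n) \<Longrightarrow> integrable (M X) (loss B)"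
  using M_measurable[OF _ loss_measurable[of B]] loss_bound_any[of B]
  by (intro finite_measure.integrable_const_bound[where B = "\<Sum>p\<in>K. (\<gamma> + \<gamma> * \<bar>B p\<bar>)\<^sup>2"] prob_space.finite_measure M_prob) auto

lemma pair_loss_measurable: "(\<lambda>(q, A). loss (fst q) A) \<in> borel_measurable ((prior \<Otimes>\<^sub>M base n) \<Otimes>\<^sub>M mat_space d)"
  unfolding loss_def case_prod_beta'
proof (intro borel_measurable_sum borel_measurable_power borel_measurable_diff borel_measurable_times borel_measurable_const)
  fix p assume p: "p \<in> K"
  show "(\<lambda>r. clip (snd r) p) \<in> borel_measurable ((prior \<Otimes>\<^sub>M base n) \<Otimes>\<^sub>M mat_space d)"
    by (rule measurable_compose[OF measurable_snd clip_measurable[OF p]])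
  show "(\<lambda>r. fst (fst r) p) \<in> borel_measurable ((prior \<Otimes>\<^sub>M base n) \<Otimes>\<^sub>M mat_space d)"
    by (rule measurable_compose[OF measurable_fst pair_B_measurable[OF p]])
qed

lemma risk_measurable: "(\<lambda>q. risk (fst q) (snd q)) \<in> borel_measurable (prior \<Otimes>\<^sub>M base n)"
  unfolding risk_def
  by (rule measurable_kernel_integral[OF pair_loss_measurable M_kernel_pair]) (auto simp: space_pair_measure loss_integrable)

lemma risk_nonneg: "0 \<le> risk B X"
  unfolding risk_def using loss_nonneg by (intro Bochner_Integration.integral_nonneg)

lemma risk_le:
  assumes X: "X \<in> space (base n)" and B: "\<And>p. p \<in> K \<Longrightarrow> \<bar>B p\<bar> \<le> 1"
  shows "risk B X \<le> 4 * \<gamma>\<^sup>2 * card K"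
proof -
  interpret prob_space "M X" by (rule M_prob[OF X])
  show ?thesis unfolding risk_def using loss_integrable[OF X] loss_bounds(2)[OF B] by (intro integral_le_const) auto
qed

lemma space_joint: "space (joint n) = space prior \<times> space (base n)"
  using sets_eq_imp_space_eq[OF sets_joint] by (simp add: space_pair_measure)

lemma AE_joint_space: "AE q in joint n. (\<forall>p\<in>K. \<bar>fst q p\<bar> \<le> 1) \<and> snd q \<in> space (base n)"
  using AE_joint AE_space by eventually_elim (auto simp: space_joint)

lemma risk_integrable: "integrable (joint n) (\<lambda>q. risk (fst q) (snd q))"
proof (rule bounded_joint_integrable[OF risk_measurable])
  show "AE q in joint n. \<bar>risk (fst q) (snd q)\<bar> \<le> 4 * \<gamma>\<^sup>2 * card K"
    using AE_joint_space by eventually_elim (auto simp: abs_of_nonneg[OF risk_nonneg] intro!: risk_le)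
qed

text \<open>From b c = \<gamma> b^2 + b (c - \<gamma> b) with Young's inequality for the last term.
  It stands in for Cauchy-Schwarz: being affine in the squares it can be averaged first, and the
  weight \<tau> is chosen afterwards.\<close>

lemma est_correlation:
  assumes X: "X \<in> space (base n)" and \<tau>: "\<tau> > 0"
  shows "\<gamma> * (\<Sum>p\<in>K. (B p)\<^sup>2) - (\<tau> * (\<Sum>p\<in>K. (B p)\<^sup>2) + risk B X / \<tau>) / 2 \<le> (\<Sum>p\<in>K. B p * est p X)"
proof -
  interpret prob_space "M X" by (rule M_prob[OF X])
  let ?s = "\<Sum>p\<in>K. (B p)\<^sup>2"
  have pt: "\<gamma> * ?s - (\<tau> * ?s + loss B A / \<tau>) / 2 \<le> (\<Sum>p\<in>K. B p * clip A p)" for A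
  proof -
    have "\<gamma> * b\<^sup>2 - (\<tau> * b\<^sup>2 + (c - \<gamma> * b)\<^sup>2 / \<tau>) / 2 \<le> b * c" for b c :: real
    proof -
      have "0 \<le> (\<tau> * b + (c - \<gamma> * b))\<^sup>2 / (2 * \<tau>)" using \<tau> by simp
      also have "\<dots> = b * c - (\<gamma> * b\<^sup>2 - (\<tau> * b\<^sup>2 + (c - \<gamma> * b)\<^sup>2 / \<tau>) / 2)"
        using \<tau> by (simp add: power2_eq_square field_simps)
      finally show ?thesis by simp
    qed
    then have "(\<Sum>p\<in>K. \<gamma> * (B p)\<^sup>2 - (\<tau> * (B p)\<^sup>2 + (clip A p - \<gamma> * B p)\<^sup>2 / \<tau>) / 2) \<le> (\<Sum>p\<in>K. B p * clip A p)"
      by (intro sum_mono)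
    then show ?thesis
      unfolding loss_def by (simp add: sum_subtractf sum.distrib sum_distrib_left flip: sum_divide_distrib)
  qed
  have "(\<integral>A. \<gamma> * ?s - (\<tau> * ?s + loss B A / \<tau>) / 2 \<partial>M X) \<le> (\<integral>A. (\<Sum>p\<in>K. B p * clip A p) \<partial>M X)"
    using loss_integrable[OF X] clip_integrable[OF X] by (intro integral_mono pt) auto
  also have "(\<integral>A. (\<Sum>p\<in>K. B p * clip A p) \<partial>M X) = (\<Sum>p\<in>K. B p * est p X)"
    using clip_integrable[OF X] X by (subst Bochner_Integration.integral_sum) (auto simp: est_def)
  also have "(\<integral>A. \<gamma> * ?s - (\<tau> * ?s + loss B A / \<tau>) / 2 \<partial>M X) = \<gamma> * ?s - (\<tau> * ?s + risk B X / \<tau>) / 2"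
    using loss_integrable[OF X] by (simp add: risk_def prob_space)
  finally show ?thesis .
qed

text \<open>On the data space this is the sum over all samples of the mean attack, with the sum over
  the samples moved inside the sum over \<open>K\<close>.\<close>

definition total_attack :: "(nat \<times> nat \<Rightarrow> real) \<Rightarrow> (nat \<Rightarrow> nat \<Rightarrow> real) \<Rightarrow> real" where
  "total_attack B X = (\<Sum>p\<in>K. score_sum n B X p * ((1 - (B p)\<^sup>2) * (est p X - \<gamma> * B p)))"

lemma pair_est_measurable: "p \<in> K \<Longrightarrow> (\<lambda>q. est p (snd q)) \<in> borel_measurable (prior \<Otimes>\<^sub>M base n)"
  by (rule measurable_compose[OF measurable_snd est_measurable])

lemma weighted_score_integrable:
  assumes p: "p \<in> K"
  shows "integrable (joint n) (\<lambda>q. score_sum n (fst q) (snd q) p * ((1 - (fst q p)\<^sup>2) * est p (snd q)))"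
    and "integrable (joint n) (\<lambda>q. score_sum n (fst q) (snd q) p * ((1 - (fst q p)\<^sup>2) * (\<gamma> * fst q p)))"
proof -
  note Bm = pair_B_measurable[OF p, of n] and em = pair_est_measurable[OF p]
  have w: "\<bar>1 - b\<^sup>2\<bar> \<le> 1" if "\<bar>b\<bar> \<le> 1" for b :: real
  proof -
    have "b\<^sup>2 \<le> 1" using that by (simp add: abs_square_le_1)
    then show ?thesis by simp
  qed
  show "integrable (joint n) (\<lambda>q. score_sum n (fst q) (snd q) p * ((1 - (fst q p)\<^sup>2) * est p (snd q)))"
  proof (rule score_sum_bounded_integrable[OF p])
    show "(\<lambda>q. (1 - (fst q p)\<^sup>2) * est p (snd q)) \<in> borel_measurable (prior \<Otimes>\<^sub>M base n)" using Bm em by measurable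
    show "AE q in joint n. \<bar>(1 - (fst q p)\<^sup>2) * est p (snd q)\<bar> \<le> 1 * \<gamma>"
      using AE_joint
    proof eventually_elim
      fix q :: "(nat \<times> nat \<Rightarrow> real) \<times> (nat \<Rightarrow> nat \<Rightarrow> real)" assume "\<forall>p\<in>K. \<bar>fst q p\<bar> \<le> 1"
      then show "\<bar>(1 - (fst q p)\<^sup>2) * est p (snd q)\<bar> \<le> 1 * \<gamma>"
        unfolding abs_mult using p w est_bound[OF p] by (intro mult_mono) auto
    qed
  qed
  show "integrable (joint n) (\<lambda>q. score_sum n (fst q) (snd q) p * ((1 - (fst q p)\<^sup>2) * (\<gamma> * fst q p)))"
  proof (rule score_sum_bounded_integrable[OF p])
    show "(\<lambda>q. (1 - (fst q p)\<^sup>2) * (\<gamma> * fst q p)) \<in> borel_measurable (prior \<Otimes>\<^sub>M base n)" using Bm by measurable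
    show "AE q in joint n. \<bar>(1 - (fst q p)\<^sup>2) * (\<gamma> * fst q p)\<bar> \<le> 1 * (\<gamma> * 1)"
      using AE_joint
    proof eventually_elim
      fix q :: "(nat \<times> nat \<Rightarrow> real) \<times> (nat \<Rightarrow> nat \<Rightarrow> real)" assume "\<forall>p\<in>K. \<bar>fst q p\<bar> \<le> 1"
      then show "\<bar>(1 - (fst q p)\<^sup>2) * (\<gamma> * fst q p)\<bar> \<le> 1 * (\<gamma> * 1)"
        unfolding abs_mult using p w \<gamma>_pos by (intro mult_mono) auto
    qed
  qed
qed

lemma total_attack_split:
  "total_attack B X = (\<Sum>p\<in>K. score_sum n B X p * ((1 - (B p)\<^sup>2) * est p X) - score_sum n B X p * ((1 - (B p)\<^sup>2) * (\<gamma> * B p)))"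
  unfolding total_attack_def by (intro sum.cong) (auto simp: algebra_simps)

lemma total_attack_integrable: "integrable (joint n) (\<lambda>q. total_attack (fst q) (snd q))"
  unfolding total_attack_split
  by (intro Bochner_Integration.integrable_sum Bochner_Integration.integrable_diff weighted_score_integrable)

text \<open>Given B the weights are constants and the scores are centred; centring the estimate at
  the truth is therefore free in the lower bound.\<close>

lemma bias_zero:
  assumes p: "p \<in> K"
  shows "(\<integral>q. score_sum n (fst q) (snd q) p * ((1 - (fst q p)\<^sup>2) * (\<gamma> * fst q p)) \<partial>joint n) = 0"
proof -
  have z: "(\<integral>X. score_sum n B X p * ((1 - (B p)\<^sup>2) * (\<gamma> * B p)) \<partial>sample n B) = 0" for B
  proof -
    have "(\<integral>X. score_sum n B X p \<partial>sample n B) = (\<Sum>k<n. \<integral>X. score B (X k) p \<partial>sample n B)"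
      unfolding score_sum_def by (intro Bochner_Integration.integral_sum score_PiM_law(1)[OF _ p]) simp
    also have "\<dots> = 0" by (intro sum.neutral ballI score_PiM_law(2)[OF _ p]) simp
    finally show ?thesis by (subst integral_mult_left_zero) simp
  qed
  show ?thesis
    unfolding integral_joint(2)[OF weighted_score_integrable(2)[OF p]] fst_conv snd_conv z by simp
qed

lemma second_moment_joint:
  assumes p: "p \<in> K"
  shows "integrable (joint n) (\<lambda>q. (fst q p)\<^sup>2)" "(\<integral>q. (fst q p)\<^sup>2 \<partial>joint n) = 1 / 3"
proof -
  show i: "integrable (joint n) (\<lambda>q. (fst q p)\<^sup>2)"
  proof (rule bounded_joint_integrable)
    show "(\<lambda>q. (fst q p)\<^sup>2) \<in> borel_measurable (prior \<Otimes>\<^sub>M base n)" using pair_B_measurable[OF p] by measurable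
    show "AE q in joint n. \<bar>(fst q p)\<^sup>2\<bar> \<le> 1" using AE_joint by eventually_elim (use p in \<open>auto simp: abs_square_le_1\<close>)
  qed
  interpret L: prob_space "sample n B" for B by (rule prob_space_PiM_law)
  have "(\<integral>q. (fst q p)\<^sup>2 \<partial>joint n) = (\<integral>B. (B p)\<^sup>2 \<partial>prior)"
    using integral_joint(2)[OF i] by (simp add: L.prob_space)
  also have "\<dots> = (\<integral>x. x\<^sup>2 \<partial>distr prior sym_unif (\<lambda>B. B p))"
  proof (rule integral_distr[symmetric])
    show "(\<lambda>B. B p) \<in> measurable prior sym_unif"
      using prior_component_measurable[OF p] by (simp add: measurable_cong_sets[OF refl sets_sym_unif])
    show "(\<lambda>x. x\<^sup>2) \<in> borel_measurable sym_unif" by (rule borel_measurable_power) measurable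
  qed
  also have "distr prior sym_unif (\<lambda>B. B p) = sym_unif"
    unfolding prior_def by (rule distr_PiM_component[OF prob_space_sym_unif p])
  finally show "(\<integral>q. (fst q p)\<^sup>2 \<partial>joint n) = 1 / 3" by (simp add: sym_unif_second_moment)
qed

text \<open>\<open>stein\<close> with c = \<open>est p\<close> turns the score correlation into 2 /
  \<gamma> times the correlation of estimate and coefficient. Summed over \<open>K\<close>, the
  latter is at least \<gamma> * card K / 3, from the second moment 1/3 of the entries, minus the
  Cauchy-Schwarz loss \<beta> * sqrt (card K / 3).\<close>

lemma total_attack_lower:
  fixes \<beta> :: real
  assumes \<beta>: "\<beta> > 0" and r: "(\<integral>q. risk (fst q) (snd q) \<partial>joint n) \<le> \<beta>\<^sup>2"
  shows "2 / 3 * card K - 2 / \<gamma> * \<beta> * sqrt (card K / 3) \<le> (\<integral>q. total_attack (fst q) (snd q) \<partial>joint n)"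
proof -
  let ?N = "real (card K)"
  have N: "?N > 0" using m_bounds by (simp add: card_K)
  \<comment> \<open>The balancing weight: it makes both terms lost in \<open>est_correlation\<close>
    at most \<beta> * sqrt (?N / 3).\<close>
  define \<tau> where "\<tau> = \<beta> / sqrt (?N / 3)"
  have \<tau>: "\<tau> > 0" using \<beta> N by (simp add: \<tau>_def)
  have bi: "integrable (joint n) (\<lambda>q. fst q p * est p (snd q))" if p: "p \<in> K" for p
  proof (rule bounded_joint_integrable)
    show "(\<lambda>q. fst q p * est p (snd q)) \<in> borel_measurable (prior \<Otimes>\<^sub>M base n)"
      using pair_B_measurable[OF p] pair_est_measurable[OF p] by measurable
    show "AE q in joint n. \<bar>fst q p * est p (snd q)\<bar> \<le> 1 * \<gamma>"
      using AE_joint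
    proof eventually_elim
      fix q :: "(nat \<times> nat \<Rightarrow> real) \<times> (nat \<Rightarrow> nat \<Rightarrow> real)" assume "\<forall>p\<in>K. \<bar>fst q p\<bar> \<le> 1"
      then show "\<bar>fst q p * est p (snd q)\<bar> \<le> 1 * \<gamma>"
        unfolding abs_mult using p est_bound[OF p] by (intro mult_mono) auto
    qed
  qed
  have s: "(\<integral>q. score_sum n (fst q) (snd q) p * ((1 - (fst q p)\<^sup>2) * est p (snd q)) \<partial>joint n) = 2 / \<gamma> * (\<integral>q. fst q p * est p (snd q) \<partial>joint n)" if p: "p \<in> K" for p
  proof -
    have "0 = (\<integral>q. \<gamma> * (score_sum n (fst q) (snd q) p * ((1 - (fst q p)\<^sup>2) * est p (snd q))) - 2 * (fst q p * est p (snd q)) \<partial>joint n)"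
      using stein[OF p est_measurable[OF p] est_bound[OF p]] by (simp add: algebra_simps)
    also have "\<dots> = \<gamma> * (\<integral>q. score_sum n (fst q) (snd q) p * ((1 - (fst q p)\<^sup>2) * est p (snd q)) \<partial>joint n) - 2 * (\<integral>q. fst q p * est p (snd q) \<partial>joint n)"
      using weighted_score_integrable(1)[OF p] bi[OF p] by simp
    finally show ?thesis using \<gamma>_pos by (simp add: field_simps)
  qed
  have "(\<integral>q. total_attack (fst q) (snd q) \<partial>joint n) = (\<Sum>p\<in>K. (\<integral>q. score_sum n (fst q) (snd q) p * ((1 - (fst q p)\<^sup>2) * est p (snd q)) \<partial>joint n)
      - (\<integral>q. score_sum n (fst q) (snd q) p * ((1 - (fst q p)\<^sup>2) * (\<gamma> * fst q p)) \<partial>joint n))"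
    unfolding total_attack_split
    by (subst Bochner_Integration.integral_sum)
      (auto intro!: Bochner_Integration.integrable_diff weighted_score_integrable sum.cong Bochner_Integration.integral_diff)
  also have "\<dots> = 2 / \<gamma> * (\<Sum>p\<in>K. \<integral>q. fst q p * est p (snd q) \<partial>joint n)"
    unfolding sum_distrib_left by (intro sum.cong refl) (simp add: s bias_zero)
  also have "(\<Sum>p\<in>K. \<integral>q. fst q p * est p (snd q) \<partial>joint n) = (\<integral>q. (\<Sum>p\<in>K. fst q p * est p (snd q)) \<partial>joint n)"
    by (intro Bochner_Integration.integral_sum[symmetric] bi)
  finally have eq: "(\<integral>q. total_attack (fst q) (snd q) \<partial>joint n) = 2 / \<gamma> * (\<integral>q. (\<Sum>p\<in>K. fst q p * est p (snd q)) \<partial>joint n)" .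
  have si: "integrable (joint n) (\<lambda>q. \<Sum>p\<in>K. (fst q p)\<^sup>2)" by (intro Bochner_Integration.integrable_sum second_moment_joint)
  have sv: "(\<integral>q. (\<Sum>p\<in>K. (fst q p)\<^sup>2) \<partial>joint n) = ?N / 3"
  proof -
    have "(\<integral>q. (\<Sum>p\<in>K. (fst q p)\<^sup>2) \<partial>joint n) = (\<Sum>p\<in>K. \<integral>q. (fst q p)\<^sup>2 \<partial>joint n)"
      by (intro Bochner_Integration.integral_sum second_moment_joint(1))
    also have "\<dots> = (\<Sum>p\<in>K. 1 / 3)" by (intro sum.cong refl second_moment_joint(2))
    finally show ?thesis by simp
  qed
  have "\<gamma> * (?N / 3) - (\<tau> * (?N / 3) + (\<integral>q. risk (fst q) (snd q) \<partial>joint n) / \<tau>) / 2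
      = (\<integral>q. \<gamma> * (\<Sum>p\<in>K. (fst q p)\<^sup>2) - (\<tau> * (\<Sum>p\<in>K. (fst q p)\<^sup>2) + risk (fst q) (snd q) / \<tau>) / 2 \<partial>joint n)"
    using si risk_integrable by (simp add: sv)
  also have "\<dots> \<le> (\<integral>q. (\<Sum>p\<in>K. fst q p * est p (snd q)) \<partial>joint n)"
    using si risk_integrable bi est_correlation[OF _ \<tau>] by (intro integral_mono) (auto simp: space_joint)
  finally have 1: "\<gamma> * (?N / 3) - (\<tau> * (?N / 3) + (\<integral>q. risk (fst q) (snd q) \<partial>joint n) / \<tau>) / 2 \<le> (\<integral>q. (\<Sum>p\<in>K. fst q p * est p (snd q)) \<partial>joint n)" .
  have 2: "(\<integral>q. risk (fst q) (snd q) \<partial>joint n) / \<tau> \<le> \<beta>\<^sup>2 / \<tau>" using r \<tau> by (intro divide_right_mono) auto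
  have 3: "\<beta>\<^sup>2 / \<tau> = \<beta> * sqrt (?N / 3)" "\<tau> * (?N / 3) = \<beta> * sqrt (?N / 3)"
  proof -
    define w where "w = sqrt (?N / 3)"
    have w: "w > 0" "?N / 3 = w * w" using N by (auto simp: w_def)
    show "\<beta>\<^sup>2 / \<tau> = \<beta> * sqrt (?N / 3)" "\<tau> * (?N / 3) = \<beta> * sqrt (?N / 3)"
      unfolding \<tau>_def w_def[symmetric] w(2) using w(1) \<beta> by (auto simp: field_simps power2_eq_square)
  qed
  have arith: "a - w \<le> I" if "a - (x + y) / 2 \<le> I" "y \<le> z" "z = w" "x = w" for a x y z w I :: real
  proof -
    have "(x + y) / 2 \<le> (w + w) / 2" using that by (intro divide_right_mono add_mono) auto
    then have "(x + y) / 2 \<le> w" by simp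
    then show ?thesis using that(1) by argo
  qed
  have "\<gamma> * (?N / 3) - \<beta> * sqrt (?N / 3) \<le> (\<integral>q. (\<Sum>p\<in>K. fst q p * est p (snd q)) \<partial>joint n)"
    by (rule arith[OF 1 2 3])
  then have "2 / \<gamma> * (\<gamma> * (?N / 3) - \<beta> * sqrt (?N / 3)) \<le> (\<integral>q. total_attack (fst q) (snd q) \<partial>joint n)"
    unfolding eq using \<gamma>_pos by (intro mult_left_mono) auto
  moreover have "2 / \<gamma> * (\<gamma> * (?N / 3) - \<beta> * sqrt (?N / 3)) = 2 / 3 * ?N - 2 / \<gamma> * \<beta> * sqrt (?N / 3)"
    using \<gamma>_pos by (simp add: field_simps)
  ultimately show ?thesis by simp
qed

text \<open>\<open>attack_dp\<close> is summed over the n samples for almost every B. As exp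
  \<epsilon> - 1 \<le> 2 \<epsilon> on (0, 1), the multiplicative part is at most 2 n \<epsilon>
  \<beta>; the additive part uses n * \<delta> \<le> 1/3.\<close>

lemma total_attack_upper:
  fixes \<epsilon> \<delta> \<beta> :: real
  assumes dp: "diff_private d n \<epsilon> \<delta> M" and \<epsilon>: "0 < \<epsilon>" "\<epsilon> < 1" and n: "n \<ge> 1" and \<delta>: "\<delta> \<le> 1 / (3 * real n)"
    and \<beta>: "\<beta> > 0" and r: "(\<integral>q. risk (fst q) (snd q) \<partial>joint n) \<le> \<beta>\<^sup>2"
  shows "(\<integral>q. total_attack (fst q) (snd q) \<partial>joint n) \<le> 2 * real n * \<epsilon> * \<beta> + 4 / 3 * \<gamma> * card K"
proof -
  interpret P: prob_space prior by (rule prob_space_prior)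
  interpret L: prob_space "sample n B" for B by (rule prob_space_PiM_law)
  let ?D = "\<lambda>B. sample n B"
  have spD: "space (?D B) = space (base n)" for B
    unfolding PiM_law_density by simp
  have ri: "integrable (joint n) (\<lambda>q. risk (fst q) (snd q) / (2 * \<beta>) + \<beta> / 2)"
  proof -
    interpret J: prob_space "joint n" by (rule prob_space_joint)
    show ?thesis using risk_integrable by simp
  qed
  define rr where "rr B = (\<integral>X. risk B X / (2 * \<beta>) + \<beta> / 2 \<partial>?D B)" for B
  have rri: "integrable prior rr" and rrv: "(\<integral>B. rr B \<partial>prior) = (\<integral>q. risk (fst q) (snd q) / (2 * \<beta>) + \<beta> / 2 \<partial>joint n)"
    using integral_joint[OF ri] unfolding rr_def by auto
  have "(\<integral>q. total_attack (fst q) (snd q) \<partial>joint n) = (\<integral>B. (\<integral>X. total_attack B X \<partial>?D B) \<partial>prior)"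
    using integral_joint(2)[OF total_attack_integrable] by simp
  also have "\<dots> \<le> (\<integral>B. n * ((exp \<epsilon> - 1) * rr B + 4 * (1 / (3 * real n)) * \<gamma> * card K) \<partial>prior)"
  proof (rule integral_mono_AE)
    show "integrable prior (\<lambda>B. \<integral>X. total_attack B X \<partial>?D B)" using integral_joint(1)[OF total_attack_integrable] by simp
    show "integrable prior (\<lambda>B. n * ((exp \<epsilon> - 1) * rr B + 4 * (1 / (3 * real n)) * \<gamma> * card K))"
      using rri by (intro integrable_mult_right Bochner_Integration.integrable_add) auto
    show "AE B in prior. (\<integral>X. total_attack B X \<partial>?D B) \<le> n * ((exp \<epsilon> - 1) * rr B + 4 * (1 / (3 * real n)) * \<gamma> * card K)"
      using AE_prior
    proof eventually_elim
      fix B :: "nat \<times> nat \<Rightarrow> real" assume B: "\<forall>p\<in>K. \<bar>B p\<bar> \<le> 1"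
      have ai: "integrable (?D B) (\<lambda>X. \<integral>A. attack B (X k) A \<partial>M X)" if k: "k < n" for k
      proof -
        have "integrable (?D B) (\<lambda>X. \<Sum>p\<in>K. (1 - (B p)\<^sup>2) * score B (X k) p * (est p X - \<gamma> * B p))"
        proof (rule Bochner_Integration.integrable_sum)
          fix p assume p: "p \<in> K"
          have em: "est p \<in> borel_measurable (?D B)"
            using est_measurable[OF p] unfolding PiM_law_density by simp
          have si: "integrable (?D B) (\<lambda>X. (1 - (B p)\<^sup>2) * score B (X k) p)"
            by (intro integrable_mult_right score_PiM_law(1)[OF k p])
          show "integrable (?D B) (\<lambda>X. (1 - (B p)\<^sup>2) * score B (X k) p * (est p X - \<gamma> * B p))"
          proof (rule Bochner_Integration.integrable_bound[OF integrable_mult_left[OF si]])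
            show "(\<lambda>X. (1 - (B p)\<^sup>2) * score B (X k) p * (est p X - \<gamma> * B p)) \<in> borel_measurable (?D B)"
              by (rule borel_measurable_times[OF borel_measurable_integrable[OF si] borel_measurable_diff[OF em borel_measurable_const]])
            show "AE X in ?D B. norm ((1 - (B p)\<^sup>2) * score B (X k) p * (est p X - \<gamma> * B p)) \<le> norm ((1 - (B p)\<^sup>2) * score B (X k) p * (2 * \<gamma>))"
            proof (rule AE_I2)
              fix X
              have "\<bar>\<gamma> * B p\<bar> \<le> \<gamma>" using B p \<gamma>_pos by (simp add: abs_mult mult_left_le)
              then have "\<bar>est p X - \<gamma> * B p\<bar> \<le> \<bar>2 * \<gamma>\<bar>" using est_bound[OF p, of X] by linarith
              then show "norm ((1 - (B p)\<^sup>2) * score B (X k) p * (est p X - \<gamma> * B p)) \<le> norm ((1 - (B p)\<^sup>2) * score B (X k) p * (2 * \<gamma>))"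
                unfolding real_norm_def abs_mult[of _ "est p X - \<gamma> * B p"] abs_mult[of _ "2 * \<gamma>"] by (intro mult_left_mono) auto
            qed
          qed
        qed
        then show ?thesis
          by (rule Bochner_Integration.integrable_cong[THEN iffD1, OF refl, rotated]) (simp add: attack_integral spD)
      qed
      have "(\<integral>X. total_attack B X \<partial>?D B) = (\<integral>X. (\<Sum>k<n. \<integral>A. attack B (X k) A \<partial>M X) \<partial>?D B)"
      proof (intro Bochner_Integration.integral_cong refl)
        fix X assume "X \<in> space (?D B)"
        then have X: "X \<in> space (base n)" by (simp add: spD)
        show "total_attack B X = (\<Sum>k<n. \<integral>A. attack B (X k) A \<partial>M X)"
          unfolding attack_integral[OF X] total_attack_def score_sum_def sum_distrib_right
          by (subst sum.swap) (intro sum.cong refl, simp add: mult_ac)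
      qed
      also have "\<dots> = (\<Sum>k<n. \<integral>X. (\<integral>A. attack B (X k) A \<partial>M X) \<partial>?D B)"
        by (intro Bochner_Integration.integral_sum ai) simp
      also have "\<dots> \<le> (\<Sum>k<n. (exp \<epsilon> - 1) * rr B + 4 * (1 / (3 * real n)) * \<gamma> * card K)"
      proof (rule sum_mono)
        fix k assume "k \<in> {..<n}"
        then have k: "k < n" by simp
        have "(\<integral>X. (\<integral>A. attack B (X k) A \<partial>M X) \<partial>?D B)
          \<le> (exp \<epsilon> - 1) * (\<integral>X. (\<integral>A. loss B A / (2 * \<beta>) + \<beta> / 2 \<partial>M X) \<partial>?D B) + 4 * (1 / (3 * real n)) * \<gamma> * card K"
          using B \<epsilon> \<delta> n by (intro attack_dp[OF mech dp _ _ _ k \<beta>]) auto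
        also have "(\<integral>X. (\<integral>A. loss B A / (2 * \<beta>) + \<beta> / 2 \<partial>M X) \<partial>?D B) = rr B"
          unfolding rr_def
        proof (intro Bochner_Integration.integral_cong refl)
          fix X assume "X \<in> space (?D B)"
          then have X: "X \<in> space (base n)" by (simp add: spD)
          interpret MX: prob_space "M X" by (rule M_prob[OF X])
          show "(\<integral>A. loss B A / (2 * \<beta>) + \<beta> / 2 \<partial>M X) = risk B X / (2 * \<beta>) + \<beta> / 2"
            using loss_integrable[OF X] by (simp add: risk_def MX.prob_space)
        qed
        finally show "(\<integral>X. (\<integral>A. attack B (X k) A \<partial>M X) \<partial>?D B) \<le> (exp \<epsilon> - 1) * rr B + 4 * (1 / (3 * real n)) * \<gamma> * card K" .
      qed
      finally show "(\<integral>X. total_attack B X \<partial>?D B) \<le> n * ((exp \<epsilon> - 1) * rr B + 4 * (1 / (3 * real n)) * \<gamma> * card K)" by simp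
    qed
  qed
  also have "\<dots> = n * ((exp \<epsilon> - 1) * (\<integral>B. rr B \<partial>prior) + 4 * (1 / (3 * real n)) * \<gamma> * card K)"
    using rri by (simp add: P.prob_space)
  also have "\<dots> \<le> n * ((2 * \<epsilon>) * \<beta> + 4 * (1 / (3 * real n)) * \<gamma> * card K)"
  proof (intro mult_left_mono add_right_mono mult_mono)
    have "exp \<epsilon> \<le> 1 + \<epsilon> + \<epsilon>\<^sup>2" using \<epsilon> by (intro exp_bound) auto
    also have "\<epsilon>\<^sup>2 \<le> \<epsilon>" using \<epsilon> by (simp add: power2_eq_square mult_left_le)
    finally show "exp \<epsilon> - 1 \<le> 2 * \<epsilon>" by simp
    have "(\<integral>B. rr B \<partial>prior) = (\<integral>q. risk (fst q) (snd q) \<partial>joint n) / (2 * \<beta>) + \<beta> / 2"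
    proof -
      interpret J: prob_space "joint n" by (rule prob_space_joint)
      show ?thesis unfolding rrv using risk_integrable by (simp add: J.prob_space)
    qed
    \<comment> \<open>The parameter of \<open>attack_dp\<close> is the bound on the root mean square
      loss itself, so both AM-GM terms become \<beta> / 2.\<close>
    also have "\<dots> \<le> \<beta>\<^sup>2 / (2 * \<beta>) + \<beta> / 2" using r \<beta> by (intro add_right_mono divide_right_mono) auto
    also have "\<dots> = \<beta>" using \<beta> by (simp add: power2_eq_square)
    finally show "(\<integral>B. rr B \<partial>prior) \<le> \<beta>" .
    show "0 \<le> (\<integral>B. rr B \<partial>prior)"
      unfolding rr_def using risk_nonneg \<beta> by (intro Bochner_Integration.integral_nonneg add_nonneg_nonneg divide_nonneg_nonneg) auto
  qed (use \<epsilon> in auto)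
  also have "\<dots> = 2 * real n * \<epsilon> * \<beta> + 4 / 3 * \<gamma> * card K" using n by (simp add: field_simps)
  finally show ?thesis .
qed

end

context regression_prior
begin

section \<open>From the error of the mechanism to the sample size\<close>

text \<open>err_given is not known to be measurable in the covariance, because sqrt_factor is a choice.
  On the image of Cov it is bounded below by a measurable function of the recovered coefficients.\<close>

definition coef :: "(nat \<Rightarrow> nat \<Rightarrow> real) \<Rightarrow> nat \<times> nat \<Rightarrow> real" where
  "coef S = (\<lambda>p\<in>K. S (fst p) (snd p) / \<gamma>)"

definition cov_prior :: "(nat \<Rightarrow> nat \<Rightarrow> real) measure" where
  "cov_prior = distr prior (mat_space d) Cov"

lemma coef_measurable: "coef \<in> measurable (mat_space d) prior"
proof -
  have "(\<lambda>S. \<lambda>p\<in>K. S (fst p) (snd p) / \<gamma>) \<in> measurable (mat_space d) prior"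
    unfolding prior_def
  proof (rule measurable_restrict)
    fix p assume "p \<in> K"
    then have "fst p < d" "snd p < d" using m_bounds by (auto simp: K_def)
    then have "(\<lambda>S. S (fst p) (snd p) / \<gamma>) \<in> borel_measurable (mat_space d)"
      by (intro borel_measurable_divide measurable_mat_component borel_measurable_const)
    then show "(\<lambda>S. S (fst p) (snd p) / \<gamma>) \<in> measurable (mat_space d) sym_unif"
      by (simp add: measurable_cong_sets[OF refl sets_sym_unif])
  qed
  moreover have "(\<lambda>S. \<lambda>p\<in>K. S (fst p) (snd p) / \<gamma>) = coef" by (simp add: coef_def fun_eq_iff)
  ultimately show ?thesis by simp
qed

lemma coef_Cov: "B \<in> space prior \<Longrightarrow> coef (Cov B) = B"
proof
  fix p assume B: "B \<in> space prior"
  show "coef (Cov B) p = B p"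
  proof (cases "p \<in> K")
    case True
    then show ?thesis using Cov_K[of "fst p" "snd p" B] \<gamma>_pos by (simp add: coef_def)
  next
    case False
    then show ?thesis using B by (cases p) (auto simp: coef_def prior_def space_PiM PiE_def extensional_def)
  qed
qed

text \<open>The image of the cube under \<open>Cov\<close>, written as a fixed point condition on
  finitely many entries, which makes it measurable.\<close>

definition good :: "(nat \<Rightarrow> nat \<Rightarrow> real) set" where
  "good = {S \<in> space (mat_space d). (\<forall>i\<in>{..<d}. \<forall>j\<in>{..<d}. Cov (coef S) i j = S i j) \<and> (\<forall>p\<in>K. \<bar>coef S p\<bar> \<le> 1)}"

lemma good_measurable: "good \<in> sets (mat_space d)"
  unfolding good_def
proof (intro sets.sets_Collect_conj sets.sets_Collect_finite_All borel_measurable_eq borel_measurable_le borel_measurable_const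
    measurable_mat_component)
  fix i j assume "i \<in> {..<d}" "j \<in> {..<d}"
  then show "(\<lambda>S. Cov (coef S) i j) \<in> borel_measurable (mat_space d)"
    by (intro measurable_compose[OF measurable_compose[OF coef_measurable Cov_measurable] measurable_mat_component]) auto
next
  fix p assume "p \<in> K"
  then have "(\<lambda>S. coef S p) \<in> borel_measurable (mat_space d)"
    by (rule measurable_compose[OF coef_measurable prior_component_measurable])
  then show "(\<lambda>S. \<bar>coef S p\<bar>) \<in> borel_measurable (mat_space d)" by measurable
qed auto

lemma good_Cov: "S \<in> good \<Longrightarrow> S = Cov (coef S)"
proof (intro ext)
  fix i j assume S: "S \<in> good"
  show "S i j = Cov (coef S) i j"
  proof (cases "i < d \<and> j < d")
    case True
    then show ?thesis using S by (simp add: good_def)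
  next
    case False
    then show ?thesis using S Cov_space[of "coef S"]
      by (cases "i < d") (auto simp: good_def mat_space_def vec_space_def space_PiM PiE_def extensional_def Pi_def)
  qed
qed

lemma AE_good: "AE S in cov_prior. S \<in> good"
proof -
  have m: "{S \<in> space (mat_space d). S \<in> good} \<in> sets (mat_space d)"
    using good_measurable by measurable
  have "AE B in prior. Cov B \<in> good"
    using AE_prior AE_space by eventually_elim (auto simp: good_def Cov_space coef_Cov)
  then show ?thesis unfolding cov_prior_def by (subst AE_distr_iff[OF Cov_measurable m])
qed

lemma AE_pos_def_cov_prior: "AE S in cov_prior. pos_def d S"
  using AE_good
proof eventually_elim
  fix S assume "S \<in> good"
  then show "pos_def d S" using pos_def_Cov[of "coef S"] good_Cov by metis
qed

lemma prob_space_cov_prior: "prob_space cov_prior"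
  unfolding cov_prior_def by (intro prob_space.prob_space_distr prob_space_prior Cov_measurable)

lemma sets_cov_prior: "sets cov_prior = sets (mat_space d)"
  by (simp add: cov_prior_def)

lemma emeasure_cov_prior_W: "0 < emeasure cov_prior (W_set d)"
proof -
  interpret P: prob_space prior by (rule prob_space_prior)
  have v: "Cov -` W_set d \<inter> space prior \<in> sets prior"
    by (rule measurable_sets[OF Cov_measurable W_set_measurable])
  have "emeasure cov_prior (W_set d) = emeasure prior (Cov -` W_set d \<inter> space prior)"
    unfolding cov_prior_def by (rule emeasure_distr[OF Cov_measurable W_set_measurable])
  also have "\<dots> \<noteq> 0"
  proof
    assume 0: "emeasure prior (Cov -` W_set d \<inter> space prior) = 0"
    have "measure prior {B \<in> space prior. Cov B \<notin> W_set d} = 1 - measure prior (Cov -` W_set d \<inter> space prior)"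
    proof -
      have "{B \<in> space prior. Cov B \<notin> W_set d} = space prior - (Cov -` W_set d \<inter> space prior)" by auto
      then show ?thesis using P.prob_compl[OF v] by simp
    qed
    then have "measure prior {B \<in> space prior. Cov B \<notin> W_set d} = 1" using 0 by (simp add: measure_def)
    then have "ennreal 1 \<le> ennreal ((1 / 8) ^ d)" using prior_outside_W by (simp add: P.emeasure_eq_measure)
    moreover have "(1 / 8 :: real) ^ d \<le> (1 / 8) ^ 1" using d100 by (intro power_decreasing) auto
    ultimately show False by (simp add: ennreal_le_iff del: ennreal_1)
  qed
  finally show ?thesis by (simp add: zero_less_iff_neq_zero)
qed

text \<open>Clipping projects onto an interval that contains \<gamma> * B p, so it moves no entry
  away from it; the entries outside \<open>K\<close> only add to the Frobenius norm.\<close>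

lemma loss_le_frob:
  assumes B: "\<And>p. p \<in> K \<Longrightarrow> \<bar>B p\<bar> \<le> 1"
  shows "loss B A \<le> frob_sq d A (Cov B)"
proof -
  have "loss B A \<le> (\<Sum>p\<in>K. (A (fst p) (snd p) - Cov B (fst p) (snd p))\<^sup>2)"
    unfolding loss_def
  proof (rule sum_mono)
    fix p assume p: "p \<in> K"
    have c: "Cov B (fst p) (snd p) = \<gamma> * B p" using Cov_K[of "fst p" "snd p" B] p by simp
    have "\<bar>\<gamma> * B p\<bar> \<le> \<gamma>" using B[OF p] \<gamma>_pos by (simp add: abs_mult mult_left_le)
    then have "\<bar>clip A p - \<gamma> * B p\<bar> \<le> \<bar>A (fst p) (snd p) - \<gamma> * B p\<bar>" unfolding clip_def by linarith
    then show "(clip A p - \<gamma> * B p)\<^sup>2 \<le> (A (fst p) (snd p) - Cov B (fst p) (snd p))\<^sup>2"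
      unfolding c by (rule abs_le_square_iff[THEN iffD1])
  qed
  also have "\<dots> \<le> (\<Sum>p\<in>{..<d} \<times> {..<d}. (A (fst p) (snd p) - Cov B (fst p) (snd p))\<^sup>2)"
    using m_bounds by (intro sum_mono2) (auto simp: K_def)
  also have "\<dots> = frob_sq d A (Cov B)"
    unfolding frob_sq_def by (simp add: sum.cartesian_product case_prod_beta)
  finally show ?thesis .
qed

end

section \<open>The final estimate for the sample size\<close>

context regression_mechanism
begin

text \<open>Inside the window the loss is below the Frobenius error, and the integral over the
  window is at most the conditional mean because the window has mass at most 1. Outside, the clipped
  loss is at most 4 \<gamma>^2 * card K \<le> d/9 \<le> 2^d, and the mass 8^-d leaves 4^-d.\<close>

lemma risk_le_of_err:
  fixes \<alpha> :: real
  assumes err: "err_sq d n cov_prior M = ennreal (\<alpha>\<^sup>2)"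
  shows "(\<integral>q. risk (fst q) (snd q) \<partial>joint n) \<le> \<alpha>\<^sup>2 + (1 / 4) ^ d"
proof -
  interpret C: prob_space cov_prior by (rule prob_space_cov_prior)
  interpret P: prob_space prior by (rule prob_space_prior)
  interpret base: prob_space "base n" by (rule prob_space_base)
  let ?D = "\<lambda>B. sample n B"
  have spD: "space (?D B) = space (base n)" for B unfolding PiM_law_density by simp
  define f where "f q = (\<integral>\<^sup>+A. ennreal (loss (fst q) A) \<partial>M (snd q))" for q :: "(nat \<times> nat \<Rightarrow> real) \<times> (nat \<Rightarrow> nat \<Rightarrow> real)"
  have fm: "f \<in> borel_measurable (prior \<Otimes>\<^sub>M base n)"
    unfolding f_def using pair_loss_measurable
    by (intro nn_integral_measurable_subprob_algebra2[OF _ M_kernel_pair]) (auto simp: case_prod_beta')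
  \<comment> \<open>Mean loss given B. It is measurable in B, and composed with \<open>coef\<close>
    it becomes a function of the covariance: the measurable minorant of \<open>err_given\<close> on
    \<open>good\<close>.\<close>
  define F where "F B = (\<integral>\<^sup>+X. f (B, X) \<partial>?D B)" for B
  have Fm: "F \<in> borel_measurable prior"
  proof -
    have l: "(\<lambda>q. ennreal (data_lik n (fst q) (snd q))) \<in> borel_measurable (prior \<Otimes>\<^sub>M base n)"
      using pair_lik_measurable by (rule measurable_compose[OF _ measurable_ennreal])
    have "(\<lambda>B. \<integral>\<^sup>+X. ennreal (data_lik n B X) * f (B, X) \<partial>base n) \<in> borel_measurable prior"
      using base.borel_measurable_nn_integral_fst[OF borel_measurable_times_ennreal[OF l fm]] by simp
    moreover have "(\<integral>\<^sup>+X. ennreal (data_lik n B X) * f (B, X) \<partial>base n) = F B" if B: "B \<in> space prior" for B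
    proof -
      have l': "(\<lambda>X. ennreal (data_lik n B X)) \<in> borel_measurable (base n)"
        using measurable_compose[OF measurable_Pair1'[OF B] l] by simp
      have f': "(\<lambda>X. f (B, X)) \<in> borel_measurable (base n)"
        using measurable_compose[OF measurable_Pair1'[OF B] fm] by simp
      show ?thesis unfolding F_def PiM_law_density by (rule nn_integral_density[OF l' f', symmetric])
    qed
    ultimately show ?thesis by (rule measurable_cong[THEN iffD1, rotated])
  qed
  have Fle: "F B \<le> ennreal (4 * \<gamma>\<^sup>2 * card K)" if B: "\<forall>p\<in>K. \<bar>B p\<bar> \<le> 1" for B
  proof -
    interpret L: prob_space "?D B" by (rule prob_space_PiM_law)
    have "F B \<le> (\<integral>\<^sup>+X. ennreal (4 * \<gamma>\<^sup>2 * card K) \<partial>?D B)"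
      unfolding F_def
    proof (rule nn_integral_mono)
      fix X assume "X \<in> space (?D B)"
      then have X: "X \<in> space (base n)" by (simp add: spD)
      interpret MX: prob_space "M X" by (rule M_prob[OF X])
      have "f (B, X) \<le> (\<integral>\<^sup>+A. ennreal (4 * \<gamma>\<^sup>2 * card K) \<partial>M X)"
        unfolding f_def fst_conv snd_conv using B by (intro nn_integral_mono ennreal_leI loss_bounds(2)) auto
      then show "f (B, X) \<le> ennreal (4 * \<gamma>\<^sup>2 * card K)" by (simp add: MX.emeasure_space_1)
    qed
    then show ?thesis by (simp add: L.emeasure_space_1)
  qed
  have W0: "emeasure cov_prior (W_set d) \<noteq> 0" using emeasure_cov_prior_W by simp
  have Wfin: "emeasure cov_prior (W_set d) \<noteq> \<top>" by (simp add: C.emeasure_eq_measure)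
  have up: "(\<integral>\<^sup>+S. indicator (W_set d) S * err_given d n M S \<partial>cov_prior) \<le> ennreal (\<alpha>\<^sup>2)"
  proof -
    let ?I = "\<integral>\<^sup>+S. indicator (W_set d) S * err_given d n M S \<partial>cov_prior" and ?w = "emeasure cov_prior (W_set d)"
    have "?I = ?I / ?w * ?w" using W0 Wfin by (simp add: ennreal_divide_times mult_divide_eq_ennreal ennreal_times_divide)
    also have "\<dots> = ennreal (\<alpha>\<^sup>2) * ?w" using err unfolding err_sq_def by simp
    also have "\<dots> \<le> ennreal (\<alpha>\<^sup>2) * 1" by (intro mult_left_mono C.emeasure_le_1) auto
    finally show ?thesis by simp
  qed
  have "(\<integral>\<^sup>+B. indicator (W_set d) (Cov B) * F B \<partial>prior) = (\<integral>\<^sup>+B. indicator (W_set d) (Cov B) * F (coef (Cov B)) \<partial>prior)"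
    by (intro nn_integral_cong) (simp add: coef_Cov)
  also have "\<dots> = (\<integral>\<^sup>+S. indicator (W_set d) S * F (coef S) \<partial>cov_prior)"
    unfolding cov_prior_def using W_set_measurable
    by (intro nn_integral_distr[OF Cov_measurable, symmetric] borel_measurable_times_ennreal)
      (auto intro!: measurable_compose[OF coef_measurable Fm])
  also have "\<dots> \<le> (\<integral>\<^sup>+S. indicator (W_set d) S * err_given d n M S \<partial>cov_prior)"
  proof (rule nn_integral_mono_AE)
    show "AE S in cov_prior. indicator (W_set d) S * F (coef S) \<le> indicator (W_set d) S * err_given d n M S"
      using AE_good
    proof eventually_elim
      fix S assume S: "S \<in> good"
      then have B: "\<And>p. p \<in> K \<Longrightarrow> \<bar>coef S p\<bar> \<le> 1" by (simp add: good_def)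
      have "F (coef S) \<le> err_given d n M (Cov (coef S))"
        unfolding F_def f_def err_given_def data_law_def gaussian_Cov law_def
        using loss_le_frob[OF B] by (auto intro!: nn_integral_mono ennreal_leI)
      then have "F (coef S) \<le> err_given d n M S" using good_Cov[OF S] by simp
      then show "indicator (W_set d) S * F (coef S) \<le> indicator (W_set d) S * err_given d n M S" by (intro mult_left_mono) auto
    qed
  qed
  also note up
  finally have inW: "(\<integral>\<^sup>+B. indicator (W_set d) (Cov B) * F B \<partial>prior) \<le> ennreal (\<alpha>\<^sup>2)" .
  let ?bad = "{B \<in> space prior. Cov B \<notin> W_set d}"
  have badm: "?bad \<in> sets prior"
  proof -
    have "?bad = space prior - (Cov -` W_set d \<inter> space prior)" by auto
    then show ?thesis using measurable_sets[OF Cov_measurable W_set_measurable] by auto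
  qed
  have "(\<integral>\<^sup>+B. F B \<partial>prior) \<le> (\<integral>\<^sup>+B. indicator (W_set d) (Cov B) * F B + ennreal (4 * \<gamma>\<^sup>2 * card K) * indicator ?bad B \<partial>prior)"
  proof (rule nn_integral_mono_AE)
    show "AE B in prior. F B \<le> indicator (W_set d) (Cov B) * F B + ennreal (4 * \<gamma>\<^sup>2 * card K) * indicator ?bad B"
      using AE_prior AE_space by eventually_elim (auto simp: indicator_def Fle)
  qed
  also have "\<dots> = (\<integral>\<^sup>+B. indicator (W_set d) (Cov B) * F B \<partial>prior) + ennreal (4 * \<gamma>\<^sup>2 * card K) * emeasure prior ?bad"
  proof -
    have "(\<lambda>B. indicator (W_set d) (Cov B) * F B) \<in> borel_measurable prior"
      using Fm measurable_compose[OF Cov_measurable borel_measurable_indicator[OF W_set_measurable]] by (intro borel_measurable_times_ennreal)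
    then show ?thesis using badm by (subst nn_integral_add) (auto simp: nn_integral_cmult_indicator)
  qed
  also have "\<dots> \<le> ennreal (\<alpha>\<^sup>2) + ennreal (2 ^ d) * ennreal ((1 / 8) ^ d)"
  proof (intro add_mono mult_mono inW prior_outside_W ennreal_leI)
    have "4 * \<gamma>\<^sup>2 * card K \<le> 4 * \<gamma>\<^sup>2 * ((real d)\<^sup>2 / 4)" by (intro mult_left_mono card_K_bounds) auto
    also have "\<dots> = d / 9" using d100 by (simp add: \<gamma>_def power_divide power_mult_distrib power2_eq_square)
    also have "\<dots> \<le> d" by simp
    also have "\<dots> \<le> 2 ^ d" using less_exp[of d] by (simp add: of_nat_less_numeral_power_cancel_iff less_imp_le)
    finally show "4 * \<gamma>\<^sup>2 * card K \<le> 2 ^ d" .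
  qed auto
  also have "\<dots> = ennreal (\<alpha>\<^sup>2 + (1 / 4) ^ d)"
  proof -
    have "(2::real) ^ d * (1 / 8) ^ d = (1 / 4) ^ d" by (simp flip: power_mult_distrib)
    then show ?thesis by (simp flip: ennreal_mult ennreal_plus)
  qed
  finally have Fb: "(\<integral>\<^sup>+B. F B \<partial>prior) \<le> ennreal (\<alpha>\<^sup>2 + (1 / 4) ^ d)" .
  have "ennreal (\<integral>q. risk (fst q) (snd q) \<partial>joint n) = (\<integral>\<^sup>+q. ennreal (risk (fst q) (snd q)) \<partial>joint n)"
    using risk_integrable risk_nonneg by (intro nn_integral_eq_integral[symmetric]) auto
  also have "\<dots> = (\<integral>\<^sup>+q. f q \<partial>joint n)"
  proof (rule nn_integral_cong)
    fix q assume "q \<in> space (joint n)"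
    then have "snd q \<in> space (base n)" by (auto simp: space_joint)
    then show "ennreal (risk (fst q) (snd q)) = f q"
      unfolding risk_def f_def using loss_nonneg loss_integrable by (intro nn_integral_eq_integral[symmetric]) auto
  qed
  also have "\<dots> = (\<integral>\<^sup>+B. F B \<partial>prior)"
    unfolding F_def by (rule nn_integral_joint[OF fm])
  also note Fb
  finally show ?thesis by (subst (asm) ennreal_le_iff) auto
qed

lemma sample_size_bound:
  fixes \<alpha> \<epsilon> \<delta> :: real
  assumes dp: "diff_private d n \<epsilon> \<delta> M" and \<epsilon>: "0 < \<epsilon>" "\<epsilon> < 1" and n: "n \<ge> 1" and \<delta>: "\<delta> \<le> 1 / (3 * real n)"
    and err: "err_sq d n cov_prior M = ennreal (\<alpha>\<^sup>2)"
    and \<alpha>: "2 powr (- real d) \<le> \<alpha>" "\<alpha> \<le> sqrt d / 15"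
  shows "real n \<ge> (1 / 100) * (real d)\<^sup>2 / (\<epsilon> * \<alpha>)"
proof -
  \<comment> \<open>A bound for the root mean square loss under the whole prior. The lower limit on
    \<alpha> will give \<beta>^2 \<le> 2 \<alpha>^2, since 4^-d is the square of 2^-d.\<close>
  define \<beta> where "\<beta> = sqrt (\<alpha>\<^sup>2 + (1 / 4) ^ d)"
  have \<beta>2: "\<beta>\<^sup>2 = \<alpha>\<^sup>2 + (1 / 4) ^ d" unfolding \<beta>_def by (rule real_sqrt_pow2) (auto intro!: add_nonneg_nonneg)
  have \<beta>: "\<beta> > 0" unfolding \<beta>_def by (auto intro!: add_nonneg_pos)
  have "0 < 2 powr (- real d)" by simp
  then have \<alpha>0: "\<alpha> > 0" using \<alpha>(1) by linarith
  let ?N = "real (card K)"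
  define w where "w = sqrt (real d)"
  have w: "w \<ge> 10" "w\<^sup>2 = real d" using d100 by (auto simp: w_def intro!: real_le_rsqrt)
  define x where "x = real n * \<epsilon>"
  have x: "x > 0" using n \<epsilon> by (simp add: x_def)
  have r: "(\<integral>q. risk (fst q) (snd q) \<partial>joint n) \<le> \<beta>\<^sup>2" unfolding \<beta>2 by (rule risk_le_of_err[OF err])
  have "2 / 3 * ?N - 2 / \<gamma> * \<beta> * sqrt (?N / 3) \<le> 2 * real n * \<epsilon> * \<beta> + 4 / 3 * \<gamma> * ?N"
    by (rule order_trans[OF total_attack_lower[OF \<beta> r] total_attack_upper[OF dp \<epsilon> n \<delta> \<beta> r]])
  moreover have "4 / 3 * \<gamma> * ?N \<le> 4 / 3 * (1 / 30) * ?N" by (intro mult_right_mono mult_left_mono \<gamma>_le) auto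
  moreover have "2 / \<gamma> = 6 * w" using w by (simp add: \<gamma>_def w_def)
  \<comment> \<open>28/45 = 2/3 - 4/90: the additive privacy loss uses up only a small part of the
    main term.\<close>
  ultimately have 1: "28 / 45 * ?N \<le> \<beta> * (2 * x + 6 * w * sqrt (?N / 3))"
    by (simp add: x_def algebra_simps)
  \<comment> \<open>0.289 slightly exceeds 1 / sqrt 12.\<close>
  have "sqrt (?N / 3) \<le> 0.289 * w\<^sup>2"
  proof (rule real_le_lsqrt)
    have "?N / 3 \<le> (real d)\<^sup>2 / 12" using card_K_bounds(1) by simp
    also have "\<dots> \<le> (0.289 * w\<^sup>2)\<^sup>2" unfolding w(2) by (simp add: power2_eq_square)
    finally show "?N / 3 \<le> (0.289 * w\<^sup>2)\<^sup>2" .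
  qed auto
  then have "6 * w * sqrt (?N / 3) \<le> 6 * w * (0.289 * w\<^sup>2)" using w by (intro mult_left_mono) auto
  then have 2: "6 * w * sqrt (?N / 3) \<le> 1.734 * w ^ 3" by (simp add: power2_eq_square power3_eq_cube mult_ac)
  have 3: "0.155 * w ^ 4 \<le> 28 / 45 * ?N"
  proof -
    have "w ^ 4 = (real d)\<^sup>2" unfolding w(2)[symmetric] by simp
    then show ?thesis using card_K_bounds(2) by simp
  qed
  have 4: "0.155 * w ^ 4 \<le> \<beta> * (2 * x + 1.734 * w ^ 3)"
  proof -
    have "\<beta> * (2 * x + 6 * w * sqrt (?N / 3)) \<le> \<beta> * (2 * x + 1.734 * w ^ 3)" using 2 \<beta> by (intro mult_left_mono) auto
    then show ?thesis using 1 3 by linarith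
  qed
  have w3: "w ^ 3 > 0" using w by simp
  \<comment> \<open>Otherwise the privacy term is dominated by the Cauchy-Schwarz loss (2.234 =
    1.734 + 2/4), and \<beta> is at least about 0.069 w. This contradicts \<alpha> \<le> w / 15; the
    excess of \<beta>^2 over \<alpha>^2, at most 1/64, is covered by w^2 \<ge> 100.\<close>
  have big: "x > w ^ 3 / 4"
  proof (rule ccontr)
    assume "\<not> x > w ^ 3 / 4"
    then have "\<beta> * (2 * x + 1.734 * w ^ 3) \<le> \<beta> * (2.234 * w ^ 3)" using \<beta> by (intro mult_left_mono) auto
    with 4 have "0.155 * w ^ 4 \<le> \<beta> * (2.234 * w ^ 3)" by (rule order_trans)
    then have "w ^ 3 * (0.155 * w) \<le> w ^ 3 * (2.234 * \<beta>)" by (simp add: power4_eq_xxxx power3_eq_cube mult_ac)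
    then have "0.155 * w \<le> 2.234 * \<beta>" using w3 by (simp only: mult_le_cancel_left_pos)
    then have "(0.155 * w)\<^sup>2 \<le> (2.234 * \<beta>)\<^sup>2" using w by (intro power_mono) auto
    then have 5: "0.024025 * w\<^sup>2 \<le> 4.990756 * \<beta>\<^sup>2" by (simp add: power_mult_distrib power2_eq_square)
    have "\<alpha>\<^sup>2 \<le> (w / 15)\<^sup>2" using \<alpha> \<alpha>0 by (intro power_mono) (auto simp: w_def)
    then have 6: "\<alpha>\<^sup>2 \<le> w\<^sup>2 / 225" by (simp add: power_divide)
    have "(1 / 4 :: real) ^ d \<le> (1 / 4) ^ 3" using d100 by (intro power_decreasing) auto
    then have 7: "(1 / 4 :: real) ^ d \<le> 1 / 64" by (simp add: power3_eq_cube)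
    have 8: "w\<^sup>2 \<ge> 100" using w d100 by simp
    show False using 5 6 7 8 \<beta>2 by simp
  qed
  \<comment> \<open>Now w^3 < 4 x absorbs the Cauchy-Schwarz loss into the privacy term: 2 + 4 *
    1.734 is below 9.\<close>
  have "0.155 * w ^ 4 \<le> \<beta> * (9 * x)"
  proof -
    have "\<beta> * (2 * x + 1.734 * w ^ 3) \<le> \<beta> * (9 * x)" using big \<beta> x by (intro mult_left_mono) auto
    then show ?thesis using 4 by linarith
  qed
  then have "(0.155 * w ^ 4)\<^sup>2 \<le> (\<beta> * (9 * x))\<^sup>2" using w by (intro power_mono) auto
  also have "\<dots> = \<beta>\<^sup>2 * (81 * x\<^sup>2)" by (simp add: power_mult_distrib)
  also have "\<beta>\<^sup>2 \<le> 2 * \<alpha>\<^sup>2"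
  proof -
    have "(1 / 4 :: real) ^ d = ((1 / 2)\<^sup>2) ^ d" by (simp add: power2_eq_square)
    also have "\<dots> = ((1 / 2) ^ d)\<^sup>2" by (simp only: power_mult[symmetric] mult.commute)
    also have "(1 / 2 :: real) ^ d = 2 powr (- real d)"
      by (simp add: powr_minus powr_realpow power_one_over inverse_eq_divide)
    also have "(2 powr (- real d))\<^sup>2 \<le> \<alpha>\<^sup>2" using \<alpha> by (intro power_mono) auto
    finally show ?thesis unfolding \<beta>2 by simp
  qed
  finally have "(0.155 * w ^ 4)\<^sup>2 \<le> 2 * \<alpha>\<^sup>2 * (81 * x\<^sup>2)" by (simp add: mult_right_mono)
  \<comment> \<open>2 * 81 is below 15.5^2, and 0.155 / 15.5 is the constant 1/100.\<close>
  also have "\<dots> \<le> (15.5 * (\<alpha> * x))\<^sup>2" using \<alpha>0 x by (simp add: power_mult_distrib power2_eq_square)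
  finally have "0.155 * w ^ 4 \<le> 15.5 * (\<alpha> * x)"
    using \<alpha>0 x by (intro power2_le_imp_le[of "0.155 * w ^ 4"]) auto
  moreover have "w ^ 4 = (real d)\<^sup>2" unfolding w(2)[symmetric] by simp
  ultimately have "(1 / 100) * (real d)\<^sup>2 \<le> real n * (\<epsilon> * \<alpha>)" by (simp add: x_def mult_ac)
  then show ?thesis using \<epsilon> \<alpha>0 by (simp add: divide_le_eq)
qed

end

theorem theorem1:
  shows "\<exists>C>0. \<forall>(d::nat) (n::nat) (\<epsilon>::real) (\<delta>::real).
    d \<ge> 1 \<longrightarrow> n \<ge> 1 \<longrightarrow> 0 < \<epsilon> \<longrightarrow> \<epsilon> < 1 \<longrightarrow> \<delta> \<le> 1 / (3 * n * ln (exp 1 * n)) \<longrightarrow>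
    (\<exists>P. prob_space P \<and> sets P = sets (mat_space d) \<and> (AE S in P. pos_def d S) \<and>
         emeasure P (W_set d) > 0 \<and>
      (\<forall>M. mechanism d n M \<longrightarrow> diff_private d n \<epsilon> \<delta> M \<longrightarrow>
         (\<forall>\<alpha>::real. \<alpha> \<ge> 0 \<longrightarrow> err_sq d n P M = ennreal (\<alpha>\<^sup>2) \<longrightarrow>
            2 powr (- real d) \<le> \<alpha> \<longrightarrow> \<alpha> \<le> sqrt d / 15 \<longrightarrow>
            real n \<ge> C * (real d)\<^sup>2 / (\<epsilon> * \<alpha>))))"
proof -
  \<comment> \<open>For d < 100 the facts n * \<epsilon> > 1/10 and \<alpha> \<ge> 2^-d \<ge> 2^-100
    give n * \<epsilon> * \<alpha> \<ge> 2^-100 / 10, which is C * 100^2. The bound for large d,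
    with constant 1/100, is weaker than this choice requires.\<close>
  define C :: real where "C = (1 / 10 ^ 5) * (1 / 2 ^ 100)"
  have C: "C > 0" "C \<le> 1 / 100" unfolding C_def by (auto simp: field_simps)
  show ?thesis
  proof (intro exI[of _ C] conjI C(1) allI impI)
    fix d n :: nat and \<epsilon> \<delta> :: real
    assume d: "d \<ge> 1" and n: "n \<ge> 1" and \<epsilon>: "0 < \<epsilon>" "\<epsilon> < 1" and \<delta>0: "\<delta> \<le> 1 / (3 * n * ln (exp 1 * n))"
    have \<delta>: "\<delta> \<le> 1 / (3 * real n)"
    proof -
      have "1 \<le> ln (exp 1 * real n)" using n by (simp add: ln_mult)
      then have "3 * real n * 1 \<le> 3 * real n * ln (exp 1 * real n)" using n by (intro mult_left_mono) auto
      then have "1 / (3 * real n * ln (exp 1 * real n)) \<le> 1 / (3 * real n * 1)" using n by (intro frac_le) auto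
      then have "1 / (3 * real n * ln (exp 1 * real n)) \<le> 1 / (3 * real n)" by simp
      then show ?thesis using \<delta>0 by linarith
    qed
    show "\<exists>P. prob_space P \<and> sets P = sets (mat_space d) \<and> (AE S in P. pos_def d S) \<and>
         emeasure P (W_set d) > 0 \<and>
      (\<forall>M. mechanism d n M \<longrightarrow> diff_private d n \<epsilon> \<delta> M \<longrightarrow>
         (\<forall>\<alpha>::real. \<alpha> \<ge> 0 \<longrightarrow> err_sq d n P M = ennreal (\<alpha>\<^sup>2) \<longrightarrow>
            2 powr (- real d) \<le> \<alpha> \<longrightarrow> \<alpha> \<le> sqrt d / 15 \<longrightarrow>
            real n \<ge> C * (real d)\<^sup>2 / (\<epsilon> * \<alpha>)))"
    proof (cases "d \<ge> 100")
      case True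
      then interpret regression_prior d by unfold_locales
      show ?thesis
      proof (intro exI[of _ cov_prior] conjI prob_space_cov_prior sets_cov_prior AE_pos_def_cov_prior emeasure_cov_prior_W allI impI)
        fix M and \<alpha> :: real
        assume M: "mechanism d n M" and dp: "diff_private d n \<epsilon> \<delta> M" and "\<alpha> \<ge> 0"
          and err: "err_sq d n cov_prior M = ennreal (\<alpha>\<^sup>2)"
          and \<alpha>: "2 powr (- real d) \<le> \<alpha>" "\<alpha> \<le> sqrt d / 15"
        interpret regression_mechanism d n M by unfold_locales (rule M)
        have "C * (real d)\<^sup>2 / (\<epsilon> * \<alpha>) \<le> (1 / 100) * (real d)\<^sup>2 / (\<epsilon> * \<alpha>)"
          using C \<epsilon> \<open>\<alpha> \<ge> 0\<close> by (intro divide_right_mono mult_right_mono) auto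
        then show "C * (real d)\<^sup>2 / (\<epsilon> * \<alpha>) \<le> real n"
          using sample_size_bound[OF dp \<epsilon> n \<delta> err \<alpha>] by linarith
      qed
    next
      case False
      from two_point_prior[OF d n \<epsilon>(1) \<delta>] obtain P where P: "prob_space P" "sets P = sets (mat_space d)" "AE S in P. pos_def d S"
        "emeasure P (W_set d) > 0"
        and small: "real n * \<epsilon> \<le> 1 / 10 \<Longrightarrow> mechanism d n M \<Longrightarrow> diff_private d n \<epsilon> \<delta> M \<Longrightarrow> \<alpha> \<ge> 0 \<Longrightarrow>
          err_sq d n P M = ennreal (\<alpha>\<^sup>2) \<Longrightarrow> \<not> \<alpha> \<le> sqrt d / 15" for M and \<alpha> :: real by blast
      show ?thesis
      proof (intro exI[of _ P] conjI P allI impI)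
        fix M and \<alpha> :: real
        assume M: "mechanism d n M" "diff_private d n \<epsilon> \<delta> M" "\<alpha> \<ge> 0" "err_sq d n P M = ennreal (\<alpha>\<^sup>2)"
          and \<alpha>: "2 powr (- real d) \<le> \<alpha>" "\<alpha> \<le> sqrt d / 15"
        \<comment> \<open>Contrapositive of the two-point bound: an error of at most sqrt d / 15
          forces a privacy budget n * \<epsilon> bounded away from 0, which is all that bounded d
          requires.\<close>
        have big: "real n * \<epsilon> > 1 / 10" using small[OF _ M] \<alpha> by linarith
        have "1 / 2 ^ 100 \<le> (1 / 2 :: real) ^ d"
          using False power_decreasing[of d 100 "1 / 2 :: real"] by (simp add: power_one_over)
        also have "\<dots> = 2 powr (- real d)" by (simp add: powr_minus powr_realpow power_one_over inverse_eq_divide)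
        finally have a: "1 / 2 ^ 100 \<le> \<alpha>" using \<alpha> by linarith
        then have a0: "\<alpha> > 0" by (rule less_le_trans[rotated]) simp
        have "(real d)\<^sup>2 \<le> 100\<^sup>2" using False by (intro power_mono) auto
        then have "C * (real d)\<^sup>2 \<le> C * 100\<^sup>2" using C by (intro mult_left_mono) auto
        also have "\<dots> = 1 / 10 * (1 / 2 ^ 100)" by (simp add: C_def)
        also have "\<dots> \<le> (real n * \<epsilon>) * \<alpha>" using big a by (intro mult_mono) auto
        finally have "C * (real d)\<^sup>2 \<le> real n * (\<epsilon> * \<alpha>)" by (simp add: mult_ac)
        then show "C * (real d)\<^sup>2 / (\<epsilon> * \<alpha>) \<le> real n" using \<epsilon> a0 by (simp add: divide_le_eq)
      qed
    qed
  qed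
qed

end
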